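(* Let $G$ be a finite abelian group, $F$ an algebraically closed field of characteristic zero, and let $R=\bigoplus_{g\in G}R^{(g)}$ be a $G$-graded algebra which, as an algebra, is the algebra of infinite matrices over $F$ each having only finitely many nonzero entries. Then $R$ is isomorphic, as a $G$-graded algebra, to a graded tensor product $C\otimes D$, where $C$ is the algebra of infinite matrices over $F$ with finitely many nonzero entries endowed with an elementary $G$-grading, and $D=M_n(F)$ is a matrix algebra of some order $n$ with a fine $G$-grading. Additionally, $\mathrm{Supp}\,C\cap\mathrm{Supp}\,D=\{1\}$.
   Context: A $G$-grading on an algebra $R$ is a vector space decomposition $R=\bigoplus_{g\in G}R^{(g)}$ with $R^{(g)}R^{(h)}\subset R^{(gh)}$ for all $g,h\in G$; $\mathrm{Supp}\,R=\{g\in G\mid R^{(g)}\ne0\}$. The identity element of $G$ is $1$. The algebra of finitary matrices is the algebra of matrices over $F$ with rows and columns indexed by $\{1,2,\ldots\}$ having only finitely many nonzero entries; it has as a basis the matrix units $E_{ij}$, $i,j\ge1$. A $G$-grading on this algebra is elementary, defined by a sequence $(g_1,g_2,\ldots)$ of elements of $G$, if its component of degree $g$ is $\mathrm{Span}\{E_{ij}\mid g_i^{-1}g_j=g\}$ for each $g\in G$. A grading on $D=M_n(F)$ is fine if $\dim D^{(g)}=1$ for every $g\in\mathrm{Supp}\,D$. The graded tensor product $C\otimes D$ is the usual tensor product of algebras, with the grading in which $c\otimes d$ has degree $gh$ for $c\in C^{(g)}$, $d\in D^{(h)}$ (equivalently, $E_{ij}\otimes x$ has degree $g_i^{-1}hg_j$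 for $x$ homogeneous of degree $h$). *)

theory Defs
  imports
    "Jordan_Normal_Form.VS_Connect"
    "HOL-Algebra.QuotRing"
    "HOL-Library.Poly_Mapping"
begin

text \<open>
  An algebra over a field of type \<open>'f\<close> is a record of type \<open>('f, 'a) module\<close> with scalar ring
  \<open>class_ring\<close>. Algebras need not be unital: the field \<open>one\<close> of the record has no
  meaning in general; gradings, supports and isomorphisms ignore it.
\<close>

text \<open>Rows and columns are indexed from \<open>0\<close>. The sum is finite by finitariness of the left factor.\<close>

definition finitary_mat :: "'f::field itself \<Rightarrow> ('f, nat \<Rightarrow> nat \<Rightarrow> 'f) module" where
  "finitary_mat ty =
    \<lparr>carrier = {X. finite {(i, j). X i j \<noteq> 0}},
     mult = (\<lambda>X Y i k. \<Sum>j | X i j \<noteq> 0. X i j * Y j k),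
     one = undefined,
     zero = (\<lambda>i j. 0),
     add = (\<lambda>X Y i j. X i j + Y i j),
     smult = (\<lambda>c X i j. c * X i j)\<rparr>"

definition mat_unit :: "nat \<Rightarrow> nat \<Rightarrow> (nat \<Rightarrow> nat \<Rightarrow> 'f::field)" where
  "mat_unit i j = (\<lambda>k l. if k = i \<and> l = j then 1 else 0)"

abbreviation full_mat :: "'f::field itself \<Rightarrow> nat \<Rightarrow> ('f, 'f mat) module" where
  "full_mat ty n \<equiv> module_mat ty n n"

abbreviation lin_span :: "('f::field, 'a) module \<Rightarrow> 'a set \<Rightarrow> 'a set" where
  "lin_span A \<equiv> LinearCombinations.module.span class_ring A"

text \<open>
  Gradings by a finite group \<open>G\<close>; only the values of \<open>R\<close> on \<open>carrier G\<close> matter. The unique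
  existence of the decomposition of each element expresses that the sum of the components is
  everything and is direct.
\<close>

definition grading ::
  "('g, 'm) monoid_scheme \<Rightarrow> ('f::field, 'a) module \<Rightarrow> ('g \<Rightarrow> 'a set) \<Rightarrow> bool" where
  "grading G A R \<longleftrightarrow>
    (\<forall>g\<in>carrier G. VectorSpace.subspace class_ring (R g) A) \<and>
    (\<forall>x\<in>carrier A. \<exists>!c. c \<in> (\<Pi>\<^sub>E g\<in>carrier G. R g) \<and> x = (\<Oplus>\<^bsub>A\<^esub>g\<in>carrier G. c g)) \<and>
    (\<forall>g\<in>carrier G. \<forall>h\<in>carrier G. \<forall>x\<in>R g. \<forall>y\<in>R h. x \<otimes>\<^bsub>A\<^esub> y \<in> R (g \<otimes>\<^bsub>G\<^esub> h))"

definition supp ::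
  "('g, 'm) monoid_scheme \<Rightarrow> ('f::field, 'a) module \<Rightarrow> ('g \<Rightarrow> 'a set) \<Rightarrow> 'g set" where
  "supp G A R = {g \<in> carrier G. R g \<noteq> {\<zero>\<^bsub>A\<^esub>}}"

definition elementary_grading ::
  "('g, 'm) monoid_scheme \<Rightarrow> ('g \<Rightarrow> (nat \<Rightarrow> nat \<Rightarrow> 'f::field) set) \<Rightarrow> bool" where
  "elementary_grading G C \<longleftrightarrow>
    grading G (finitary_mat TYPE('f)) C \<and>
    (\<exists>s :: nat \<Rightarrow> 'g. (\<forall>i. s i \<in> carrier G) \<and>
      (\<forall>g\<in>carrier G. C g =
        lin_span (finitary_mat TYPE('f)) {mat_unit i j | i j. inv\<^bsub>G\<^esub> (s i) \<otimes>\<^bsub>G\<^esub> s j = g}))"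

definition fine_grading ::
  "('g, 'm) monoid_scheme \<Rightarrow> nat \<Rightarrow> ('g \<Rightarrow> 'f::field mat set) \<Rightarrow> bool" where
  "fine_grading G n D \<longleftrightarrow>
    grading G (full_mat TYPE('f) n) D \<and>
    (\<forall>g \<in> supp G (full_mat TYPE('f) n) D.
      vectorspace.dim class_ring ((full_mat TYPE('f) n)\<lparr>carrier := D g\<rparr>) = 1)"

text \<open>
  The tensor product of two algebras is the quotient of the free vector space on
  \<open>carrier A \<times> carrier B\<close>, with the product extending \<open>(a, b) (a', b') = (a a', b b')\<close>
  bilinearly, by the span of the bilinearity relations (which is a two-sided ideal).
  The instance of \<open>times\<close> for \<open>poly_mapping\<close> is a different product and is not used.
\<close>

definition free_alg ::
  "('f::field, 'a) module \<Rightarrow> ('f, 'b) module \<Rightarrow> ('f, ('a \<times> 'b) \<Rightarrow>\<^sub>0 'f) module" where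
  "free_alg A B =
    \<lparr>carrier = {u. Poly_Mapping.keys u \<subseteq> carrier A \<times> carrier B},
     mult = (\<lambda>u v. \<Sum>(a, b)\<in>Poly_Mapping.keys u. \<Sum>(a', b')\<in>Poly_Mapping.keys v.
       Poly_Mapping.single (a \<otimes>\<^bsub>A\<^esub> a', b \<otimes>\<^bsub>B\<^esub> b')
         (Poly_Mapping.lookup u (a, b) * Poly_Mapping.lookup v (a', b'))),
     one = Poly_Mapping.single (\<one>\<^bsub>A\<^esub>, \<one>\<^bsub>B\<^esub>) 1,
     zero = 0,
     add = (+),
     smult = (\<lambda>c. Poly_Mapping.map ((*) c))\<rparr>"

definition bilinear_relations ::
  "('f::field, 'a) module \<Rightarrow> ('f, 'b) module \<Rightarrow> (('a \<times> 'b) \<Rightarrow>\<^sub>0 'f) set" where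
  "bilinear_relations A B =
    (let e = (\<lambda>a b. Poly_Mapping.single (a, b) (1::'f)) in
     {e (a \<oplus>\<^bsub>A\<^esub> a') b - e a b - e a' b | a a' b.
        a \<in> carrier A \<and> a' \<in> carrier A \<and> b \<in> carrier B} \<union>
     {e a (b \<oplus>\<^bsub>B\<^esub> b') - e a b - e a b' | a b b'.
        a \<in> carrier A \<and> b \<in> carrier B \<and> b' \<in> carrier B} \<union>
     {e (c \<odot>\<^bsub>A\<^esub> a) b - Poly_Mapping.map ((*) c) (e a b) | c a b.
        a \<in> carrier A \<and> b \<in> carrier B} \<union>
     {e a (c \<odot>\<^bsub>B\<^esub> b) - Poly_Mapping.map ((*) c) (e a b) | c a b.
        a \<in> carrier A \<and> b \<in> carrier B})"

definition bilinear_ideal ::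
  "('f::field, 'a) module \<Rightarrow> ('f, 'b) module \<Rightarrow> (('a \<times> 'b) \<Rightarrow>\<^sub>0 'f) set" where
  "bilinear_ideal A B = lin_span (free_alg A B) (bilinear_relations A B)"

definition tensor_alg ::
  "('f::field, 'a) module \<Rightarrow> ('f, 'b) module \<Rightarrow> ('f, (('a \<times> 'b) \<Rightarrow>\<^sub>0 'f) set) module" where
  "tensor_alg A B =
    (let F = free_alg A B; N = bilinear_ideal A B in
     \<lparr>carrier = a_rcosets\<^bsub>F\<^esub> N,
      mult = rcoset_mult F N,
      one = N +>\<^bsub>F\<^esub> \<one>\<^bsub>F\<^esub>,
      zero = N,
      add = set_add F,
      smult = (\<lambda>c X. \<Union>u\<in>X. N +>\<^bsub>F\<^esub> (c \<odot>\<^bsub>F\<^esub> u))\<rparr>)"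

definition tensor_elem ::
  "('f::field, 'a) module \<Rightarrow> ('f, 'b) module \<Rightarrow> 'a \<Rightarrow> 'b \<Rightarrow> (('a \<times> 'b) \<Rightarrow>\<^sub>0 'f) set" where
  "tensor_elem A B a b = bilinear_ideal A B +>\<^bsub>free_alg A B\<^esub> Poly_Mapping.single (a, b) 1"

definition tensor_grading ::
  "('g, 'm) monoid_scheme \<Rightarrow> ('f::field, 'a) module \<Rightarrow> ('g \<Rightarrow> 'a set) \<Rightarrow>
    ('f, 'b) module \<Rightarrow> ('g \<Rightarrow> 'b set) \<Rightarrow> 'g \<Rightarrow> (('a \<times> 'b) \<Rightarrow>\<^sub>0 'f) set set" where
  "tensor_grading G A C B D k =
    lin_span (tensor_alg A B)
      {tensor_elem A B c d | c d g h.
        g \<in> carrier G \<and> h \<in> carrier G \<and> c \<in> C g \<and> d \<in> D h \<and> g \<otimes>\<^bsub>G\<^esub> h = k}"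

definition alg_iso :: "('f::field, 'a) module \<Rightarrow> ('f, 'b) module \<Rightarrow> ('a \<Rightarrow> 'b) set" where
  "alg_iso A B = {f \<in> LinearCombinations.module_hom class_ring A B.
    bij_betw f (carrier A) (carrier B) \<and>
    (\<forall>x\<in>carrier A. \<forall>y\<in>carrier A. f (x \<otimes>\<^bsub>A\<^esub> y) = f x \<otimes>\<^bsub>B\<^esub> f y)}"

definition graded_isomorphic ::
  "('g, 'm) monoid_scheme \<Rightarrow> ('f::field, 'a) module \<Rightarrow> ('g \<Rightarrow> 'a set) \<Rightarrow>
    ('f, 'b) module \<Rightarrow> ('g \<Rightarrow> 'b set) \<Rightarrow> bool" where
  "graded_isomorphic G A R B S \<longleftrightarrow>
    (\<exists>f \<in> alg_iso A B. \<forall>g\<in>carrier G. f ` R g = S g)"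

lemma vectorspace_finitary_mat: "vectorspace class_ring (finitary_mat TYPE('f::field))"
proof -
  have add: "finite {(i, j). X i j + Y i j \<noteq> 0}"
    if "finite {(i, j). X i j \<noteq> 0}" "finite {(i, j). Y i j \<noteq> 0}"
    for X Y :: "nat \<Rightarrow> nat \<Rightarrow> 'f"
    by (rule finite_subset[OF _ finite_UnI[OF that]]) auto
  have "\<exists>Y. finite {(i, j). Y i j \<noteq> 0} \<and> (\<lambda>i j. Y i j + X i j) = (\<lambda>i j. 0)"
    if "finite {(i, j). X i j \<noteq> 0}" for X :: "nat \<Rightarrow> nat \<Rightarrow> 'f"
    using that by (intro exI[of _ "\<lambda>i j. - X i j"]) auto
  then have "abelian_group (finitary_mat TYPE('f))"
    by (intro abelian_groupI) (auto simp: finitary_mat_def add ac_simps)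
  then have "Module.module class_ring (finitary_mat TYPE('f))"
  proof (intro Module.module.intro Module.module_axioms.intro)
    show "cring (class_ring :: 'f ring)"
      ..
    fix c :: 'f and X
    assume "X \<in> carrier (finitary_mat TYPE('f))"
    then show "c \<odot>\<^bsub>finitary_mat TYPE('f)\<^esub> X \<in> carrier (finitary_mat TYPE('f))"
      by (cases "c = 0") (auto simp: finitary_mat_def)
  qed (auto simp: finitary_mat_def algebra_simps)
  then show ?thesis
    by (intro vectorspace.intro class_field.field_axioms)
qed

end

theory Submission
  imports Defs "HOL-Library.Countable_Set"
begin

text \<open>
  Every homogeneous element of degree \<open>g\<close> has a power of degree \<open>1\<close>, and nilpotent finitary matrices
  have trace \<open>0\<close>, so the component \<open>R\<^sub>1\<close> is not nil and contains an idempotent; let \<open>e\<close> be a minimal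
  one. Nondegeneracy of the trace form shows that nonzero homogeneous elements of \<open>e R e\<close> are not
  nilpotent, and by minimality of \<open>e\<close> they are then invertible; as the field is algebraically closed,
  \<open>e R e\<close> is a matrix algebra with a fine grading whose support is a subgroup \<open>H\<close>.
  A Gram-Schmidt process produces homogeneous \<open>u\<^sub>i \<in> e R\<close> and \<open>v\<^sub>i \<in> R e\<close> with \<open>u\<^sub>i v\<^sub>j = \<delta>\<^sub>i\<^sub>j e\<close> such
  that the idempotents \<open>\<Sum>i<k. v\<^sub>i u\<^sub>i\<close> eventually fix every element of \<open>R\<close>. Then
  \<open>E\<^sub>i\<^sub>j \<otimes> d \<mapsto> v\<^sub>i d u\<^sub>j\<close> is the isomorphism, and the elementary grading is given by the degrees of
  the \<open>u\<^sub>i\<close>, which can be chosen in a fixed transversal of \<open>H\<close>.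
\<close>

section \<open>Row-finite matrices\<close>

text \<open>The algebra has infinite dimension and no unit, so finite-dimensional arguments take
  place in finite blocks, in particular in \<open>e R e\<close>. The rest of \<open>R\<close> is
  reached from there through primeness: for nonzero \<open>x\<close> and \<open>y\<close> some
  matrix unit \<open>E j k\<close> has \<open>x * E j k * y \<noteq> 0\<close>, hence so has one of
  its homogeneous components. That component supplies the dual partner of a given homogeneous row or
  column.

  A local unit must fix elements from both sides, so the Gram-Schmidt process alternates between
  rows in \<open>e R\<close> and columns in \<open>R e\<close>. The vectors to absorb are the
  homogeneous components of \<open>e * E b j\<close> and \<open>E i a * e\<close> for a fixed
  nonzero entry \<open>(a, b)\<close> of \<open>e\<close>; as \<open>G\<close> is finite they are
  countably many. A step with nothing to absorb still adds a pair, since \<open>C\<close> needs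
  infinitely many indices.

  Commutativity of \<open>G\<close> turns the degree \<open>s_i^-1 h s_j\<close> of
  \<open>v_i d u_j\<close> into \<open>(s_i^-1 s_j) h\<close>, the degree of
  \<open>E_ij \<otimes> d\<close>. As \<open>Supp C\<close> consists of the quotients
  \<open>s_i^-1 s_j\<close> and \<open>Supp D = H\<close>, the transversal forces the trivial
  intersection.\<close>

text \<open>
  The finitary matrices are studied inside a unital ring, so that \<open>1 - x\<close> and polynomials in a
  matrix make sense.
\<close>

typedef (overloaded) 'f rmat = "{X :: nat \<Rightarrow> nat \<Rightarrow> 'f::field. \<forall>i. finite {j. X i j \<noteq> 0}}"
  morphisms entry Rmat
  by (rule exI[of _ "\<lambda>i j. 0"]) simp

setup_lifting type_definition_rmat

lemma finite_row: "finite {j. entry x i j \<noteq> 0}"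
  using entry by blast

lemma rmat_eqI: "(\<And>i j. entry x i j = entry y i j) \<Longrightarrow> x = y"
  by (metis entry_inject ext)

instantiation rmat :: (field) ring_1
begin

lift_definition zero_rmat :: "'a rmat" is "\<lambda>i j. 0"
  by simp

lift_definition one_rmat :: "'a rmat" is "\<lambda>i j. if i = j then 1 else 0"
  by simp

lift_definition plus_rmat :: "'a rmat \<Rightarrow> 'a rmat \<Rightarrow> 'a rmat" is "\<lambda>x y i j. x i j + y i j"
  subgoal premises prems for x y i
  proof -
    have "{j. x i j + y i j \<noteq> 0} \<subseteq> {j. x i j \<noteq> 0} \<union> {j. y i j \<noteq> 0}"
      by auto
    then show ?thesis
      by (rule finite_subset) (use prems in simp)
  qed
  done

lift_definition uminus_rmat :: "'a rmat \<Rightarrow> 'a rmat" is "\<lambda>x i j. - x i j"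
  by simp

definition minus_rmat :: "'a rmat \<Rightarrow> 'a rmat \<Rightarrow> 'a rmat" where
  "minus_rmat x y = x + - y"

lift_definition times_rmat :: "'a rmat \<Rightarrow> 'a rmat \<Rightarrow> 'a rmat"
  is "\<lambda>x y i k. \<Sum>j | x i j \<noteq> 0. x i j * y j k"
  subgoal premises prems for x y i
  proof -
    have "{k. (\<Sum>j | x i j \<noteq> 0. x i j * y j k) \<noteq> 0} \<subseteq> (\<Union>j\<in>{j. x i j \<noteq> 0}. {k. y j k \<noteq> 0})"
      by (rule subsetI, drule CollectD, erule sum.not_neutral_contains_not_neutral) auto
    then show ?thesis
      by (rule finite_subset) (use prems in auto)
  qed
  done

text \<open>The natural range of summation is the support of one row. Enlarging it to any finite
  \<open>J\<close> gives several products a common range, as the ring axioms below require.\<close>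

lemma entry_times:
  "finite J \<Longrightarrow> (\<And>j. entry x i j \<noteq> 0 \<Longrightarrow> j \<in> J) \<Longrightarrow>
    entry (x * y) i k = (\<Sum>j\<in>J. entry x i j * entry y j k)"
  unfolding times_rmat.rep_eq by (rule sum.mono_neutral_left) auto

instance
proof
  fix a b c :: "'a rmat"
  show "a * b * c = a * (b * c)"
  proof (rule rmat_eqI)
    fix i k
    let ?J = "{j. entry a i j \<noteq> 0}"
    \<comment> \<open>\<open>?L\<close> contains the support of row \<open>i\<close> of
      \<open>a * b\<close> and of each row of \<open>b\<close> with index in \<open>?J\<close>, so
      both bracketings become the same double sum over \<open>?J\<close> and
      \<open>?L\<close>.\<close>
    let ?L = "(\<Union>j\<in>?J. {l. entry b j l \<noteq> 0})"
    have L: "finite ?L"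
      using finite_row by blast
    have ab: "entry (a * b) i l = (\<Sum>j\<in>?J. entry a i j * entry b j l)" for l
      by (rule entry_times) (auto simp: finite_row)
    have "entry (a * b * c) i k = (\<Sum>l\<in>?L. entry (a * b) i l * entry c l k)"
      by (rule entry_times[OF L], unfold ab, erule sum.not_neutral_contains_not_neutral) auto
    also have "\<dots> = (\<Sum>j\<in>?J. entry a i j * (\<Sum>l\<in>?L. entry b j l * entry c l k))"
      unfolding ab sum_distrib_left sum_distrib_right by (subst sum.swap) (simp add: mult.assoc)
    also have "\<dots> = (\<Sum>j\<in>?J. entry a i j * entry (b * c) j k)"
      by (rule sum.cong[OF refl], subst entry_times[OF L, of b]) auto
    also have "\<dots> = entry (a * (b * c)) i k"
      by (rule entry_times[symmetric]) (auto simp: finite_row)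
    finally show "entry (a * b * c) i k = entry (a * (b * c)) i k" .
  qed
  show "1 * a = a"
  proof (rule rmat_eqI)
    show "entry (1 * a) i k = entry a i k" for i k
      by (subst entry_times[of "{i}"]) (auto simp: one_rmat.rep_eq split: if_splits)
  qed
  show "a * 1 = a"
  proof (rule rmat_eqI)
    show "entry (a * 1) i k = entry a i k" for i k
      by (subst entry_times[of "insert k {j. entry a i j \<noteq> 0}"])
        (auto simp: one_rmat.rep_eq finite_row if_distrib cong: if_cong)
  qed
  show "(a + b) * c = a * c + b * c"
  proof (rule rmat_eqI)
    fix i k
    let ?J = "{j. entry a i j \<noteq> 0} \<union> {j. entry b i j \<noteq> 0}"
    have J: "finite ?J"
      by (simp add: finite_row)
    have "entry ((a + b) * c) i k = (\<Sum>j\<in>?J. entry (a + b) i j * entry c j k)"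
      by (rule entry_times[OF J]) (auto simp: plus_rmat.rep_eq)
    moreover have "entry (a * c) i k = (\<Sum>j\<in>?J. entry a i j * entry c j k)"
      "entry (b * c) i k = (\<Sum>j\<in>?J. entry b i j * entry c j k)"
      by (auto intro: entry_times[OF J])
    ultimately show "entry ((a + b) * c) i k = entry (a * c + b * c) i k"
      by (simp add: plus_rmat.rep_eq sum.distrib algebra_simps)
  qed
  show "a * (b + c) = a * b + a * c"
    by (rule rmat_eqI) (simp add: times_rmat.rep_eq plus_rmat.rep_eq sum.distrib algebra_simps)
  have "entry (0 :: 'a rmat) 0 0 \<noteq> entry 1 0 0"
    by (simp add: zero_rmat.rep_eq one_rmat.rep_eq)
  then show "(0 :: 'a rmat) \<noteq> 1"
    by metis
qed (rule rmat_eqI;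
    simp add: minus_rmat_def plus_rmat.rep_eq zero_rmat.rep_eq uminus_rmat.rep_eq algebra_simps)+

end

section \<open>Scalar multiplication and matrix units\<close>

lift_definition smul :: "'f::field \<Rightarrow> 'f rmat \<Rightarrow> 'f rmat" is "\<lambda>c x i j. c * x i j"
  subgoal premises prems for c x i
    by (rule finite_subset[OF _ prems[of i]]) auto
  done

global_interpretation rmat: vector_space smul
  by unfold_locales (rule rmat_eqI; simp add: smul.rep_eq plus_rmat.rep_eq algebra_simps)+

lemma smul_mult [simp]: "smul c x * y = smul c (x * y)"
proof (rule rmat_eqI)
  show "entry (smul c x * y) i k = entry (smul c (x * y)) i k" for i k
    by (subst entry_times[of "{j. entry x i j \<noteq> 0}"])
      (auto simp: finite_row smul.rep_eq times_rmat.rep_eq sum_distrib_left mult.assoc)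
qed

lemma mult_smul [simp]: "x * smul c y = smul c (x * y)"
  by (rule rmat_eqI) (simp add: smul.rep_eq times_rmat.rep_eq sum_distrib_left mult.left_commute)

lemma entry_sum: "entry (\<Sum>a\<in>A. f a) i j = (\<Sum>a\<in>A. entry (f a) i j)"
  by (induction A rule: infinite_finite_induct) (auto simp: zero_rmat.rep_eq plus_rmat.rep_eq)

lemma entry_diff: "entry (x - y) i j = entry x i j - entry y i j"
  unfolding minus_rmat_def plus_rmat.rep_eq uminus_rmat.rep_eq by simp

lemmas entry_simps = zero_rmat.rep_eq plus_rmat.rep_eq uminus_rmat.rep_eq smul.rep_eq entry_sum
  entry_diff

lift_definition E :: "nat \<Rightarrow> nat \<Rightarrow> 'f::field rmat" is mat_unit
  by (auto simp: mat_unit_def intro: finite_subset[of _ "{j}" for j])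

lemma entry_E: "entry (E i j) k l = (if k = i \<and> l = j then 1 else 0)"
  by (simp add: E.rep_eq mat_unit_def)

lemma entry_E_mult: "entry (E a b * x) i k = (if i = a then entry x b k else 0)"
  by (subst entry_times[of "{b}"]) (auto simp: entry_E split: if_splits)

lemma entry_mult_E: "entry (x * E a b) i k = (if k = b then entry x i a else 0)"
  by (subst entry_times[of "insert a {j. entry x i j \<noteq> 0}"])
    (auto simp: entry_E finite_row if_distrib cong: if_cong)

lemma E_mult_E: "E a b * E c d = (if b = c then E a d else 0)"
  by (rule rmat_eqI) (simp add: entry_mult_E entry_E entry_simps)

lemma E_sandwich: "E a i * x * E j b = smul (entry x i j) (E a b)"
  by (rule rmat_eqI) (auto simp: entry_mult_E entry_E_mult entry_E entry_simps)

text \<open>Primeness in coordinates: sandwiching with \<open>E 0 k\<close> and \<open>E l 0\<close>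
  turns the product into this scalar times \<open>E 0 0\<close>. Read contrapositively, nonzero
  entries of \<open>x\<close> and \<open>y\<close> name a matrix unit that gives a nonzero product
  between them.\<close>

lemma mult_E_mult_eq_0D: "x * E i j * y = 0 \<Longrightarrow> entry x k i * entry y j l = 0"
proof -
  assume "x * E i j * y = 0"
  then have "entry (E 0 k * x * E i j * y * E l 0) 0 0 = 0"
    by (simp add: mult.assoc entry_simps)
  moreover have "E 0 k * x * E i j * y * E l 0 = smul (entry x k i) (E 0 j * y * E l 0)"
    by (simp add: E_sandwich)
  ultimately show ?thesis
    by (simp add: E_sandwich entry_simps entry_E)
qed

lemma E_nonzero [simp]: "E a b \<noteq> 0"
proof
  assume "E a b = (0 :: 'a rmat)"
  then have "entry (E a b) a b = (0::'a)"
    by (simp add: entry_simps)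
  then show False
    by (simp add: entry_E)
qed

lemma rmat_neq_0E:
  assumes "x \<noteq> 0" obtains i j where "entry x i j \<noteq> 0"
  using assms rmat_eqI[of x 0] by (auto simp: entry_simps)

section \<open>Finitary matrices as the union of finite square blocks\<close>

definition Fin :: "'f::field rmat set" where
  "Fin = {x. finite {(i, j). entry x i j \<noteq> 0}}"

definition corner :: "nat \<Rightarrow> 'f::field rmat set" where
  "corner N = {x. \<forall>i j. entry x i j \<noteq> 0 \<longrightarrow> i < N \<and> j < N}"

lemma corner_mono: "M \<le> N \<Longrightarrow> corner M \<subseteq> corner N"
  by (force simp: corner_def)

lemma Fin_corner: "Fin = (\<Union>N. corner N)"
proof (intro equalityI subsetI)
  fix x :: "'a rmat" assume "x \<in> Fin"
  then have fin: "finite {(i, j). entry x i j \<noteq> 0}"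
    by (simp add: Fin_def)
  let ?A = "fst ` {(i, j). entry x i j \<noteq> 0} \<union> snd ` {(i, j). entry x i j \<noteq> 0}"
  from fin have "finite ?A"
    by simp
  then obtain N where "\<forall>k\<in>?A. k < N"
    using finite_nat_set_iff_bounded by blast
  then have "i < N \<and> j < N" if "entry x i j \<noteq> 0" for i j
    using that by (metis (mono_tags, lifting) UnCI case_prodI fst_conv image_eqI mem_Collect_eq snd_conv)
  then show "x \<in> (\<Union>N. corner N)"
    by (auto simp: corner_def)
next
  fix x :: "'a rmat" assume "x \<in> (\<Union>N. corner N)"
  then obtain N where "x \<in> corner N" by blast
  then have "{(i, j). entry x i j \<noteq> 0} \<subseteq> {..<N} \<times> {..<N}"
    by (auto simp: corner_def)
  then show "x \<in> Fin"
    unfolding Fin_def by (auto intro: finite_subset)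
qed

lemma corner_Fin: "x \<in> corner N \<Longrightarrow> x \<in> Fin"
  by (auto simp: Fin_corner)

lemma FinE: assumes "x \<in> Fin" obtains N where "x \<in> corner N"
  using assms by (auto simp: Fin_corner)

lemma FinE2: assumes "x \<in> Fin" "y \<in> Fin" obtains N where "x \<in> corner N" "y \<in> corner N"
proof -
  obtain M N where "x \<in> corner M" "y \<in> corner N"
    using assms by (meson FinE)
  then have "x \<in> corner (max M N)" "y \<in> corner (max M N)"
    using corner_mono[of M "max M N"] corner_mono[of N "max M N"] by auto
  then show ?thesis
    by (rule that)
qed

lemma subspace_corner: "rmat.subspace (corner N)"
proof (rule rmat.subspaceI)
  fix x y :: "'a rmat" assume "x \<in> corner N" "y \<in> corner N"
  then show "x + y \<in> corner N"
    unfolding corner_def plus_rmat.rep_eq mem_Collect_eq by (metis add.right_neutral)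
qed (auto simp: corner_def entry_simps)

lemma corner_mult: "x \<in> corner N \<Longrightarrow> y \<in> corner N \<Longrightarrow> x * y \<in> corner N"
proof -
  assume *: "x \<in> corner N" "y \<in> corner N"
  then have prod: "entry (x * y) i k = (\<Sum>j<N. entry x i j * entry y j k)" for i k
    by (intro entry_times) (auto simp: corner_def)
  show "x * y \<in> corner N"
    unfolding corner_def prod mem_Collect_eq
    by (clarify, erule sum.not_neutral_contains_not_neutral) (use * in \<open>auto simp: corner_def\<close>)
qed

lemma entry_mult_corner:
  "x \<in> corner N \<Longrightarrow> entry (x * y) i k = (\<Sum>j<N. entry x i j * entry y j k)"
  by (intro entry_times) (auto simp: corner_def)

lemma subspace_Fin: "rmat.subspace Fin"
proof (rule rmat.subspaceI)
  show "0 \<in> Fin"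
    by (simp add: Fin_def entry_simps)
next
  fix x y :: "'a rmat" assume "x \<in> Fin" "y \<in> Fin"
  then obtain N where "x \<in> corner N" "y \<in> corner N"
    by (rule FinE2)
  then show "x + y \<in> Fin"
    by (intro corner_Fin rmat.subspace_add[OF subspace_corner])
next
  fix c and x :: "'a rmat" assume "x \<in> Fin"
  then obtain N where "x \<in> corner N"
    by (rule FinE)
  then show "smul c x \<in> Fin"
    by (intro corner_Fin rmat.subspace_scale[OF subspace_corner])
qed

lemma Fin_mult [intro, simp]: "x \<in> Fin \<Longrightarrow> y \<in> Fin \<Longrightarrow> x * y \<in> Fin"
  by (erule (1) FinE2) (blast intro: corner_Fin corner_mult)

lemma Fin_add [intro, simp]: "x \<in> Fin \<Longrightarrow> y \<in> Fin \<Longrightarrow> x + y \<in> Fin"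
  by (rule rmat.subspace_add[OF subspace_Fin])

lemma Fin_diff [intro, simp]: "x \<in> Fin \<Longrightarrow> y \<in> Fin \<Longrightarrow> x - y \<in> Fin"
  by (rule rmat.subspace_diff[OF subspace_Fin])

lemma Fin_smul [intro, simp]: "x \<in> Fin \<Longrightarrow> smul c x \<in> Fin"
  by (rule rmat.subspace_scale[OF subspace_Fin])

lemma Fin_0 [intro, simp]: "0 \<in> Fin"
  by (rule rmat.subspace_0[OF subspace_Fin])

lemma Fin_sum [intro]: "(\<And>a. a \<in> A \<Longrightarrow> f a \<in> Fin) \<Longrightarrow> sum f A \<in> Fin"
  by (rule rmat.subspace_sum[OF subspace_Fin])

lemma Fin_E [intro, simp]: "E i j \<in> Fin"
  by (rule corner_Fin[of _ "Suc (max i j)"]) (auto simp: corner_def entry_E split: if_splits)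

lemma corner_expand:
  "x \<in> corner N \<Longrightarrow> x = (\<Sum>i<N. \<Sum>j<N. smul (entry x i j) (E i j))"
proof (rule rmat_eqI)
  fix k l assume x: "x \<in> corner N"
  have "entry (\<Sum>i<N. \<Sum>j<N. smul (entry x i j) (E i j)) k l =
      (\<Sum>i<N. \<Sum>j<N. if i = k then if j = l then entry x i j else 0 else 0)"
    by (simp add: entry_simps entry_E) (intro sum.cong, auto)
  also have "\<dots> = (\<Sum>i<N. if i = k then if l < N then entry x i l else 0 else 0)"
    by (rule sum.cong) auto
  also have "\<dots> = entry x k l"
    using x by (auto simp: corner_def)
  finally show "entry x k l = entry (\<Sum>i<N. \<Sum>j<N. smul (entry x i j) (E i j)) k l"
    by simp
qed

lemma Fin_induct:
  assumes "rmat.subspace K" "\<And>i j. E i j \<in> K" "x \<in> Fin"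
  shows "x \<in> K"
proof -
  obtain N where "x \<in> corner N"
    using assms(3) by (rule FinE)
  then have "x = (\<Sum>i<N. \<Sum>j<N. smul (entry x i j) (E i j))"
    by (rule corner_expand)
  also have "\<dots> \<in> K"
    by (intro rmat.subspace_sum rmat.subspace_scale assms)
  finally show ?thesis .
qed

lemma corner_span: "corner N \<subseteq> rmat.span ((\<lambda>(i, j). E i j) ` ({..<N} \<times> {..<N}))"
proof
  fix x :: "'a rmat" assume "x \<in> corner N"
  then have "x = (\<Sum>i<N. \<Sum>j<N. smul (entry x i j) (E i j))"
    by (rule corner_expand)
  also have "\<dots> \<in> rmat.span ((\<lambda>(i, j). E i j) ` ({..<N} \<times> {..<N}))"
    by (intro rmat.span_sum rmat.span_scale rmat.span_base) force
  finally show "x \<in> rmat.span ((\<lambda>(i, j). E i j) ` ({..<N} \<times> {..<N}))" .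
qed

lemma independent_corner_card:
  assumes "rmat.independent B" "B \<subseteq> corner N"
  shows "finite B \<and> card B \<le> N * N"
proof -
  let ?T = "(\<lambda>(i, j). E i j :: 'a rmat) ` ({..<N} \<times> {..<N})"
  have "finite B \<and> card B \<le> card ?T"
    using assms(2) corner_span by (intro rmat.independent_span_bound assms(1)) (simp_all, rule subset_trans)
  moreover have "card ?T \<le> N * N"
    using card_image_le[of "{..<N} \<times> {..<N}" "\<lambda>(i, j). E i j :: 'a rmat"] by simp
  ultimately show ?thesis by linarith
qed

text \<open>Linear dependence of a set ignores repetitions in a family, hence two cases: an
  injective family of \<open>N * N + 1\<close> members exceeds the dimension of the block, and a
  repeated value gives the relation \<open>f a - f b = 0\<close>.\<close>

lemma corner_dependent_family:
  fixes f :: "nat \<Rightarrow> 'f::field rmat"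
  assumes "\<And>k. f k \<in> corner N"
  obtains c k where "k \<le> N * N" "c k \<noteq> 0" "(\<Sum>i\<le>N * N. smul (c i) (f i)) = 0"
proof (cases "inj_on f {..N * N}")
  case True
  have "rmat.dependent (f ` {..N * N})"
  proof (rule ccontr)
    assume "\<not> rmat.dependent (f ` {..N * N})"
    then have "card (f ` {..N * N}) \<le> N * N"
      using independent_corner_card[of "f ` {..N * N}" N] assms image_subsetI[of _ f "corner N"] by simp
    then show False
      using True by (simp add: card_image)
  qed
  then obtain u k where u: "k \<le> N * N" "u (f k) \<noteq> 0" "(\<Sum>v\<in>f ` {..N * N}. smul (u v) v) = 0"
    by (subst (asm) rmat.dependent_finite) (simp, blast)
  then have "(\<Sum>i\<le>N * N. smul (u (f i)) (f i)) = 0"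
    by (simp add: sum.reindex[OF True])
  with u show thesis
    by (intro that[of k "\<lambda>i. u (f i)"])
next
  case False
  then obtain a b where ab: "a \<le> N * N" "b \<le> N * N" "a \<noteq> b" "f a = f b"
    by (auto simp: inj_on_def)
  let ?c = "\<lambda>i. if i = a then 1 else if i = b then - 1 else 0 :: 'f"
  have "(\<Sum>i\<le>N * N. smul (?c i) (f i)) =
      (\<Sum>i\<le>N * N. (if i = a then f a else 0) - (if i = b then f b else 0))"
    using ab by (intro sum.cong) auto
  also have "\<dots> = 0"
    using ab by (simp add: sum_subtractf)
  finally show thesis
    using ab that[of a ?c] by simp
qed

section \<open>The trace form\<close>

definition tr :: "'f::field rmat \<Rightarrow> 'f" where
  "tr x = (\<Sum>i | entry x i i \<noteq> 0. entry x i i)"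

lemma tr_corner: "x \<in> corner N \<Longrightarrow> tr x = (\<Sum>i<N. entry x i i)"
  unfolding tr_def by (rule sum.mono_neutral_left) (auto simp: corner_def)

lemma tr_mult_commute: "x \<in> Fin \<Longrightarrow> y \<in> Fin \<Longrightarrow> tr (x * y) = tr (y * x)"
proof -
  assume "x \<in> Fin" "y \<in> Fin"
  then obtain N where N: "x \<in> corner N" "y \<in> corner N"
    by (rule FinE2)
  then have "tr (x * y) = (\<Sum>i<N. \<Sum>j<N. entry x i j * entry y j i)"
    by (simp add: tr_corner[OF corner_mult] entry_mult_corner)
  also have "\<dots> = (\<Sum>j<N. \<Sum>i<N. entry y j i * entry x i j)"
    by (subst sum.swap) (simp add: mult.commute)
  also have "\<dots> = tr (y * x)"
    using N by (simp add: tr_corner[OF corner_mult] entry_mult_corner)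
  finally show ?thesis .
qed

lemma tr_add: "x \<in> Fin \<Longrightarrow> y \<in> Fin \<Longrightarrow> tr (x + y) = tr x + tr y"
proof -
  assume "x \<in> Fin" "y \<in> Fin"
  then obtain N where N: "x \<in> corner N" "y \<in> corner N"
    by (rule FinE2)
  then show ?thesis
    using tr_corner[OF rmat.subspace_add[OF subspace_corner N]]
    by (simp add: tr_corner entry_simps sum.distrib)
qed

lemma tr_0: "tr 0 = 0"
  by (simp add: tr_def entry_simps)

lemma tr_sum: "(\<And>a. a \<in> A \<Longrightarrow> f a \<in> Fin) \<Longrightarrow> tr (sum f A) = (\<Sum>a\<in>A. tr (f a))"
  by (induction A rule: infinite_finite_induct) (auto simp: tr_0 tr_add Fin_sum)

lemma tr_mult_E: "tr (x * E i j) = entry x j i"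
proof -
  have "{k. entry (x * E i j) k k \<noteq> 0} \<subseteq> {j}"
    by (auto simp: entry_mult_E split: if_splits)
  then show ?thesis
    unfolding tr_def by (subst sum.mono_neutral_left[of "{j}"]) (auto simp: entry_mult_E)
qed

text \<open>The trace of \<open>x * E i j\<close> is the entry of \<open>x\<close> at
  \<open>(j, i)\<close>, so the matrix units alone already detect \<open>x\<close>.\<close>

lemma tr_nondegenerate: "(\<And>y. y \<in> Fin \<Longrightarrow> tr (x * y) = 0) \<Longrightarrow> x = 0"
  by (rule rmat_eqI) (metis Fin_E tr_mult_E zero_rmat.rep_eq)

subsection \<open>Von Neumann regularity\<close>

text \<open>McCoy's lemma on von Neumann regular elements.\<close>

lemma regular_if_regular_diff:
  fixes x y z :: "'a::ring_1"
  assumes "x - x * y * x = (x - x * y * x) * z * (x - x * y * x)"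
  shows "x = x * (y + (1 - y * x) * z * (1 - x * y)) * x"
  using assms by (simp add: algebra_simps)

text \<open>The number of nonzero rows stands in for the rank as an induction measure: elimination
  with one pivot lowers it.\<close>

definition nonzero_rows :: "'f::field rmat \<Rightarrow> nat set" where
  "nonzero_rows x = {i. \<exists>j. entry x i j \<noteq> 0}"

lemma finite_nonzero_rows: "x \<in> Fin \<Longrightarrow> finite (nonzero_rows x)"
proof -
  assume "x \<in> Fin"
  then have "finite (fst ` {(i, j). entry x i j \<noteq> 0})"
    by (auto simp: Fin_def)
  moreover have "nonzero_rows x \<subseteq> fst ` {(i, j). entry x i j \<noteq> 0}"
    by (force simp: nonzero_rows_def)
  ultimately show ?thesis
    by (rule rev_finite_subset)
qed

text \<open>Gaussian elimination with pivot \<open>(a, b)\<close>: the subtracted product is column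
  \<open>b\<close> times row \<open>a\<close>, divided by the pivot. Row \<open>a\<close> becomes
  zero, and zero rows stay zero.\<close>

lemma rank_one_reduction_rows:
  assumes "x \<in> Fin" and "entry x a b \<noteq> 0"
  shows "card (nonzero_rows (x - x * smul (inverse (entry x a b)) (E b a) * x)) < card (nonzero_rows x)"
proof (rule psubset_card_mono[OF finite_nonzero_rows[OF assms(1)]])
  let ?x' = "x - x * smul (inverse (entry x a b)) (E b a) * x"
  have entry: "entry ?x' i j = entry x i j - entry x i b * entry x a j / entry x a b" for i j
  proof -
    have "entry (x * E b a * x) i j = entry (x * (E b a * x)) i j"
      by (simp add: mult.assoc)
    also have "\<dots> = (\<Sum>k\<in>insert b {k. entry x i k \<noteq> 0}. entry x i k * entry (E b a * x) k j)"
      by (rule entry_times) (auto simp: finite_row)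
    also have "\<dots> = (\<Sum>k\<in>insert b {k. entry x i k \<noteq> 0}. if k = b then entry x i b * entry x a j else 0)"
      by (rule sum.cong) (auto simp: entry_E_mult)
    also have "\<dots> = entry x i b * entry x a j"
      by (simp add: finite_row)
    finally show ?thesis
      by (simp add: entry_simps divide_inverse mult_ac)
  qed
  have "a \<in> nonzero_rows x" "a \<notin> nonzero_rows ?x'"
    using assms(2) by (auto simp: nonzero_rows_def entry simp del: smul_mult mult_smul)
  moreover have "nonzero_rows ?x' \<subseteq> nonzero_rows x"
    unfolding nonzero_rows_def entry by (clarify, rule ccontr) simp
  ultimately show "nonzero_rows ?x' \<subset> nonzero_rows x"
    by blast
qed

lemma Fin_regular: "x \<in> Fin \<Longrightarrow> \<exists>y\<in>Fin. x = x * y * x"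
proof (induction "card (nonzero_rows x)" arbitrary: x rule: less_induct)
  case less
  show ?case
  proof (cases "x = 0")
    case False
    then obtain a b where ab: "entry x a b \<noteq> 0"
      by (rule rmat_neq_0E)
    define y where "y = smul (inverse (entry x a b)) (E b a)"
    have y: "y \<in> Fin"
      by (simp add: y_def)
    have "x - x * y * x \<in> Fin"
      using y less.prems by auto
    then obtain z where z: "z \<in> Fin" "x - x * y * x = (x - x * y * x) * z * (x - x * y * x)"
      using less.hyps[of "x - x * y * x"] rank_one_reduction_rows[OF less.prems ab]
      by (auto simp: y_def)
    let ?w = "y + (1 - y * x) * z * (1 - x * y)"
    \<comment> \<open>The identity matrix is not finitary; the expanded form shows that the inner
      inverse \<open>?w\<close> is.\<close>
    have "?w = y + (z - y * x * z - z * x * y + y * x * z * x * y)"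
      by (simp add: algebra_simps)
    also have "\<dots> \<in> Fin"
      using y z(1) less.prems by auto
    finally show ?thesis
      using regular_if_regular_diff[OF z(2)] by blast
  qed (auto intro: bexI[of _ 0])
qed

text \<open>Each inner factor \<open>x * y * x\<close> collapses to \<open>x\<close>. Hence
  \<open>x ^ Suc (Suc n) = 0\<close> implies \<open>(y * x * x) ^ Suc n = 0\<close>: passing to
  \<open>y * x * x\<close> lowers the nilpotency exponent.\<close>

lemma regular_power:
  fixes x y :: "'a::ring_1"
  assumes "x * y * x = x"
  shows "(y * x * x) ^ Suc n = y * x ^ Suc (Suc n)"
proof (induction n)
  case (Suc n)
  have "(y * x * x) ^ Suc (Suc n) = y * x * x * (y * x ^ Suc (Suc n))"
    using Suc by (metis power_Suc)
  also have "\<dots> = y * x * (x * y * x) * x ^ Suc n"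
    by (simp add: mult.assoc)
  also have "\<dots> = y * x ^ Suc (Suc (Suc n))"
    unfolding assms by (simp add: mult.assoc)
  finally show ?case .
qed (simp add: mult.assoc)

text \<open>With an inner inverse \<open>y\<close>, the matrix \<open>y * x * x\<close> has the same
  trace as \<open>x * (y * x) = x\<close> and a smaller nilpotency exponent. The descent ends at
  exponent 1, where the matrix itself is zero.\<close>

lemma tr_nilpotent: "x \<in> Fin \<Longrightarrow> x ^ k = 0 \<Longrightarrow> tr x = 0"
proof (induction k arbitrary: x)
  case 0
  then show ?case by simp
next
  case (Suc k)
  note x = Suc.prems
  obtain y where y: "y \<in> Fin" and reg: "x = x * y * x"
    using Fin_regular[OF x(1)] by blast
  show ?case
  proof (cases "k = 0")
    case True
    then have "x = 0"
      using x(2) by simp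
    then show ?thesis
      by (simp only: tr_0)
  next
    case False
    then obtain m where k: "k = Suc m"
      by (auto simp: gr0_conv_Suc)
    have "(y * x * x) ^ k = 0"
      unfolding k regular_power[OF reg[symmetric]] x(2)[unfolded k] by simp
    moreover have "y * x * x \<in> Fin"
      using y x(1) by simp
    ultimately have "tr (y * x * x) = 0"
      by (intro Suc.IH)
    moreover have "tr (x * (y * x)) = tr (y * x * x)"
      using y x(1) by (intro tr_mult_commute) simp_all
    moreover have "x * (y * x) = x"
      by (rule reg[unfolded mult.assoc, symmetric])
    ultimately show ?thesis
      by simp
  qed
qed

subsection \<open>Polynomials in a matrix\<close>

text \<open>Horner evaluation in the row-finite ring. A constant term contributes a multiple of the
  identity matrix, which is why results for finitary \<open>x\<close> speak of
  \<open>x * ev p x\<close>.\<close>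

definition ev :: "'f::field poly \<Rightarrow> 'f rmat \<Rightarrow> 'f rmat" where
  "ev p x = fold_coeffs (\<lambda>c y. smul c 1 + x * y) p 0"

lemma ev_0 [simp]: "ev 0 x = 0"
  by (simp add: ev_def)

lemma ev_pCons [simp]: "ev (pCons c p) x = smul c 1 + x * ev p x"
  by (cases "p = 0 \<and> c = 0") (auto simp: ev_def)

lemma ev_1 [simp]: "ev 1 x = 1"
  by (simp add: one_pCons)

lemma ev_add: "ev (p + q) x = ev p x + ev q x"
  by (induction p q rule: poly_induct2) (simp_all add: rmat.scale_left_distrib distrib_left)

lemma ev_smult: "ev (Polynomial.smult c p) x = smul c (ev p x)"
  by (induction p) (simp_all add: rmat.scale_right_distrib)

lemma ev_mult: "ev (p * q) x = ev p x * ev q x"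
  by (induction p) (simp_all add: ev_add ev_smult distrib_right mult.assoc)

lemma ev_power: "ev (p ^ n) x = ev p x ^ n"
  by (induction n) (simp_all add: ev_mult)

lemma ev_sum: "ev (\<Sum>i\<in>A. f i) x = (\<Sum>i\<in>A. ev (f i) x)"
  by (induction A rule: infinite_finite_induct) (simp_all add: ev_add)

lemma ev_monom: "ev (Polynomial.monom c n) x = smul c (x ^ n)"
  by (induction n) (simp_all add: monom_0 monom_Suc)

lemma ev_commute: "a * x = x * a \<Longrightarrow> a * ev p x = ev p x * a"
proof (induction p)
  case (pCons c p)
  have "a * (x * ev p x) = x * (a * ev p x)"
    using pCons.prems by (metis mult.assoc)
  also have "\<dots> = x * ev p x * a"
    using pCons by (metis mult.assoc)
  finally show ?case
    by (simp add: algebra_simps)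
qed simp

lemma monom_factor:
  fixes p :: "'a::comm_ring_1 poly"
  assumes "p \<noteq> 0"
  obtains r q c where "p = [:0, 1:] ^ r * pCons c q" "c \<noteq> 0"
proof -
  have "\<exists>r q c. p = [:0, 1:] ^ r * pCons c q \<and> c \<noteq> 0"
    using assms
  proof (induction p)
    case (pCons a p)
    show ?case
    proof (cases "a = 0")
      case True
      then obtain r q c where "p = [:0, 1:] ^ r * pCons c q" "c \<noteq> 0"
        using pCons by auto
      then have "pCons a p = [:0, 1:] ^ Suc r * pCons c q"
        using True by (simp add: mult.assoc)
      then show ?thesis
        using \<open>c \<noteq> 0\<close> by blast
    next
      case False
      then show ?thesis
        by (intro exI[of _ 0] exI[of _ p] exI[of _ a]) simp
    qed
  qed simp
  then show thesis
    using that by blast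
qed

text \<open>Powers are taken from the first one on, because these lie in the block of
  \<open>x\<close>; a linear relation among them has the form \<open>x * ev p x = 0\<close>.\<close>

lemma Fin_algebraic:
  assumes "x \<in> Fin"
  obtains p where "p \<noteq> 0" "x * ev p x = 0"
proof -
  obtain N where N: "x \<in> corner N"
    using assms by (rule FinE)
  have pow: "x ^ Suc i \<in> corner N" for i
  proof (induction i)
    case (Suc i)
    then show ?case
      using corner_mult[OF N, of "x ^ Suc i"] by simp
  qed (simp add: N)
  obtain c k where c: "k \<le> N * N" "c k \<noteq> 0" "(\<Sum>i\<le>N * N. smul (c i) (x ^ Suc i)) = 0"
    using corner_dependent_family[of "\<lambda>i. x ^ Suc i" N, OF pow] by blast
  define p where "p = (\<Sum>i\<le>N * N. Polynomial.monom (c i) i)"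
  have "coeff p k = (\<Sum>i\<le>N * N. if i = k then c i else 0)"
    by (simp add: p_def coeff_sum)
  also have "\<dots> = c k"
    using c(1) by simp
  finally have "p \<noteq> 0"
    using c(2) by auto
  moreover have "x * ev p x = 0"
    using c(3) by (simp add: p_def ev_sum ev_monom sum_distrib_left)
  ultimately show thesis
    by (rule that)
qed

text \<open>The Fitting idempotent of \<open>x\<close>. The annihilating polynomial is a power of
  \<open>?X\<close> times a factor with nonzero constant term; that factor makes
  \<open>?X * T\<close> act as the identity on \<open>x ^ m\<close>. Then
  \<open>(?X * T) ^ m\<close> evaluates to an idempotent, nonzero because \<open>x ^ m\<close>
  is.\<close>

lemma idempotent_polynomial:
  assumes "x \<in> Fin" and nonnil: "\<And>k. x ^ k \<noteq> 0"
  obtains p where "x * ev p x \<noteq> 0" "(x * ev p x) * (x * ev p x) = x * ev p x"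
proof -
  let ?X = "[:0, 1:] :: 'a poly"
  have X: "ev ?X x = x"
    by simp
  obtain p where p: "p \<noteq> 0" "x * ev p x = 0"
    using Fin_algebraic[OF assms(1)] .
  obtain r q c where rqc: "p = ?X ^ r * pCons c q" "c \<noteq> 0"
    using monom_factor[OF p(1)] .
  define T where "T = Polynomial.smult (- inverse c) q"
  \<comment> \<open>One more than \<open>r\<close>, since the relation is
    \<open>x * ev p x = 0\<close>; this also makes \<open>F\<close> a multiple of \<open>?X\<close>,
    as the conclusion requires.\<close>
  define m where "m = Suc r"
  have "pCons c q = Polynomial.smult c (1 - ?X * T)"
    using rqc(2) by (simp add: T_def one_pCons)
  then have "ev (?X * p) x = smul c (ev (?X ^ m * (1 - ?X * T)) x)"
    unfolding rqc(1) m_def by (simp only: mult_smult_right ev_smult power_Suc mult.assoc)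
  moreover have "ev (?X * p) x = 0"
    using p(2) by (simp only: ev_mult X)
  ultimately have "ev (?X ^ m * (1 - ?X * T)) x = 0"
    using rqc(2) by simp
  moreover have "?X ^ m = ?X ^ m * (1 - ?X * T) + ?X ^ m * (?X * T)"
    unfolding distrib_left[symmetric] by simp
  ultimately have step: "ev (?X ^ m) x = ev (?X ^ m * (?X * T)) x"
    by (metis ev_add add_0)
  have iter: "ev (?X ^ m * (?X * T) ^ j) x = ev (?X ^ m) x" for j
  proof (induction j)
    case (Suc j)
    have "ev (?X ^ m * (?X * T) ^ Suc j) x = ev (?X ^ m * (?X * T)) x * ev ((?X * T) ^ j) x"
      by (simp only: power_Suc mult.assoc ev_mult)
    then show ?case
      using Suc by (metis step ev_mult)
  qed simp
  define F where "F = ?X ^ m * T ^ m"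
  have XF: "?X ^ m * F = ?X ^ m * (?X * T) ^ m"
    by (simp only: F_def power_mult_distrib mult.assoc)
  have "ev (F * F) x = ev (?X ^ m * (?X * T) ^ m) x * ev (T ^ m) x"
    by (simp only: F_def power_mult_distrib ev_mult[symmetric] mult_ac)
  also have "\<dots> = ev F x"
    unfolding iter by (simp only: F_def ev_mult)
  finally have idem: "ev F x * ev F x = ev F x"
    by (simp only: ev_mult)
  have "ev F x \<noteq> 0"
  proof
    assume "ev F x = 0"
    then have "ev (?X ^ m) x = 0"
      using iter[of m] by (metis XF ev_mult mult_zero_right)
    then show False
      using nonnil[of m] by (simp only: ev_power X)
  qed
  moreover have "ev F x = x * ev (?X ^ r * T ^ m) x"
    unfolding F_def m_def power_Suc[of ?X] mult.assoc ev_mult[of ?X] X ..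
  ultimately show thesis
    using that idem by metis
qed

lemma corner_zero: "x \<in> corner N \<Longrightarrow> N \<le> i \<or> N \<le> j \<Longrightarrow> entry x i j = 0"
  by (rule ccontr) (force simp: corner_def)

text \<open>The outer factors alone determine the block. For \<open>x = e\<close> this confines
  \<open>e R e\<close> to a finite-dimensional space.\<close>

lemma corner_sandwich: "x \<in> corner N \<Longrightarrow> x * y * x \<in> corner N"
proof -
  assume x: "x \<in> corner N"
  have "entry (x * y * x) i k = (\<Sum>j<N. entry x i j * entry (y * x) j k)" for i k
    using entry_mult_corner[OF x] by (simp only: mult.assoc)
  moreover have "entry (y * x) j k = 0" if "N \<le> k" for j k
  proof -
    have "entry x l k = 0" for l
      using x that by (intro corner_zero) auto
    then show ?thesis
      by (simp add: times_rmat.rep_eq)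
  qed
  ultimately show ?thesis
    using x unfolding corner_def mem_Collect_eq
    by (metis (no_types, lifting) linorder_not_less mult_eq_0_iff sum.neutral)
qed

section \<open>Graded algebras of finitary matrices\<close>

text \<open>The ambient space \<open>W\<close> is a parameter because the notion serves both for
  \<open>Fin\<close> and for the corner \<open>e R e\<close>. Existence and independence of
  components are separate clauses, so the values of \<open>c\<close> outside the carrier do not
  matter.\<close>

definition internal_grading ::
  "('g, 'm) monoid_scheme \<Rightarrow> 'f::field rmat set \<Rightarrow> ('g \<Rightarrow> 'f rmat set) \<Rightarrow> bool" where
  "internal_grading G W S \<longleftrightarrow>
    (\<forall>g\<in>carrier G. rmat.subspace (S g) \<and> S g \<subseteq> W) \<and>
    (\<forall>x\<in>W. \<exists>c. (\<forall>g\<in>carrier G. c g \<in> S g) \<and> x = (\<Sum>g\<in>carrier G. c g)) \<and>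
    (\<forall>c. (\<forall>g\<in>carrier G. c g \<in> S g) \<longrightarrow> (\<Sum>g\<in>carrier G. c g) = 0 \<longrightarrow> (\<forall>g\<in>carrier G. c g = 0)) \<and>
    (\<forall>g\<in>carrier G. \<forall>h\<in>carrier G. \<forall>x\<in>S g. \<forall>y\<in>S h. x * y \<in> S (g \<otimes>\<^bsub>G\<^esub> h))"

locale graded_fin = comm_group G for G :: "('g, 'm) monoid_scheme" (structure) +
  fixes S :: "'g \<Rightarrow> 'f::alg_closed_field rmat set"
  assumes finite_group: "finite (carrier G)"
    and internal: "internal_grading G Fin S"
begin

lemma S_subspace: "g \<in> carrier G \<Longrightarrow> rmat.subspace (S g)"
  using internal[unfolded internal_grading_def, THEN conjunct1] by blast

lemma S_Fin: "x \<in> S g \<Longrightarrow> g \<in> carrier G \<Longrightarrow> x \<in> Fin"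
  using internal[unfolded internal_grading_def, THEN conjunct1] by blast

lemma S_mult: "x \<in> S g \<Longrightarrow> y \<in> S h \<Longrightarrow> g \<in> carrier G \<Longrightarrow> h \<in> carrier G \<Longrightarrow> x * y \<in> S (g \<otimes> h)"
  using internal[unfolded internal_grading_def, THEN conjunct2, THEN conjunct2, THEN conjunct2] by blast

lemma S_decompose:
  assumes "x \<in> Fin"
  obtains c where "\<And>g. g \<in> carrier G \<Longrightarrow> c g \<in> S g" "x = (\<Sum>g\<in>carrier G. c g)"
  using internal[unfolded internal_grading_def, THEN conjunct2, THEN conjunct1] assms that by blast

lemma S_sum_eq_0:
  "(\<And>g. g \<in> carrier G \<Longrightarrow> c g \<in> S g) \<Longrightarrow> (\<Sum>g\<in>carrier G. c g) = 0 \<Longrightarrow> g \<in> carrier G \<Longrightarrow> c g = 0"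
  using internal[unfolded internal_grading_def, THEN conjunct2, THEN conjunct2, THEN conjunct1] by blast

lemma S_1_mult: "x \<in> S \<one> \<Longrightarrow> y \<in> S g \<Longrightarrow> g \<in> carrier G \<Longrightarrow> x * y \<in> S g"
  using S_mult[of x \<one> y g] by simp

lemma S_mult_1: "x \<in> S g \<Longrightarrow> y \<in> S \<one> \<Longrightarrow> g \<in> carrier G \<Longrightarrow> x * y \<in> S g"
  using S_mult[of x g y \<one>] by simp

lemma S_add: "x \<in> S g \<Longrightarrow> y \<in> S g \<Longrightarrow> g \<in> carrier G \<Longrightarrow> x + y \<in> S g"
  by (rule rmat.subspace_add[OF S_subspace])

lemma S_diff: "x \<in> S g \<Longrightarrow> y \<in> S g \<Longrightarrow> g \<in> carrier G \<Longrightarrow> x - y \<in> S g"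
  by (rule rmat.subspace_diff[OF S_subspace])

lemma S_smul: "x \<in> S g \<Longrightarrow> g \<in> carrier G \<Longrightarrow> smul c x \<in> S g"
  by (rule rmat.subspace_scale[OF S_subspace])

lemma S_power: "x \<in> S g \<Longrightarrow> g \<in> carrier G \<Longrightarrow> x ^ Suc n \<in> S (g [^] Suc n)"
proof (induction n)
  case (Suc n)
  then have "x ^ Suc n * x \<in> S (g [^] Suc n \<otimes> g)"
    by (intro S_mult) auto
  then show ?case
    by (simp only: power_Suc2[of x "Suc n"] nat_pow_Suc)
qed simp

text \<open>The left factor \<open>w\<close> absorbs the identity matrix occurring in
  \<open>ev p y\<close>, so the product is homogeneous although \<open>ev p y\<close> itself may
  fail to be finitary.\<close>

lemma S_mult_ev: "w \<in> S h \<Longrightarrow> y \<in> S \<one> \<Longrightarrow> h \<in> carrier G \<Longrightarrow> w * ev p y \<in> S h"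
proof (induction p arbitrary: w)
  case 0
  then show ?case
    by (simp add: rmat.subspace_0[OF S_subspace])
next
  case (pCons c p)
  have "smul c w + (w * y) * ev p y \<in> S h"
    by (intro S_add S_smul pCons S_mult_1)
  then show ?case
    by (simp add: distrib_left mult.assoc)
qed

lemma ex_nonnilpotent: "\<exists>a\<in>S \<one>. \<forall>k. a ^ k \<noteq> 0"
proof (rule ccontr)
  assume "\<not> ?thesis"
  then have nil: "\<exists>k. a ^ k = 0" if "a \<in> S \<one>" for a
    using that by blast
  obtain m where m: "card (carrier G) = Suc m"
    using finite_group by (metis card_0_eq not0_implies_Suc one_closed empty_iff)
  have hom: "tr x = 0" if x: "x \<in> S g" "g \<in> carrier G" for x g
  proof -
    have "g [^] Suc m = \<one>"
      using power_order_eq_one[OF finite_group x(2)] m by simp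
    then have "x ^ Suc m \<in> S \<one>"
      using S_power[OF x, of m] by simp
    then obtain k where "x ^ (Suc m * k) = 0"
      using nil by (metis power_mult)
    then show ?thesis
      using tr_nilpotent S_Fin[OF x] by blast
  qed
  \<comment> \<open>A matrix of trace 1 would be a sum of homogeneous components of trace 0.\<close>
  obtain c where c: "\<And>g. g \<in> carrier G \<Longrightarrow> c g \<in> S g" "E 0 0 = (\<Sum>g\<in>carrier G. c g)"
    using S_decompose[OF Fin_E] by blast
  have "tr (E 0 0 :: 'f rmat) = (\<Sum>g\<in>carrier G. tr (c g))"
    unfolding c(2) using c(1) S_Fin by (intro tr_sum) blast
  also have "\<dots> = 0"
    using c(1) hom by (intro sum.neutral) blast
  finally show False
    using tr_mult_E[of "1 :: 'f rmat" 0 0] by (simp add: one_rmat.rep_eq)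
qed

text \<open>
  A descending chain of idempotents \<open>f\<^sub>0, f\<^sub>1, \<dots>\<close> yields linearly independent differences
  \<open>f\<^sub>i - f\<^sub>i\<^sub>+\<^sub>1\<close> inside a fixed corner.
\<close>

lemma ex_minimal_idempotent:
  "\<exists>e\<in>S \<one>. e * e = e \<and> e \<noteq> 0 \<and>
    (\<forall>f\<in>S \<one>. f * f = f \<longrightarrow> e * f = f \<longrightarrow> f * e = f \<longrightarrow> f \<noteq> 0 \<longrightarrow> f = e)"
proof (rule ccontr)
  assume none: "\<not> ?thesis"
  then have smaller: "\<exists>f. f \<in> S \<one> \<and> f * f = f \<and> e * f = f \<and> f * e = f \<and> f \<noteq> 0 \<and> f \<noteq> e"
    if "e \<in> S \<one>" "e * e = e" "e \<noteq> 0" for e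
    using that none by blast
  obtain a where a: "a \<in> S \<one>" "\<And>k. a ^ k \<noteq> 0"
    using ex_nonnilpotent by blast
  obtain p where p: "a * ev p a \<noteq> 0" "(a * ev p a) * (a * ev p a) = a * ev p a"
    using idempotent_polynomial[OF S_Fin[OF a(1) one_closed] a(2)] .
  define e where "e = a * ev p a"
  have e: "e \<in> S \<one>" "e * e = e" "e \<noteq> 0"
    unfolding e_def by (fact S_mult_ev[OF a(1) a(1) one_closed] p)+
  obtain N where N: "e \<in> corner N"
    using FinE[OF S_Fin[OF e(1) one_closed]] .
  \<comment> \<open>\<open>B\<close> collects the differences found so far. All of them are
    annihilated by \<open>f\<close> from the left, whereas \<open>f * (f - f') = f - f'\<close> is
    nonzero; hence the next difference is outside their span.\<close>
  have "\<exists>f B. f \<in> S \<one> \<and> f * f = f \<and> f \<noteq> 0 \<and> e * f = f \<and> f * e = f \<and>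
    B \<subseteq> corner N \<and> rmat.independent B \<and> finite B \<and> card B = k \<and> (\<forall>b\<in>B. f * b = 0)" for k
  proof (induction k)
    case 0
    show ?case
      by (rule exI[of _ e], rule exI[of _ "{}"])
        (intro conjI e rmat.independent_empty empty_subsetI finite.emptyI card.empty, blast)
  next
    case (Suc k)
    then obtain f B where f: "f \<in> S \<one>" "f * f = f" "f \<noteq> 0" "e * f = f" "f * e = f"
      and B: "B \<subseteq> corner N" "rmat.independent B" "finite B" "card B = k" "\<And>b. b \<in> B \<Longrightarrow> f * b = 0"
      by blast
    obtain f' where f': "f' \<in> S \<one>" "f' * f' = f'" "f * f' = f'" "f' * f = f'" "f' \<noteq> 0" "f' \<noteq> f"
      using smaller[OF f(1-3)] by blast
    have "rmat.subspace {b. f * b = 0}"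
      by (rule rmat.subspaceI) (auto simp: distrib_left)
    then have "rmat.span B \<subseteq> {b. f * b = 0}"
      by (rule rmat.span_minimal[rotated]) (use B(5) in blast)
    moreover have "f * (f - f') \<noteq> 0"
      using f' f by (simp add: right_diff_distrib)
    ultimately have notin: "f - f' \<notin> rmat.span B"
      by (metis (mono_tags) mem_Collect_eq subsetD)
    have ef': "e * f' = f'" "f' * e = f'"
      using f(4,5) f'(3,4) by (metis mult.assoc)+
    have "e * (f - f') * e = f - f'"
      by (simp add: right_diff_distrib left_diff_distrib mult.assoc f ef')
    then have "f - f' \<in> corner N"
      using corner_sandwich[OF N, of "f - f'"] by simp
    then have B'1: "insert (f - f') B \<subseteq> corner N"
      using B(1) by simp
    have "f - f' \<notin> B"
      using notin rmat.span_base by blast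
    then have B'2: "finite (insert (f - f') B)" "card (insert (f - f') B) = Suc k"
      using B(3,4) by simp_all
    have B'3: "f' * b = 0" if "b \<in> insert (f - f') B" for b
    proof (cases "b = f - f'")
      case True
      then show ?thesis
        by (simp add: right_diff_distrib f')
    next
      case False
      then have "f' * b = f' * (f * b)"
        using f'(4) by (metis mult.assoc)
      then show ?thesis
        using that False B(5) by simp
    qed
    have B'4: "rmat.independent (insert (f - f') B)"
      using rmat.independent_insertI[OF notin B(2)] .
    show ?case
      by (rule exI[of _ f'], rule exI[of _ "insert (f - f') B"])
        (intro conjI ballI f'(1,2,5) ef' B'1 B'2 B'3 B'4)
  qed
  from this[of "Suc (N * N)"]
  obtain B :: "'f rmat set" where "B \<subseteq> corner N" "rmat.independent B" "card B = Suc (N * N)"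
    by blast
  then show False
    using independent_corner_card[of B N] by simp
qed

end

section \<open>The graded division algebra \<open>e R e\<close>\<close>

locale graded_fin_idempotent = graded_fin G S for G :: "('g, 'm) monoid_scheme" (structure)
  and S :: "'g \<Rightarrow> 'f::alg_closed_field rmat set" +
  fixes e :: "'f rmat"
  assumes e_S: "e \<in> S \<one>" and e_idem: "e * e = e" and e_nonzero: "e \<noteq> 0"
    and e_minimal: "f \<in> S \<one> \<Longrightarrow> f * f = f \<Longrightarrow> e * f = f \<Longrightarrow> f * e = f \<Longrightarrow> f \<noteq> 0 \<Longrightarrow> f = e"
begin

definition D where
  "D g = {x \<in> S g. e * x = x \<and> x * e = x}"

lemma e_Fin: "e \<in> Fin"
  using S_Fin[OF e_S] by simp

lemma D_subspace: "g \<in> carrier G \<Longrightarrow> rmat.subspace (D g)"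
  by (rule rmat.subspaceI)
    (simp_all add: D_def distrib_left distrib_right rmat.subspace_0[OF S_subspace] S_add S_smul)

lemma D_mult: "x \<in> D g \<Longrightarrow> y \<in> D h \<Longrightarrow> g \<in> carrier G \<Longrightarrow> h \<in> carrier G \<Longrightarrow> x * y \<in> D (g \<otimes> h)"
  unfolding D_def mem_Collect_eq by (metis S_mult mult.assoc)

lemma e_D: "e \<in> D \<one>"
  by (simp add: D_def e_S e_idem)

lemma e_sandwich_D: "x \<in> S g \<Longrightarrow> g \<in> carrier G \<Longrightarrow> e * x * e \<in> D g"
  unfolding D_def using e_S e_idem
  by (simp add: S_1_mult S_mult_1) (metis mult.assoc)

text \<open>The power \<open>y\<close> of \<open>x\<close> has degree \<open>\<one>\<close>, and its
  Fitting idempotent is nonzero and lies below \<open>e\<close>, so it equals \<open>e\<close> by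
  minimality. Since \<open>y = x * w = w * x\<close>, the inverse of \<open>x\<close> is
  \<open>w * ev p y\<close>.\<close>

lemma D_nonnilpotent_inverse:
  assumes x: "x \<in> D g" and g: "g \<in> carrier G" and nonnil: "\<And>k. x ^ k \<noteq> 0"
  obtains z where "z \<in> D (inv g)" "x * z = e" "z * x = e"
proof -
  have xe: "e * x = x" "x * e = x" and xS: "x \<in> S g"
    using x by (auto simp: D_def)
  \<comment> \<open>The order of \<open>G\<close> is doubled to make the exponent at least 2. Then
    \<open>w\<close> is a positive power of \<open>x\<close> even for trivial \<open>G\<close>,
    where a single factor would leave only the identity matrix.\<close>
  obtain m where m: "card (carrier G) + card (carrier G) = Suc (Suc m)"
    using finite_group by (metis card_0_eq not0_implies_Suc one_closed empty_iff add_Suc add_Suc_right)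
  define w where "w = x ^ Suc m"
  define y where "y = x * w"
  have y: "y = x ^ Suc (Suc m)"
    by (simp add: y_def w_def)
  have "g [^] Suc (Suc m) = \<one>"
    unfolding m[symmetric] using power_order_eq_one[OF finite_group g] g by (simp flip: nat_pow_mult)
  then have yS: "y \<in> S \<one>" and gm: "g [^] Suc m \<otimes> g = \<one>"
    using S_power[OF xS g, of "Suc m"] y by simp_all
  have wS: "w \<in> S (inv g)"
    using S_power[OF xS g, of m] inv_equality[OF gm] g by (simp add: w_def)
  have wx: "w * x = y"
    unfolding y_def w_def by (simp only: power_commutes)
  have ew: "e * w = w" "w * e = w"
    by (simp_all add: w_def xe flip: mult.assoc) (metis power_commutes power_Suc mult.assoc xe(2))
  have "y ^ k \<noteq> 0" for k
    using nonnil by (metis y power_mult)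
  then obtain p where p: "y * ev p y \<noteq> 0" "(y * ev p y) * (y * ev p y) = y * ev p y"
    using idempotent_polynomial[OF S_Fin[OF yS]] by auto
  have ey: "e * y = y" "y * e = y"
    using xe ew by (metis y_def mult.assoc)+
  have "y * ev p y * e = y * ev p y"
    using ev_commute[of e y p] ey by (metis mult.assoc)
  moreover have "e * (y * ev p y) = y * ev p y"
    using ey by (metis mult.assoc)
  ultimately have ye: "y * ev p y = e"
    using p yS S_mult_ev[of y \<one> y p] by (intro e_minimal) auto
  have "w * ev p y \<in> D (inv g)"
    unfolding D_def using S_mult_ev[OF wS yS] g ew ev_commute[of e y p] ey
    by (simp add: mult.assoc) (metis mult.assoc)
  moreover have "x * (w * ev p y) = e"
    using ye by (simp add: y_def mult.assoc)
  moreover have "w * ev p y * x = e"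
    using ev_commute[of x y p] ye wx by (metis y_def mult.assoc)
  ultimately show thesis
    by (rule that)
qed

text \<open>
  If \<open>x\<close> is nilpotent, then \<open>x y\<close> is not invertible for homogeneous \<open>y\<close>, hence nilpotent, hence of
  trace \<open>0\<close>; so \<open>x\<close> is orthogonal to everything under the trace form.
\<close>

lemma D_nonnilpotent:
  assumes x: "x \<in> D g" and g: "g \<in> carrier G" and "x \<noteq> 0"
  shows "x ^ k \<noteq> 0"
proof
  assume nil: "x ^ k = 0"
  have xe: "e * x = x" "x * e = x" and xF: "x \<in> Fin"
    using x g S_Fin by (auto simp: D_def)
  \<comment> \<open>A right inverse \<open>w\<close> of \<open>x\<close> would give
    \<open>x ^ Suc n * w ^ Suc n = e\<close> for all \<open>n\<close>, contradicting
    nilpotency.\<close>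
  have no_right_inverse: "x * w \<noteq> e" if "e * w = w" for w
  proof
    assume xw: "x * w = e"
    have "x ^ Suc n * w ^ Suc n = e" for n
    proof (induction n)
      case (Suc n)
      have "x ^ Suc (Suc n) * w ^ Suc (Suc n) = x * (x ^ Suc n * w ^ Suc n) * w"
        unfolding power_Suc[of x "Suc n"] power_Suc2[of w "Suc n"] by (simp only: mult.assoc)
      then show ?case
        using Suc xw xe by simp
    qed (simp add: xw)
    from this[of k] show False
      using nil e_nonzero by simp
  qed
  have "x = 0"
  proof (rule tr_nondegenerate)
    fix y :: "'f rmat" assume y: "y \<in> Fin"
    obtain c where c: "\<And>h. h \<in> carrier G \<Longrightarrow> c h \<in> S h" "y = (\<Sum>h\<in>carrier G. c h)"
      using S_decompose[OF y] by blast
    \<comment> \<open>Since \<open>e\<close> fixes \<open>x\<close> on both sides, cyclicity of the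
      trace replaces \<open>y\<close> by \<open>e * y * e\<close>, whose homogeneous components lie
      in the spaces \<open>D h\<close>.\<close>
    have "tr (x * y) = tr (e * (x * y))"
      using xe by (metis mult.assoc)
    also have "\<dots> = tr (x * y * e)"
      using xF y e_Fin by (intro tr_mult_commute) auto
    also have "x * y * e = x * (e * y * e)"
      using xe by (metis mult.assoc)
    also have "\<dots> = (\<Sum>h\<in>carrier G. x * (e * c h * e))"
      by (simp add: c(2) sum_distrib_left sum_distrib_right)
    also have "tr \<dots> = (\<Sum>h\<in>carrier G. tr (x * (e * c h * e)))"
      by (intro tr_sum Fin_mult xF e_Fin S_Fin[OF c(1)])
    also have "\<dots> = 0"
    proof (rule sum.neutral, rule ballI)
      fix h assume h: "h \<in> carrier G"
      let ?y = "e * c h * e"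
      have y: "?y \<in> D h"
        using c(1) h e_sandwich_D by blast
      then have xy: "x * ?y \<in> D (g \<otimes> h)"
        using D_mult x g h by blast
      show "tr (x * ?y) = 0"
      proof (cases "\<exists>k. (x * ?y) ^ k = 0")
        case True
        then show ?thesis
          using tr_nilpotent[OF Fin_mult[OF xF S_Fin[OF _ h]], of ?y] y unfolding D_def by blast
      next
        case False
        then obtain z where "z \<in> D (inv (g \<otimes> h))" "x * ?y * z = e"
          using D_nonnilpotent_inverse[OF xy] g h by blast
        moreover have "e * (?y * z) = ?y * z"
          using y unfolding D_def mem_Collect_eq by (metis mult.assoc)
        ultimately show ?thesis
          using no_right_inverse[of "?y * z"] by (simp add: mult.assoc)
      qed
    qed
    finally show "tr (x * y) = 0" .
  qed
  then show False
    using assms(3) by simp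
qed

lemma D_inverse:
  assumes "x \<in> D g" "g \<in> carrier G" "x \<noteq> 0"
  obtains z where "z \<in> D (inv g)" "x * z = e" "z * x = e"
  using D_nonnilpotent_inverse[OF assms(1,2) D_nonnilpotent[OF assms]] .

text \<open>Schur's argument: \<open>l\<close> is a root of a polynomial of least degree
  annihilating \<open>x\<close> in \<open>e R e\<close>. If \<open>x - smul l e\<close> were
  nonzero, it would be invertible, and cancelling it would leave an annihilating polynomial of
  smaller degree.\<close>

lemma D_1:
  assumes x: "x \<in> D \<one>"
  obtains c where "x = smul c e"
proof -
  have xe: "e * x = x" "x * e = x" and xF: "x \<in> Fin"
    using x S_Fin by (auto simp: D_def)
  obtain p0 where p0: "p0 \<noteq> 0" "x * ev p0 x = 0"
    using Fin_algebraic[OF xF] .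
  \<comment> \<open>The factor \<open>e\<close> converts the identity matrix inside
    \<open>ev p x\<close> into the identity of \<open>e R e\<close>.\<close>
  let ?P = "\<lambda>p. p \<noteq> 0 \<and> e * ev p x = 0"
  have "?P (pCons 0 p0)"
    using p0 by simp
  then obtain p where p: "?P p" and least: "\<And>q. ?P q \<Longrightarrow> degree p \<le> degree q"
    using ex_has_least_nat[of ?P _ degree] by blast
  have "degree p > 0"
  proof (rule ccontr)
    assume "\<not> degree p > 0"
    then obtain c where "p = [:c:]"
      by (auto elim: degree_eq_zeroE)
    then show False
      using p e_nonzero by auto
  qed
  then obtain l where "poly p l = 0"
    using alg_closed_imp_poly_has_root by blast
  then obtain q where q: "p = [:- l, 1:] * q"
    by (auto simp: poly_eq_0_iff_dvd elim: dvdE)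
  have "q \<noteq> 0"
    using p q by auto
  then have degq: "degree q < degree p"
    unfolding q by (subst degree_mult_eq) auto
  have "x = smul l e"
  proof (rule ccontr)
    assume "x \<noteq> smul l e"
    moreover have "x - smul l e \<in> D \<one>"
      using x e_D by (intro rmat.subspace_diff[OF D_subspace] rmat.subspace_scale[OF D_subspace]) auto
    ultimately obtain z where "z * (x - smul l e) = e"
      using D_inverse[of "x - smul l e" \<one>] by auto
    moreover have "(x - smul l e) * ev q x = 0"
    proof -
      have "ev p x = (x - smul l 1) * ev q x"
        by (simp only: q ev_mult) simp
      then have "e * (x - smul l 1) * ev q x = 0"
        using p by (simp add: mult.assoc)
      then show ?thesis
        by (simp add: right_diff_distrib xe)
    qed
    ultimately have "e * ev q x = 0"
      by (metis mult.assoc mult_zero_right)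
    then show False
      using least[of q] degq \<open>q \<noteq> 0\<close> by simp
  qed
  then show thesis
    by (rule that)
qed

text \<open>Multiplication by the inverse of \<open>y\<close> carries degree \<open>g\<close> to
  degree \<open>\<one>\<close>, where only multiples of \<open>e\<close> occur.\<close>

lemma D_one_dimensional:
  assumes "x \<in> D g" "y \<in> D g" "y \<noteq> 0" "g \<in> carrier G"
  obtains c where "x = smul c y"
proof -
  obtain z where z: "z \<in> D (inv g)" "z * y = e"
    using D_inverse assms(2-4) by metis
  have "x * z \<in> D \<one>"
    using D_mult[OF assms(1) z(1)] assms(4) by simp
  then obtain c where "x * z = smul c e"
    by (rule D_1)
  then have "x * (z * y) = smul c (e * y)"
    by (metis mult.assoc smul_mult)
  then have "x = smul c y"
    using assms(1,2) z(2) by (simp add: D_def)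
  then show thesis
    by (rule that)
qed

definition H where
  "H = {h \<in> carrier G. D h \<noteq> {0}}"

lemma H_E:
  assumes "h \<in> H"
  obtains x where "x \<in> D h" "x \<noteq> 0" "h \<in> carrier G"
proof -
  have "0 \<in> D h"
    using assms rmat.subspace_0[OF D_subspace] by (simp add: H_def)
  then show thesis
    using assms that by (auto simp: H_def)
qed

text \<open>Nonzero homogeneous elements of \<open>e R e\<close> are invertible, so their inverses
  and products are nonzero again.\<close>

lemma H_subgroup: "subgroup H G"
proof
  show "H \<subseteq> carrier G"
    by (auto simp: H_def)
  show "\<one> \<in> H"
    using e_D e_nonzero by (auto simp: H_def)
  fix g assume "g \<in> H"
  then obtain x where x: "x \<in> D g" "x \<noteq> 0" "g \<in> carrier G"
    by (rule H_E)
  then obtain z where z: "z \<in> D (inv g)" "x * z = e" "z * x = e"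
    by (metis D_inverse)
  then have "z \<noteq> 0"
    using e_nonzero by auto
  then show "inv g \<in> H"
    using z x by (auto simp: H_def)
  fix h assume "h \<in> H"
  then obtain y where y: "y \<in> D h" "y \<noteq> 0" "h \<in> carrier G"
    by (rule H_E)
  have "x * y \<noteq> 0"
  proof
    assume "x * y = 0"
    then have "e * y = 0"
      using z by (metis mult.assoc mult_zero_right)
    then show False
      using y by (simp add: D_def)
  qed
  then show "g \<otimes> h \<in> H"
    using D_mult x y by (auto simp: H_def)
qed

end

section \<open>Dual homogeneous bases\<close>

context graded_fin_idempotent
begin

text \<open>One Gram-Schmidt step: \<open>f\<close> is the idempotent built so far, and
  \<open>u\<close>, \<open>v\<close> form a dual pair orthogonal to it. The opposite degrees keep
  \<open>f + v * u\<close> in degree \<open>\<one>\<close>.\<close>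

definition extends_by where
  "extends_by f s u v \<longleftrightarrow> s \<in> carrier G \<and> u \<in> S s \<and> v \<in> S (inv s) \<and> e * u = u \<and> v * e = v \<and>
    u * v = e \<and> u * f = 0 \<and> f * v = 0"

text \<open>Primeness with a homogeneous middle factor: if all components of a matrix unit were
  annihilated between \<open>x\<close> and \<open>y\<close>, so would be the matrix unit.\<close>

lemma nonzero_sandwich_component:
  assumes "x \<noteq> 0" "y \<noteq> 0"
  obtains h c where "h \<in> carrier G" "c \<in> S h" "x * c * y \<noteq> 0"
proof -
  obtain i j where "entry x i j \<noteq> 0"
    using rmat_neq_0E[OF assms(1)] .
  moreover obtain k l where "entry y k l \<noteq> 0"
    using rmat_neq_0E[OF assms(2)] .
  ultimately have "x * E j k * y \<noteq> 0"
    using mult_E_mult_eq_0D by (metis mult_eq_0_iff)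
  moreover obtain c where c: "\<And>h. h \<in> carrier G \<Longrightarrow> c h \<in> S h" "E j k = (\<Sum>h\<in>carrier G. c h)"
    using S_decompose[OF Fin_E[of j k]] by blast
  ultimately have "(\<Sum>h\<in>carrier G. x * c h * y) \<noteq> 0"
    by (simp add: sum_distrib_left sum_distrib_right)
  then obtain h where "h \<in> carrier G" "x * c h * y \<noteq> 0"
    by (rule sum.not_neutral_contains_not_neutral)
  then show thesis
    using that c(1) by blast
qed

text \<open>Primeness gives \<open>w * c * e \<noteq> 0\<close>. Subtracting
  \<open>f * c * e\<close> makes the column orthogonal to \<open>f\<close> and, because
  \<open>w * f = 0\<close>, leaves the product unchanged. As \<open>w * v0\<close> is nonzero and
  homogeneous in \<open>e R e\<close>, it is invertible, and its inverse normalizes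
  \<open>v0\<close>.\<close>

lemma ext_row:
  assumes f: "f \<in> S \<one>" "f * f = f"
    and w: "w \<in> S g" "g \<in> carrier G" "w \<noteq> 0" "e * w = w" "w * f = 0"
  obtains v where "extends_by f g w v"
proof -
  obtain h c where c: "h \<in> carrier G" "c \<in> S h" "w * c * e \<noteq> 0"
    using nonzero_sandwich_component[OF w(3) e_nonzero] .
  define v0 where "v0 = c * e - f * c * e"
  have v0: "v0 \<in> S h"
    unfolding v0_def by (intro S_diff S_mult_1[OF _ e_S] S_1_mult[OF f(1)] c)
  have "w * (f * c * e) = 0"
    using w(5) by (metis mult.assoc mult_zero_left)
  then have wv0: "w * v0 = w * c * e"
    by (simp add: v0_def right_diff_distrib mult.assoc)
  have "w * v0 \<in> D (g \<otimes> h)"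
    unfolding D_def mem_Collect_eq
  proof (intro conjI)
    show "w * v0 \<in> S (g \<otimes> h)"
      by (intro S_mult w v0 c)
    show "e * (w * v0) = w * v0" "w * v0 * e = w * v0"
      unfolding wv0 using w(4) e_idem by (metis mult.assoc)+
  qed
  moreover have "w * v0 \<noteq> 0"
    using c(3) wv0 by simp
  ultimately obtain z where z: "z \<in> D (inv (g \<otimes> h))" "w * v0 * z = e"
    using D_inverse w(2) c(1) by (metis m_closed)
  have "v0 * z \<in> S (h \<otimes> inv (g \<otimes> h))"
    using z v0 c w by (intro S_mult) (auto simp: D_def)
  moreover have "h \<otimes> inv (g \<otimes> h) = inv g"
    using c(1) w(2) m_lcomm[of h "inv g" "inv h"] by (simp add: inv_mult)
  moreover have "v0 * z * e = v0 * z"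
    using z(1) unfolding D_def mem_Collect_eq by (metis mult.assoc)
  moreover have "f * (v0 * z) = 0"
  proof -
    have "f * v0 = 0"
      using f(2) by (simp add: v0_def right_diff_distrib flip: mult.assoc)
    then show ?thesis
      by (metis mult.assoc mult_zero_left)
  qed
  ultimately have "extends_by f g w (v0 * z)"
    using w z(2) by (simp add: extends_by_def mult.assoc)
  then show thesis
    by (rule that)
qed

text \<open>Mirror image of \<open>ext_row\<close>: the column is given, and its partner is made
  orthogonal to \<open>f\<close> from the right and normalized from the left, which yields degree
  \<open>inv g\<close>.\<close>

lemma ext_column:
  assumes f: "f \<in> S \<one>" "f * f = f"
    and w: "w \<in> S g" "g \<in> carrier G" "w \<noteq> 0" "w * e = w" "f * w = 0"
  obtains u where "extends_by f (inv g) u w"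
proof -
  obtain h c where c: "h \<in> carrier G" "c \<in> S h" "e * c * w \<noteq> 0"
    using nonzero_sandwich_component[OF e_nonzero w(3)] .
  define u0 where "u0 = e * c - e * c * f"
  have u0: "u0 \<in> S h"
    unfolding u0_def by (intro S_diff S_mult_1[OF _ f(1)] S_1_mult[OF e_S] c)
  have "e * c * f * w = 0"
    using w(5) by (metis mult.assoc mult_zero_right)
  then have u0w: "u0 * w = e * c * w"
    by (simp add: u0_def left_diff_distrib)
  have "u0 * w \<in> D (h \<otimes> g)"
    unfolding D_def mem_Collect_eq
  proof (intro conjI)
    show "u0 * w \<in> S (h \<otimes> g)"
      by (intro S_mult w u0 c)
    show "e * (u0 * w) = u0 * w" "u0 * w * e = u0 * w"
      unfolding u0w using w(4) e_idem by (metis mult.assoc)+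
  qed
  moreover have "u0 * w \<noteq> 0"
    using c(3) u0w by simp
  ultimately obtain z where z: "z \<in> D (inv (h \<otimes> g))" "z * (u0 * w) = e"
    using D_inverse w(2) c(1) by (metis m_closed)
  have "z * u0 \<in> S (inv (h \<otimes> g) \<otimes> h)"
    using z u0 c w by (intro S_mult) (auto simp: D_def)
  moreover have "inv (h \<otimes> g) \<otimes> h = inv g"
    using c(1) w(2) by (metis inv_closed inv_mult_group inv_solve_right m_closed)
  moreover have "e * (z * u0) = z * u0"
    using z(1) unfolding D_def mem_Collect_eq by (metis mult.assoc)
  moreover have "z * u0 * f = 0"
  proof -
    have "u0 * f = 0"
      using f(2) by (simp add: u0_def left_diff_distrib mult.assoc)
    then show ?thesis
      by (metis mult.assoc mult_zero_right)
  qed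
  ultimately have "extends_by f (inv g) (z * u0) w"
    using w z(2) by (simp add: extends_by_def mult.assoc)
  then show thesis
    by (rule that)
qed

lemma ext_S_1: "extends_by f s u v \<Longrightarrow> f \<in> S \<one> \<Longrightarrow> f + v * u \<in> S \<one>"
  unfolding extends_by_def using S_mult[of v "inv s" u s] S_add[of f \<one> "v * u"] by auto

lemma ext_idempotent: "extends_by f s u v \<Longrightarrow> f * f = f \<Longrightarrow> (f + v * u) * (f + v * u) = f + v * u"
proof -
  assume "extends_by f s u v" and f: "f * f = f"
  then have uv: "u * v = e" "v * e = v" "u * f = 0" "f * v = 0"
    by (auto simp: extends_by_def)
  have "v * u * (v * u) = v * (u * v) * u"
    by (simp only: mult.assoc)
  also have "\<dots> = v * u"
    using uv by simp
  moreover have "f * (v * u) = 0" "v * u * f = 0"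
    using uv by (metis mult.assoc mult_zero_left mult_zero_right)+
  ultimately show ?thesis
    using f by (simp add: distrib_left distrib_right)
qed

text \<open>From \<open>x * f = x\<close> and \<open>f * v = 0\<close> follows
  \<open>x * v = 0\<close>, and dually \<open>u * y = 0\<close>: what \<open>f\<close> fixes is not
  affected by the new pair.\<close>

lemma ext_preserves:
  assumes "extends_by f s u v"
  shows "x * f = x \<Longrightarrow> x * (f + v * u) = x" and "f * y = y \<Longrightarrow> (f + v * u) * y = y"
proof -
  have uv: "u * f = 0" "f * v = 0"
    using assms by (auto simp: extends_by_def)
  show "x * (f + v * u) = x" if "x * f = x"
  proof -
    have "x * (v * u) = 0"
      using that uv by (metis mult.assoc mult_zero_left mult_zero_right)
    then show ?thesis
      using that by (simp add: distrib_left)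
  qed
  show "(f + v * u) * y = y" if "f * y = y"
  proof -
    have "v * u * y = 0"
      using that uv by (metis mult.assoc mult_zero_left mult_zero_right)
    then show ?thesis
      using that by (simp add: distrib_right)
  qed
qed

text \<open>Finitely many dual pairs never exhaust the algebra: \<open>e R\<close> contains elements supported in a
  column that \<open>f\<close> does not reach.\<close>

lemma ex_ext:
  assumes f: "f \<in> S \<one>" "f * f = f"
  shows "\<exists>s u v. extends_by f s u v"
proof -
  obtain a b where ab: "entry e a b \<noteq> 0"
    using rmat_neq_0E[OF e_nonzero] .
  obtain N where N: "f \<in> corner N"
    using FinE[OF S_Fin[OF f(1) one_closed]] .
  obtain c where c: "\<And>h. h \<in> carrier G \<Longrightarrow> c h \<in> S h" "E b N = (\<Sum>h\<in>carrier G. c h)"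
    using S_decompose[OF Fin_E[of b N]] by blast
  \<comment> \<open>\<open>N\<close> is the first column outside the block of \<open>f\<close>, so
    \<open>E b N * f = 0\<close>; the index \<open>b\<close> comes from a nonzero entry of
    \<open>e\<close>, which keeps \<open>e * E b N\<close> from vanishing.\<close>
  have "entry (e * E b N) a N \<noteq> 0"
    using ab by (simp add: entry_mult_E)
  then have "e * E b N \<noteq> 0"
    by (metis zero_rmat.rep_eq)
  then have "(\<Sum>h\<in>carrier G. e * c h) \<noteq> 0"
    by (simp add: c(2) sum_distrib_left)
  then obtain h where h: "h \<in> carrier G" "e * c h \<noteq> 0"
    by (rule sum.not_neutral_contains_not_neutral)
  have "E b N * f = 0"
    by (rule rmat_eqI) (simp add: entry_E_mult corner_zero[OF N] entry_simps)
  then have "(\<Sum>h\<in>carrier G. c h * f) = 0"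
    by (simp add: c(2) sum_distrib_right)
  then have "c h * f = 0"
    by (intro S_sum_eq_0[of "\<lambda>h. c h * f"] S_mult_1[OF c(1) f(1)] h)
  then have "e * c h * f = 0"
    by (simp add: mult.assoc)
  moreover have "e * (e * c h) = e * c h"
    by (simp add: e_idem flip: mult.assoc)
  ultimately obtain v where "extends_by f h (e * c h) v"
    using ext_row[OF f S_1_mult[OF e_S c(1)]] h by blast
  then show ?thesis
    by blast
qed

text \<open>A row that is already fixed still triggers an extension, so that the process never
  stops. Otherwise the new row is the defect \<open>?w = x - x * f\<close>; then
  \<open>x * v = e\<close>, and \<open>x * (v * ?w)\<close> restores exactly this defect.\<close>

lemma ex_ext_row:
  assumes f: "f \<in> S \<one>" "f * f = f" and x: "x \<in> S g" "g \<in> carrier G" "e * x = x"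
  shows "\<exists>s u v. extends_by f s u v \<and> x * (f + v * u) = x"
proof (cases "x * f = x")
  case True
  then show ?thesis
    using ex_ext[OF f] ext_preserves(1) by blast
next
  case False
  let ?w = "x - x * f"
  have "?w \<in> S g"
    by (intro S_diff S_mult_1 x f)
  moreover have "?w \<noteq> 0" "e * ?w = ?w" "?w * f = 0"
    using False f(2) x(3) by (auto simp: right_diff_distrib left_diff_distrib mult.assoc)
      (simp flip: mult.assoc)
  ultimately obtain v where v: "extends_by f g ?w v"
    using ext_row[OF f] x(2) by blast
  then have "?w * v = e" "f * v = 0" "e * ?w = ?w"
    by (auto simp: extends_by_def)
  then have "x * v = e"
    by (simp add: left_diff_distrib mult.assoc)
  then have "x * (v * ?w) = ?w"
    using \<open>e * ?w = ?w\<close> by (metis mult.assoc)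
  then have "x * (f + v * ?w) = x"
    by (simp add: distrib_left)
  then show ?thesis
    using v by blast
qed

lemma ex_ext_column:
  assumes f: "f \<in> S \<one>" "f * f = f" and y: "y \<in> S g" "g \<in> carrier G" "y * e = y"
  shows "\<exists>s u v. extends_by f s u v \<and> (f + v * u) * y = y"
proof (cases "f * y = y")
  case True
  then show ?thesis
    using ex_ext[OF f] ext_preserves(2) by blast
next
  case False
  let ?w = "y - f * y"
  have "?w \<in> S g"
    by (intro S_diff S_1_mult y f)
  moreover have "?w \<noteq> 0" "?w * e = ?w" "f * ?w = 0"
    using False f(2) y(3) by (auto simp: right_diff_distrib left_diff_distrib mult.assoc)
      (simp flip: mult.assoc)
  ultimately obtain u where u: "extends_by f (inv g) u ?w"
    using ext_column[OF f] y(2) by blast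
  then have "u * ?w = e" "u * f = 0" "?w * e = ?w"
    by (auto simp: extends_by_def)
  then have "u * y = e"
    by (simp add: right_diff_distrib flip: mult.assoc)
  then have "?w * u * y = ?w"
    using \<open>?w * e = ?w\<close> by (simp add: mult.assoc)
  then have "(f + ?w * u) * y = y"
    by (simp add: distrib_right)
  then show ?thesis
    using u by blast
qed

text \<open>Step \<open>2 * n\<close> absorbs the row \<open>X n\<close> and step
  \<open>Suc (2 * n)\<close> the column \<open>Y n\<close>; the idempotent resulting from a step has
  the next index.\<close>

lemma ext_sequence:
  assumes X: "\<And>n. \<exists>g\<in>carrier G. X n \<in> S g" "\<And>n. e * X n = X n"
    and Y: "\<And>n. \<exists>g\<in>carrier G. Y n \<in> S g" "\<And>n. Y n * e = Y n"
  obtains F s u v where "F 0 = 0" "\<And>n. F (Suc n) = F n + v n * u n" "\<And>n. extends_by (F n) (s n) (u n) (v n)"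
    "\<And>n. X n * F (Suc (2 * n)) = X n" "\<And>n. F (Suc (Suc (2 * n))) * Y n = Y n"
proof -
  let ?P = "\<lambda>(n :: nat) f. f \<in> S \<one> \<and> f * f = f \<and> (n = 0 \<longrightarrow> f = 0)"
  let ?Q = "\<lambda>n f f'. \<exists>s u v. extends_by f s u v \<and> f' = f + v * u \<and>
    (even n \<longrightarrow> X (n div 2) * f' = X (n div 2)) \<and> (odd n \<longrightarrow> f' * Y (n div 2) = Y (n div 2))"
  have "\<exists>F. \<forall>n. ?P n (F n) \<and> ?Q n (F n) (F (Suc n))"
  proof (rule dependent_nat_choice[of ?P ?Q])
    show "\<exists>f. ?P 0 f"
      by (intro exI[of _ 0]) (simp add: rmat.subspace_0[OF S_subspace])
    fix f n assume f: "?P n f"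
    obtain s u v where suv: "extends_by f s u v" "even n \<longrightarrow> X (n div 2) * (f + v * u) = X (n div 2)"
      "odd n \<longrightarrow> (f + v * u) * Y (n div 2) = Y (n div 2)"
    proof (cases "even n")
      case True
      obtain g where "g \<in> carrier G" "X (n div 2) \<in> S g"
        using X(1) by blast
      then show ?thesis
        using ex_ext_row[of f "X (n div 2)" g] f X(2) True that by blast
    next
      case False
      obtain g where "g \<in> carrier G" "Y (n div 2) \<in> S g"
        using Y(1) by blast
      then show ?thesis
        using ex_ext_column[of f "Y (n div 2)" g] f Y(2) False that by blast
    qed
    have P: "?P (Suc n) (f + v * u)"
      using f ext_S_1[OF suv(1)] ext_idempotent[OF suv(1)] by blast
    have Q: "?Q n f (f + v * u)"
      by (rule exI[of _ s], rule exI[of _ u], rule exI[of _ v]) (intro conjI suv refl)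
    show "\<exists>f'. ?P (Suc n) f' \<and> ?Q n f f'"
      by (rule exI, rule conjI, rule P, rule Q)
  qed
  then obtain F where F: "\<forall>n. ?P n (F n) \<and> ?Q n (F n) (F (Suc n))" ..
  have P: "?P n (F n)" and Q: "?Q n (F n) (F (Suc n))" for n
    by (rule conjunct1[OF spec[OF F]], rule conjunct2[OF spec[OF F]])
  from Q obtain s u v where suv: "\<And>n. extends_by (F n) (s n) (u n) (v n) \<and> F (Suc n) = F n + v n * u n \<and>
    (even n \<longrightarrow> X (n div 2) * F (Suc n) = X (n div 2)) \<and>
    (odd n \<longrightarrow> F (Suc n) * Y (n div 2) = Y (n div 2))"
    by metis
  show thesis
  proof (rule that[of F v u s])
    show "F 0 = 0"
      using P[of 0] by blast
    show "F (Suc n) = F n + v n * u n" "extends_by (F n) (s n) (u n) (v n)" for n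
      using suv[of n] by blast+
    show "X n * F (Suc (2 * n)) = X n" for n
      using suv[of "2 * n", THEN conjunct2, THEN conjunct2, THEN conjunct1] by simp
    show "F (Suc (Suc (2 * n))) * Y n = Y n" for n
      using suv[of "Suc (2 * n)", THEN conjunct2, THEN conjunct2, THEN conjunct2] by simp
  qed
qed

text \<open>With \<open>entry e a b \<noteq> 0\<close>, every \<open>E i j\<close> is a multiple of
  \<open>E i a * e * E b j\<close>. It therefore suffices that the idempotents eventually fix the
  components of \<open>E i a * e\<close> from the left and those of \<open>e * E b j\<close> from
  the right.\<close>

lemma ex_dual_bases:
  obtains s :: "nat \<Rightarrow> 'g" and u v :: "nat \<Rightarrow> 'f rmat" where
    "\<And>n. s n \<in> carrier G" "\<And>n. u n \<in> S (s n)" "\<And>n. v n \<in> S (inv (s n))"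
    "\<And>n. e * u n = u n" "\<And>n. v n * e = v n" "\<And>m n. u m * v n = (if m = n then e else 0)"
    "\<And>x. x \<in> Fin \<Longrightarrow> \<exists>N. \<forall>n\<ge>N. (\<Sum>i<n. v i * u i) * x = x \<and> x * (\<Sum>i<n. v i * u i) = x"
proof -
  obtain a b where ab: "entry e a b \<noteq> 0"
    using rmat_neq_0E[OF e_nonzero] .
  have "\<exists>c. (\<forall>g\<in>carrier G. c g \<in> S g) \<and> E i j = (\<Sum>g\<in>carrier G. c g)" for i j
    using S_decompose[OF Fin_E] by metis
  then obtain c where c: "\<And>i j g. g \<in> carrier G \<Longrightarrow> c i j g \<in> S g"
    and Ec: "\<And>i j. E i j = (\<Sum>g\<in>carrier G. c i j g)"
    by metis
  define TX where "TX = (\<lambda>(j, g). e * c b j g) ` (UNIV \<times> carrier G)"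
  define TY where "TY = (\<lambda>(i, g). c i a g * e) ` (UNIV \<times> carrier G)"
  have countable: "countable TX" "countable TY"
    unfolding TX_def TY_def
    by (intro countable_image countable_SIGMA countable_finite finite_group countableI_type)+
  have nonempty: "TX \<noteq> {}" "TY \<noteq> {}"
    unfolding TX_def TY_def using one_closed by blast+
  define X where "X = from_nat_into TX"
  define Y where "Y = from_nat_into TY"
  have X: "X n \<in> TX" and Y: "Y n \<in> TY" for n
    by (simp_all add: X_def Y_def from_nat_into nonempty)
  have X1: "\<exists>g\<in>carrier G. X n \<in> S g" for n
  proof -
    obtain j g where g: "g \<in> carrier G" "X n = e * c b j g"
      using X[of n] by (auto simp: TX_def)
    show ?thesis
      by (rule bexI[of _ g]) (simp_all add: g S_1_mult[OF e_S c])
  qed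
  have Y1: "\<exists>g\<in>carrier G. Y n \<in> S g" for n
  proof -
    obtain i g where g: "g \<in> carrier G" "Y n = c i a g * e"
      using Y[of n] by (auto simp: TY_def)
    show ?thesis
      by (rule bexI[of _ g]) (simp_all add: g S_mult_1[OF c e_S])
  qed
  have X2: "e * X n = X n" for n
    using X[of n] e_idem by (auto simp: TX_def simp flip: mult.assoc)
  have Y2: "Y n * e = Y n" for n
    using Y[of n] e_idem by (auto simp: TY_def mult.assoc)
  obtain F s u v where F: "F 0 = 0" "\<And>n. F (Suc n) = F n + v n * u n" "\<And>n. extends_by (F n) (s n) (u n) (v n)"
    "\<And>n. X n * F (Suc (2 * n)) = X n" "\<And>n. F (Suc (Suc (2 * n))) * Y n = Y n"
    by (rule ext_sequence[OF X1 X2 Y1 Y2]) (rule that)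
  have Fsum: "F n = (\<Sum>i<n. v i * u i)" for n
    by (induction n) (simp_all add: F)
  have row_mono: "x * F n = x" if "x * F m = x" "m \<le> n" for x m n
    using that(2) by (induction rule: dec_induct) (simp_all add: that(1) F(2) ext_preserves(1)[OF F(3)])
  have column_mono: "F n * x = x" if "F m * x = x" "m \<le> n" for x m n
    using that(2) by (induction rule: dec_induct) (simp_all add: that(1) F(2) ext_preserves(2)[OF F(3)])
  have ext: "s n \<in> carrier G" "u n \<in> S (s n)" "v n \<in> S (inv (s n))" "e * u n = u n" "v n * e = v n"
    "u n * v n = e" "u n * F n = 0" "F n * v n = 0" for n
    using F(3)[of n] by (simp_all add: extends_by_def)
  \<comment> \<open>A pair is fixed by every later idempotent, and a new pair is orthogonal to the
    current one; together this gives duality for distinct indices in both orders.\<close>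
  have uF: "u m * F n = u m" and Fv: "F n * v m = v m" if "m < n" for m n
  proof -
    have "u m * F (Suc m) = u m"
      by (simp add: F(2) distrib_left ext flip: mult.assoc)
    moreover have "F (Suc m) * v m = v m"
      by (simp add: F(2) distrib_right mult.assoc ext)
    ultimately show "u m * F n = u m" "F n * v m = v m"
      using that row_mono column_mono by (auto simp: Suc_le_eq)
  qed
  have uv: "u m * v n = (if m = n then e else 0)" for m n
  proof -
    consider "m < n" | "m = n" | "n < m"
      by linarith
    then show ?thesis
    proof cases
      case 1
      then have "u m * v n = u m * (F n * v n)"
        using uF by (metis mult.assoc)
      then show ?thesis
        using 1 ext by simp
    next
      case 3
      then have "u m * v n = u m * F m * v n"
        using Fv by (metis mult.assoc)
      then show ?thesis
        using 3 ext by simp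
    qed (use ext in simp)
  qed
  let ?K = "{x. \<exists>N. \<forall>n\<ge>N. F n * x = x \<and> x * F n = x}"
  have "rmat.subspace ?K"
  proof (rule rmat.subspaceI)
    show "0 \<in> ?K"
      by simp
    fix x y assume "x \<in> ?K" "y \<in> ?K"
    then obtain M N where "\<forall>n\<ge>M. F n * x = x \<and> x * F n = x" "\<forall>n\<ge>N. F n * y = y \<and> y * F n = y"
      by blast
    then have "\<forall>n\<ge>max M N. F n * (x + y) = x + y \<and> (x + y) * F n = x + y"
      by (simp add: distrib_left distrib_right)
    then show "x + y \<in> ?K"
      by blast
  next
    fix x r assume "x \<in> ?K"
    then obtain M where "\<forall>n\<ge>M. F n * x = x \<and> x * F n = x"
      by blast
    then have "\<forall>n\<ge>M. F n * smul r x = smul r x \<and> smul r x * F n = smul r x"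
      by simp
    then show "smul r x \<in> ?K"
      by blast
  qed
  note K = this
  have "E i j \<in> ?K" for i j
  proof -
    have comp: "c i a g * e * (e * c b j h) \<in> ?K" if gh: "g \<in> carrier G" "h \<in> carrier G" for g h
    proof -
      have "c i a g * e \<in> TY" "e * c b j h \<in> TX"
        using gh by (auto simp: TX_def TY_def)
      then obtain m n where mn: "c i a g * e = Y m" "e * c b j h = X n"
        using countable from_nat_into_surj unfolding X_def Y_def by metis
      have "F k * (Y m * X n) = Y m * X n \<and> Y m * X n * F k = Y m * X n"
        if "k \<ge> max (Suc (2 * n)) (Suc (Suc (2 * m)))" for k
        using row_mono[OF F(4)[of n], of k] column_mono[OF F(5)[of m], of k] that
        by (metis max.bounded_iff mult.assoc)
      then show ?thesis
        unfolding mn by blast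
    qed
    have "E i a * e * E b j = smul (entry e a b) (E i j)"
      by (rule E_sandwich)
    then have "E i j = smul (inverse (entry e a b)) (E i a * e * (e * E b j))"
      using ab e_idem by (simp add: mult.assoc) (simp flip: mult.assoc)
    also have "\<dots> = smul (inverse (entry e a b)) (\<Sum>g\<in>carrier G. \<Sum>h\<in>carrier G. c i a g * e * (e * c b j h))"
      by (simp add: Ec sum_distrib_left sum_distrib_right) (rule disjI1, rule sum.swap)
    also have "\<dots> \<in> ?K"
      by (intro rmat.subspace_scale[OF K] rmat.subspace_sum[OF K] comp)
    finally show ?thesis .
  qed
  then have "Fin \<subseteq> ?K"
    using Fin_induct[OF K] by blast
  then show thesis
    using that[of s u v] ext uv unfolding Fsum by blast
qed

text \<open>Multiplying \<open>u n\<close> by an invertible homogeneous element of \<open>e R e\<close> moves its degree within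
  its coset of \<open>H\<close>; choosing one representative per coset makes the supports intersect trivially.\<close>

lemma ex_normalized_dual_bases:
  obtains s :: "nat \<Rightarrow> 'g" and u v :: "nat \<Rightarrow> 'f rmat" where
    "\<And>n. s n \<in> carrier G" "\<And>n. u n \<in> S (s n)" "\<And>n. v n \<in> S (inv (s n))"
    "\<And>n. e * u n = u n" "\<And>n. v n * e = v n" "\<And>m n. u m * v n = (if m = n then e else 0)"
    "\<And>x. x \<in> Fin \<Longrightarrow> \<exists>N. \<forall>n\<ge>N. (\<Sum>i<n. v i * u i) * x = x \<and> x * (\<Sum>i<n. v i * u i) = x"
    "\<And>m n. inv (s m) \<otimes> s n \<in> H \<Longrightarrow> s m = s n"
proof -
  obtain s :: "nat \<Rightarrow> 'g" and u v :: "nat \<Rightarrow> 'f rmat" where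
    suv: "\<And>n. s n \<in> carrier G" "\<And>n. u n \<in> S (s n)" "\<And>n. v n \<in> S (inv (s n))"
    "\<And>n. e * u n = u n" "\<And>n. v n * e = v n" "\<And>m n. u m * v n = (if m = n then e else 0)"
    "\<And>x. x \<in> Fin \<Longrightarrow> \<exists>N. \<forall>n\<ge>N. (\<Sum>i<n. v i * u i) * x = x \<and> x * (\<Sum>i<n. v i * u i) = x"
    by (rule ex_dual_bases) (rule that)
  \<comment> \<open>The choice depends on the coset alone, so indices in the same coset of
    \<open>H\<close> receive the very same representative.\<close>
  define t where "t n = (SOME x. x \<in> H #> s n)" for n
  have t: "t n \<in> H #> s n" for n
    unfolding t_def by (rule someI[of _ "s n"]) (rule rcos_self[OF suv(1) H_subgroup])
  have "\<exists>h d z. t n = h \<otimes> s n \<and> h \<in> carrier G \<and> d \<in> D h \<and> z \<in> D (inv h) \<and> d * z = e \<and> z * d = e" for n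
  proof -
    obtain h where h: "h \<in> H" "t n = h \<otimes> s n"
      using t[of n] by (auto simp: r_coset_def)
    obtain d where d: "d \<in> D h" "d \<noteq> 0" "h \<in> carrier G"
      using H_E[OF h(1)] .
    then obtain z where "z \<in> D (inv h)" "d * z = e" "z * d = e"
      using D_inverse by metis
    then show ?thesis
      using h d by blast
  qed
  then obtain h d z where hdz: "\<And>n. t n = h n \<otimes> s n" "\<And>n. h n \<in> carrier G" "\<And>n. d n \<in> D (h n)"
    "\<And>n. z n \<in> D (inv (h n))" "\<And>n. d n * z n = e" "\<And>n. z n * d n = e"
    by metis
  have dz: "e * d n = d n" "d n * e = d n" "d n \<in> S (h n)" "z n * e = z n" "z n \<in> S (inv (h n))" for n
    using hdz(3,4)[of n] by (auto simp: D_def)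
  \<comment> \<open>The modified pairs have the same products, so the local units and their
    exhaustion property carry over.\<close>
  have vu: "v n * z n * (d n * u n) = v n * u n" for n
  proof -
    have "v n * z n * (d n * u n) = v n * (z n * d n) * u n"
      by (simp only: mult.assoc)
    then show ?thesis
      by (simp add: hdz suv)
  qed
  show thesis
  proof (rule that[of t "\<lambda>n. d n * u n" "\<lambda>n. v n * z n"])
    show tG: "t n \<in> carrier G" for n
      using hdz suv by simp
    show "d n * u n \<in> S (t n)" for n
      unfolding hdz(1) by (intro S_mult dz suv hdz(2))
    have "inv (t n) = inv (s n) \<otimes> inv (h n)" for n
      unfolding hdz(1) using hdz(2) suv(1) by (simp add: inv_mult_group)
    then show "v n * z n \<in> S (inv (t n))" for n
      using S_mult[OF suv(3) dz(5)] suv(1) hdz(2) by simp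
    show "e * (d n * u n) = d n * u n" for n
      using dz by (simp flip: mult.assoc)
    show "v n * z n * e = v n * z n" for n
      using dz by (simp add: mult.assoc)
    show "d m * u m * (v n * z n) = (if m = n then e else 0)" for m n
    proof -
      have "d m * u m * (v n * z n) = d m * (u m * v n) * z n"
        by (simp only: mult.assoc)
      then show ?thesis
        using dz hdz by (simp add: suv(6))
    qed
    show "\<exists>N. \<forall>n\<ge>N. (\<Sum>i<n. v i * z i * (d i * u i)) * x = x \<and> x * (\<Sum>i<n. v i * z i * (d i * u i)) = x"
      if "x \<in> Fin" for x
      unfolding vu by (rule suv(7)[OF that])
    show "t m = t n" if "inv (t m) \<otimes> t n \<in> H" for m n
    proof -
      have "t n = (inv (t m) \<otimes> t n) \<otimes> t m"
        using tG[of m] tG[of n] by (metis inv_closed l_one m_assoc m_closed m_comm r_inv)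
      then have "t n \<in> H #> t m"
        using that unfolding r_coset_def by blast
      then have "H #> t n = H #> t m"
        using repr_independence[OF _ _ H_subgroup, of "t n" "t m"] tG by simp
      moreover have "H #> t k = H #> s k" for k
        using repr_independence[OF t suv(1) H_subgroup] by simp
      ultimately show ?thesis
        by (simp add: t_def)
    qed
  qed
qed

end

section \<open>Matrix units of a corner\<close>

text \<open>A rank factorization of \<open>e\<close>, with \<open>n\<close> its rank. The factors
  sit in row 0 and column 0, so that \<open>a k * x * b l\<close> is a multiple of
  \<open>E 0 0\<close> and acts as a scalar. Rank one idempotents are split off one at a
  time.\<close>

lemma idempotent_matrix_units:
  "e \<in> Fin \<Longrightarrow> e * e = e \<Longrightarrow> \<exists>(n :: nat) a b. e = (\<Sum>k<n. b k * a k) \<and>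
    (\<forall>k. E 0 0 * a k = a k \<and> b k * E 0 0 = b k \<and> a k \<in> Fin \<and> b k \<in> Fin) \<and>
    (\<forall>k<n. \<forall>l<n. a k * b l = (if k = l then E 0 0 else 0))"
proof (induction "card (nonzero_rows e)" arbitrary: e rule: less_induct)
  case less
  show ?case
  proof (cases "e = 0")
    case True
    show ?thesis
      unfolding True by (rule exI[of _ "0 :: nat"], rule exI[of _ "\<lambda>_. 0"], rule exI[of _ "\<lambda>_. 0"]) simp
  next
    case False
    then obtain i j where ij: "entry e i j \<noteq> 0"
      by (rule rmat_neq_0E)
    \<comment> \<open>Row \<open>i\<close> and column \<open>j\<close> of \<open>e\<close>, moved to
      row 0 and column 0 and scaled to give \<open>u * v = E 0 0\<close>. Then \<open>v * u\<close>
      is a rank one idempotent below \<open>e\<close>, and subtracting it is elimination with pivot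
      \<open>(i, j)\<close>.\<close>
    define u where "u = E 0 i * e"
    define v where "v = smul (inverse (entry e i j)) (e * E j 0)"
    define e' where "e' = e - v * u"
    have "E j 0 * E 0 i = (E j i :: 'a rmat)"
      by (simp add: E_mult_E)
    then have "e * E j 0 * (E 0 i * e) = e * E j i * e"
      by (metis mult.assoc)
    then have vu: "v * u = e * smul (inverse (entry e i j)) (E j i) * e"
      by (simp add: u_def v_def)
    have uv: "u * v = E 0 0"
    proof -
      have "u * v = smul (inverse (entry e i j)) (E 0 i * (e * e) * E j 0)"
        by (simp add: u_def v_def mult.assoc)
      then show ?thesis
        using ij less.prems by (simp add: E_sandwich)
    qed
    have eu: "u * e = u" "e * v = v" "E 0 0 * u = u" "v * E 0 0 = v"
      using less.prems(2) by (simp_all add: u_def v_def mult.assoc E_mult_E)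
        (simp_all add: E_mult_E flip: mult.assoc)
    have vv: "v * u * (v * u) = v * u"
    proof -
      have "v * u * (v * u) = v * (u * v) * u"
        by (simp only: mult.assoc)
      then show ?thesis
        by (simp add: uv eu)
    qed
    have evu: "e * (v * u) = v * u" "v * u * e = v * u"
      using eu by (simp flip: mult.assoc) (simp add: eu mult.assoc)
    have "e' * e' = e'"
      unfolding e'_def by (simp add: left_diff_distrib right_diff_distrib less.prems(2) vv evu)
    have fin: "u \<in> Fin" "v \<in> Fin"
      using less.prems(1) by (simp_all add: u_def v_def)
    then have "e' \<in> Fin"
      unfolding e'_def using less.prems(1) by auto
    moreover have "card (nonzero_rows e') < card (nonzero_rows e)"
      using rank_one_reduction_rows[OF less.prems(1) ij] unfolding e'_def vu .
    ultimately have "\<exists>(n :: nat) a b. e' = (\<Sum>k<n. b k * a k) \<and>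
      (\<forall>k. E 0 0 * a k = a k \<and> b k * E 0 0 = b k \<and> a k \<in> Fin \<and> b k \<in> Fin) \<and>
      (\<forall>k<n. \<forall>l<n. a k * b l = (if k = l then E 0 0 else 0))"
      using \<open>e' * e' = e'\<close> by (intro less.hyps)
    then obtain n :: nat and a b where IH': "e' = (\<Sum>k<n. b k * a k) \<and>
      (\<forall>k. E 0 0 * a k = a k \<and> b k * E 0 0 = b k \<and> a k \<in> Fin \<and> b k \<in> Fin) \<and>
      (\<forall>k<n. \<forall>l<n. a k * b l = (if k = l then E 0 0 else 0))"
      by (elim exE) (rule that)
    then have IH: "e' = (\<Sum>k<n. b k * a k)"
      "\<And>k. E 0 0 * a k = a k" "\<And>k. b k * E 0 0 = b k" "\<And>k. a k \<in> Fin" "\<And>k. b k \<in> Fin"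
      "\<And>k l. k < n \<Longrightarrow> l < n \<Longrightarrow> a k * b l = (if k = l then E 0 0 else 0)"
      by simp_all
    have ae: "a k * e' = a k" "e' * b k = b k" if "k < n" for k
    proof -
      have "a k * e' = (\<Sum>l<n. a k * b l * a l)"
        by (simp add: IH(1) sum_distrib_left mult.assoc)
      also have "\<dots> = (\<Sum>l<n. if l = k then a k else 0)"
        by (intro sum.cong) (auto simp: IH that)
      finally show "a k * e' = a k"
        using that by simp
      have "e' * b k = (\<Sum>l<n. b l * (a l * b k))"
        by (simp add: IH(1) sum_distrib_right mult.assoc)
      also have "\<dots> = (\<Sum>l<n. if l = k then b k else 0)"
        by (intro sum.cong) (auto simp: IH that)
      finally show "e' * b k = b k"
        using that by simp
    qed
    have e'v: "e' * v = 0" "u * e' = 0"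
    proof -
      have "v * u * v = v" "u * (v * u) = u"
        using uv eu by (metis mult.assoc)+
      then show "e' * v = 0" "u * e' = 0"
        using eu by (simp_all add: e'_def left_diff_distrib right_diff_distrib)
    qed
    have av: "a k * v = 0" "u * b k = 0" if "k < n" for k
      using ae[OF that] e'v by (metis mult.assoc mult_zero_left mult_zero_right)+
    define a' where "a' = a(n := u)"
    define b' where "b' = b(n := v)"
    have "e = (\<Sum>k<Suc n. b' k * a' k)"
    proof -
      have "(\<Sum>k<n. b' k * a' k) = e'"
        unfolding IH(1) by (intro sum.cong) (simp_all add: a'_def b'_def)
      then show ?thesis
        by (simp add: e'_def a'_def b'_def)
    qed
    moreover have "\<forall>k. E 0 0 * a' k = a' k \<and> b' k * E 0 0 = b' k \<and> a' k \<in> Fin \<and> b' k \<in> Fin"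
      using IH eu fin by (simp add: a'_def b'_def)
    moreover have "\<forall>k<Suc n. \<forall>l<Suc n. a' k * b' l = (if k = l then E 0 0 else 0)"
      using IH(6) av uv by (auto simp: a'_def b'_def less_Suc_eq)
    ultimately show ?thesis
      by blast
  qed
qed

section \<open>Transfer to the record-based algebras\<close>

text \<open>A bridge from type-class vector spaces to records: the module axioms of
  \<open>M\<close>, its spans, finite sums and dimension are derived from the subspace
  \<open>W\<close>. In this way the quotient defining a tensor product becomes a module without
  separate verification.\<close>

locale linear_onto = vector_space scale
  for scale :: "'f::field \<Rightarrow> 'v::ab_group_add \<Rightarrow> 'v" +
  fixes W :: "'v set" and M :: "('f, 'a) module" and h :: "'v \<Rightarrow> 'a"
  assumes W: "subspace W"
    and image: "h ` W = carrier M"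
    and h_add: "x \<in> W \<Longrightarrow> y \<in> W \<Longrightarrow> h (x + y) = h x \<oplus>\<^bsub>M\<^esub> h y"
    and h_scale: "x \<in> W \<Longrightarrow> h (scale c x) = c \<odot>\<^bsub>M\<^esub> h x"
    and h_zero: "h 0 = \<zero>\<^bsub>M\<^esub>"
begin

lemma closed: "x \<in> W \<Longrightarrow> h x \<in> carrier M"
  using image by blast

lemma carrierE: assumes "y \<in> carrier M" obtains x where "x \<in> W" "y = h x"
  using assms image by blast

lemmas W_closed = subspace_add[OF W] subspace_scale[OF W] subspace_0[OF W] subspace_diff[OF W]
  subspace_neg[OF W]

lemma module: "Module.module class_ring M"
proof (rule module_criteria)
  show "cring (class_ring :: 'f ring)" ..
  show "\<zero>\<^bsub>M\<^esub> \<in> carrier M"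
    using closed[OF subspace_0[OF W]] h_zero by simp
  show "\<forall>v w. v \<in> carrier M \<and> w \<in> carrier M \<longrightarrow> v \<oplus>\<^bsub>M\<^esub> w \<in> carrier M"
    by (metis carrierE closed h_add subspace_add[OF W])
  show "\<forall>v\<in>carrier M. \<exists>w\<in>carrier M. v \<oplus>\<^bsub>M\<^esub> w = \<zero>\<^bsub>M\<^esub>"
  proof
    fix v assume "v \<in> carrier M"
    then obtain x where x: "x \<in> W" "v = h x"
      by (rule carrierE)
    then have "v \<oplus>\<^bsub>M\<^esub> h (- x) = \<zero>\<^bsub>M\<^esub>"
      using h_add[of x "- x"] h_zero subspace_neg[OF W] by simp
    then show "\<exists>w\<in>carrier M. v \<oplus>\<^bsub>M\<^esub> w = \<zero>\<^bsub>M\<^esub>"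
      using closed subspace_neg[OF W] x by blast
  qed
  show "\<forall>c v. c \<in> carrier class_ring \<and> v \<in> carrier M \<longrightarrow> c \<odot>\<^bsub>M\<^esub> v \<in> carrier M"
    by (metis carrierE closed h_scale subspace_scale[OF W])
  show "\<forall>v w. v \<in> carrier M \<and> w \<in> carrier M \<longrightarrow> v \<oplus>\<^bsub>M\<^esub> w = w \<oplus>\<^bsub>M\<^esub> v"
    by (metis carrierE h_add add.commute)
  show "\<forall>v w x. v \<in> carrier M \<and> w \<in> carrier M \<and> x \<in> carrier M \<longrightarrow>
      v \<oplus>\<^bsub>M\<^esub> w \<oplus>\<^bsub>M\<^esub> x = v \<oplus>\<^bsub>M\<^esub> (w \<oplus>\<^bsub>M\<^esub> x)"
  proof (intro allI impI, elim conjE)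
    fix v w x assume "v \<in> carrier M" "w \<in> carrier M" "x \<in> carrier M"
    then obtain a b c where "a \<in> W" "v = h a" "b \<in> W" "w = h b" "c \<in> W" "x = h c"
      by (metis carrierE)
    then show "v \<oplus>\<^bsub>M\<^esub> w \<oplus>\<^bsub>M\<^esub> x = v \<oplus>\<^bsub>M\<^esub> (w \<oplus>\<^bsub>M\<^esub> x)"
      by (simp add: subspace_add[OF W] add.assoc flip: h_add)
  qed
  show "\<forall>v\<in>carrier M. v \<oplus>\<^bsub>M\<^esub> \<zero>\<^bsub>M\<^esub> = v"
    by (metis carrierE h_add h_zero subspace_0[OF W] add.right_neutral)
  show "\<forall>a b v. a \<in> carrier class_ring \<and> b \<in> carrier class_ring \<and> v \<in> carrier M \<longrightarrow>
      (a \<otimes>\<^bsub>class_ring\<^esub> b) \<odot>\<^bsub>M\<^esub> v = a \<odot>\<^bsub>M\<^esub> (b \<odot>\<^bsub>M\<^esub> v)"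
    by (auto elim!: carrierE simp: class_ring_simps subspace_scale[OF W] simp flip: h_scale)
  show "\<forall>v\<in>carrier M. \<one>\<^bsub>class_ring\<^esub> \<odot>\<^bsub>M\<^esub> v = v"
    by (auto elim!: carrierE simp: class_ring_simps simp flip: h_scale)
  show "\<forall>a b v. a \<in> carrier class_ring \<and> b \<in> carrier class_ring \<and> v \<in> carrier M \<longrightarrow>
      (a \<oplus>\<^bsub>class_ring\<^esub> b) \<odot>\<^bsub>M\<^esub> v = a \<odot>\<^bsub>M\<^esub> v \<oplus>\<^bsub>M\<^esub> b \<odot>\<^bsub>M\<^esub> v"
    by (auto elim!: carrierE simp: class_ring_simps subspace_scale[OF W] scale_left_distrib
        simp flip: h_scale h_add)
  show "\<forall>a v w. a \<in> carrier class_ring \<and> v \<in> carrier M \<and> w \<in> carrier M \<longrightarrow>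
      a \<odot>\<^bsub>M\<^esub> (v \<oplus>\<^bsub>M\<^esub> w) = a \<odot>\<^bsub>M\<^esub> v \<oplus>\<^bsub>M\<^esub> a \<odot>\<^bsub>M\<^esub> w"
    by (auto elim!: carrierE simp: subspace_scale[OF W] subspace_add[OF W] scale_right_distrib
        simp flip: h_scale h_add)
qed

lemma vectorspace: "vectorspace class_ring M"
  using module class_field by (rule vectorspace.intro)

lemma submodule_image:
  assumes "subspace U" "U \<subseteq> W"
  shows "submodule class_ring (h ` U) M"
proof (rule submodule.intro)
  show "h ` U \<subseteq> carrier M"
    using assms(2) closed by blast
  show "\<zero>\<^bsub>M\<^esub> \<in> h ` U"
    using subspace_0[OF assms(1)] h_zero by (metis imageI)
  fix v w assume "v \<in> h ` U" "w \<in> h ` U"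
  then obtain x y where "x \<in> U" "v = h x" "y \<in> U" "w = h y"
    by blast
  then show "v \<oplus>\<^bsub>M\<^esub> w \<in> h ` U"
    using subspace_add[OF assms(1), of x y] h_add[of x y] assms(2) by (metis imageI subsetD)
next
  fix c v assume "v \<in> h ` U"
  then obtain x where "x \<in> U" "v = h x"
    by blast
  then show "c \<odot>\<^bsub>M\<^esub> v \<in> h ` U"
    using subspace_scale[OF assms(1), of x c] h_scale[of x c] assms(2) by (metis imageI subsetD)
qed (rule module)

lemma subspace_image:
  "subspace U \<Longrightarrow> U \<subseteq> W \<Longrightarrow> VectorSpace.subspace class_ring (h ` U) M"
  by (intro VectorSpace.subspace.intro vectorspace submodule_image)

lemma subspace_vimage:
  assumes "submodule class_ring Y M"
  shows "subspace {x \<in> W. h x \<in> Y}"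
proof (rule subspaceI)
  show "0 \<in> {x \<in> W. h x \<in> Y}"
    using submodule.zero_closed[OF assms] subspace_0[OF W] h_zero by simp
next
  fix x y assume "x \<in> {x \<in> W. h x \<in> Y}" "y \<in> {x \<in> W. h x \<in> Y}"
  then show "x + y \<in> {x \<in> W. h x \<in> Y}"
    using submodule.m_closed[OF assms, of "h x" "h y"] subspace_add[OF W] h_add by simp
next
  fix c x assume "x \<in> {x \<in> W. h x \<in> Y}"
  then show "scale c x \<in> {x \<in> W. h x \<in> Y}"
    using submodule.smult_closed[OF assms, of c "h x"] subspace_scale[OF W] h_scale
    by (simp add: class_ring_simps)
qed

lemma lin_span_image:
  assumes "U \<subseteq> W"
  shows "lin_span M (h ` U) = h ` span U"
proof
  have "span U \<subseteq> W"
    by (rule span_minimal[OF assms W])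
  then show "lin_span M (h ` U) \<subseteq> h ` span U"
    by (intro module.span_is_subset[OF module] submodule_image subspace_span image_mono span_superset)
  have hU: "h ` U \<subseteq> carrier M"
    using assms closed by blast
  have "U \<subseteq> {x \<in> W. h x \<in> lin_span M (h ` U)}"
    using assms module.in_own_span[OF module hU] by blast
  then have "span U \<subseteq> {x \<in> W. h x \<in> lin_span M (h ` U)}"
    by (intro span_minimal subspace_vimage module.span_is_submodule[OF module hU])
  then show "h ` span U \<subseteq> lin_span M (h ` U)"
    by blast
qed

lemma finsum_image:
  assumes "\<And>a. a \<in> A \<Longrightarrow> c a \<in> W"
  shows "finsum M (\<lambda>a. h (c a)) A = h (sum c A)"
proof -
  interpret M: abelian_group M
    using module by (rule Module.module.axioms)
  show ?thesis
    using assms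
  proof (induction A rule: infinite_finite_induct)
    case (infinite A)
    then show ?case
      by (simp add: finsum_def finprod_def h_zero)
  next
    case (insert a A)
    have "finsum M (\<lambda>a. h (c a)) (insert a A) = h (c a) \<oplus>\<^bsub>M\<^esub> finsum M (\<lambda>a. h (c a)) A"
      using insert closed by (intro M.finsum_insert) auto
    also have "\<dots> = h (c a + sum c A)"
      using insert by (simp add: h_add subspace_sum[OF W])
    finally show ?case
      using insert by simp
  qed (simp add: h_zero)
qed

text \<open>The dimension is the least size of a finite spanning set, and the empty set spans only
  zero.\<close>

lemma dim_eq_1:
  assumes W_line: "W \<subseteq> range (\<lambda>c. scale c x)" and "x \<in> W" and "h x \<noteq> \<zero>\<^bsub>M\<^esub>"
  shows "vectorspace.dim class_ring M = 1"
proof -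
  let ?P = "\<lambda>n. \<exists>A. finite A \<and> card A = n \<and> A \<subseteq> carrier M \<and> lin_span M A = carrier M"
  have dim: "vectorspace.dim class_ring M = (LEAST n. ?P n)"
    by (rule vectorspace.dim_def[OF vectorspace])
  have "W \<subseteq> span {x}"
    using W_line by (auto intro: span_scale span_base)
  moreover have "span {x} \<subseteq> W"
    using assms(2) by (intro span_minimal W) simp
  ultimately have "lin_span M (h ` {x}) = carrier M"
    using lin_span_image[of "{x}"] assms(2) image by simp
  then have P1: "?P 1"
    using closed[OF assms(2)] by (intro exI[of _ "{h x}"]) simp
  have not_P0: "\<not> ?P 0"
  proof
    assume "?P 0"
    then have "lin_span M {} = carrier M"
      by auto
    then have "h ` {0} = carrier M"
      using lin_span_image[of "{}"] by (simp add: span_empty)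
    then show False
      using closed[OF assms(2)] assms(3) h_zero by auto
  qed
  show ?thesis
    unfolding dim
  proof (rule Least_equality)
    show "?P 1" by (rule P1)
    show "1 \<le> n" if "?P n" for n
      using that not_P0 by (cases n) auto
  qed
qed

end

locale linear_iso = linear_onto scale W M h
  for scale :: "'f::field \<Rightarrow> 'v::ab_group_add \<Rightarrow> 'v" and W M h +
  assumes h_inj: "inj_on h W"

locale rmat_iso = linear_iso smul W M h
  for W :: "'f::field rmat set" and M h +
  assumes W_mult: "x \<in> W \<Longrightarrow> y \<in> W \<Longrightarrow> x * y \<in> W"
    and h_mult: "x \<in> W \<Longrightarrow> y \<in> W \<Longrightarrow> h (x * y) = h x \<otimes>\<^bsub>M\<^esub> h y"
begin

lemma grading_image:
  assumes S: "internal_grading G W S"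
  shows "grading G M (\<lambda>g. h ` S g)"
  unfolding grading_def
proof (intro conjI ballI)
  have sub: "rmat.subspace (S g)" "S g \<subseteq> W" if "g \<in> carrier G" for g
    using S[unfolded internal_grading_def, THEN conjunct1] that by blast+
  show "VectorSpace.subspace class_ring (h ` S g) M" if "g \<in> carrier G" for g
    using sub[OF that] by (rule subspace_image)
  show "x \<otimes>\<^bsub>M\<^esub> y \<in> h ` S (g \<otimes>\<^bsub>G\<^esub> k)"
    if gk: "g \<in> carrier G" "k \<in> carrier G" and xy: "x \<in> h ` S g" "y \<in> h ` S k" for g k x y
  proof -
    obtain a b where ab: "a \<in> S g" "x = h a" "b \<in> S k" "y = h b"
      using xy by blast
    then have "a * b \<in> S (g \<otimes>\<^bsub>G\<^esub> k)"
      using S[unfolded internal_grading_def, THEN conjunct2, THEN conjunct2, THEN conjunct2] gk by blast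
    moreover have "x \<otimes>\<^bsub>M\<^esub> y = h (a * b)"
      unfolding ab using ab sub(2) gk by (intro h_mult[symmetric]) blast+
    ultimately show ?thesis
      by blast
  qed
  show "\<exists>!c. c \<in> (\<Pi>\<^sub>E g\<in>carrier G. h ` S g) \<and> x = (\<Oplus>\<^bsub>M\<^esub>g\<in>carrier G. c g)"
    if x: "x \<in> carrier M" for x
  proof -
    obtain w where w: "w \<in> W" "x = h w"
      using x by (rule carrierE)
    obtain c where c: "\<And>g. g \<in> carrier G \<Longrightarrow> c g \<in> S g" "w = (\<Sum>g\<in>carrier G. c g)"
      using S[unfolded internal_grading_def, THEN conjunct2, THEN conjunct1] w by blast
    have decomposition: "(\<Oplus>\<^bsub>M\<^esub>g\<in>carrier G. d g) = h (\<Sum>g\<in>carrier G. b g)"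
      if "\<And>g. g \<in> carrier G \<Longrightarrow> b g \<in> S g \<and> d g = h (b g)" for b d
    proof -
      interpret M: abelian_group M
        using module by (rule Module.module.axioms)
      have "(\<Oplus>\<^bsub>M\<^esub>g\<in>carrier G. d g) = (\<Oplus>\<^bsub>M\<^esub>g\<in>carrier G. h (b g))"
        using that sub(2) closed by (intro M.finsum_cong') (auto simp: subset_iff)
      then show ?thesis
        using finsum_image[of "carrier G" b] that sub(2) by (simp add: subset_iff)
    qed
    show ?thesis
    proof (rule ex1I)
      show "(\<lambda>g\<in>carrier G. h (c g)) \<in> (\<Pi>\<^sub>E g\<in>carrier G. h ` S g) \<and>
          x = (\<Oplus>\<^bsub>M\<^esub>g\<in>carrier G. (\<lambda>g\<in>carrier G. h (c g)) g)"
        using c(1) decomposition[of c "\<lambda>g\<in>carrier G. h (c g)"] w(2) c(2) by auto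
    next
      fix d assume d: "d \<in> (\<Pi>\<^sub>E g\<in>carrier G. h ` S g) \<and> x = (\<Oplus>\<^bsub>M\<^esub>g\<in>carrier G. d g)"
      then have "\<forall>g\<in>carrier G. \<exists>y. y \<in> S g \<and> d g = h y"
        by (auto simp: PiE_iff)
      then obtain b where b: "\<And>g. g \<in> carrier G \<Longrightarrow> b g \<in> S g \<and> d g = h (b g)"
        by metis
      have sums: "(\<Sum>g\<in>carrier G. b g) \<in> W"
        using b sub(2) by (intro subspace_sum[OF W]) blast
      have "h (\<Sum>g\<in>carrier G. b g) = h w"
        using d decomposition[OF b] w(2) by simp
      then have "(\<Sum>g\<in>carrier G. b g) = w"
        using h_inj sums w(1) by (simp add: inj_on_eq_iff)
      then have "(\<Sum>g\<in>carrier G. b g - c g) = 0"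
        using c(2) by (simp add: sum_subtractf)
      moreover have "b g - c g \<in> S g" if "g \<in> carrier G" for g
        using that b c(1) sub(1) by (intro rmat.subspace_diff) auto
      ultimately have "b g - c g = 0" if "g \<in> carrier G" for g
        using S[unfolded internal_grading_def, THEN conjunct2, THEN conjunct2, THEN conjunct1,
            THEN spec[of _ "\<lambda>g. b g - c g"]] that by blast
      then have "d g = (\<lambda>g\<in>carrier G. h (c g)) g" if "g \<in> carrier G" for g
        using b that by simp
      then show "d = (\<lambda>g\<in>carrier G. h (c g))"
        using d by (intro extensionalityI[of _ "carrier G"]) (auto simp: PiE_def)
    qed
  qed
qed

lemma grading_vimage:
  assumes R: "grading G M R"
  shows "internal_grading G W (\<lambda>g. {x \<in> W. h x \<in> R g})"
proof -
  interpret M: abelian_group M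
    using module by (rule Module.module.axioms)
  have sub: "submodule class_ring (R g) M" if "g \<in> carrier G" for g
    using R that by (auto simp: grading_def VectorSpace.subspace_def)
  have R_carrier: "R g \<subseteq> carrier M" if "g \<in> carrier G" for g
    using submodule.subset[OF sub[OF that]] .
  have ex1: "\<exists>!c. c \<in> (\<Pi>\<^sub>E g\<in>carrier G. R g) \<and> x = (\<Oplus>\<^bsub>M\<^esub>g\<in>carrier G. c g)"
    if "x \<in> carrier M" for x
    using R that by (simp add: grading_def)
  show ?thesis
    unfolding internal_grading_def
  proof (intro conjI ballI allI impI)
    show "rmat.subspace {x \<in> W. h x \<in> R g}" if "g \<in> carrier G" for g
      using sub[OF that] by (rule subspace_vimage)
    show "{x \<in> W. h x \<in> R g} \<subseteq> W" for g
      by blast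
    show "x * y \<in> {x \<in> W. h x \<in> R (g \<otimes>\<^bsub>G\<^esub> k)}"
      if "g \<in> carrier G" "k \<in> carrier G" "x \<in> {x \<in> W. h x \<in> R g}" "y \<in> {x \<in> W. h x \<in> R k}" for g k x y
      using R that W_mult h_mult by (simp add: grading_def)
  next
    fix x assume x: "x \<in> W"
    obtain c where c: "c \<in> (\<Pi>\<^sub>E g\<in>carrier G. R g)" "h x = (\<Oplus>\<^bsub>M\<^esub>g\<in>carrier G. c g)"
      using ex1[OF closed[OF x]] by blast
    have "\<forall>g\<in>carrier G. \<exists>y. y \<in> W \<and> c g = h y"
      using c(1) R_carrier carrierE by (metis PiE_mem subsetD)
    then obtain b where b: "\<And>g. g \<in> carrier G \<Longrightarrow> b g \<in> W \<and> c g = h (b g)"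
      by metis
    have "h x = (\<Oplus>\<^bsub>M\<^esub>g\<in>carrier G. h (b g))"
      unfolding c(2) using b closed by (intro M.finsum_cong') auto
    also have "\<dots> = h (\<Sum>g\<in>carrier G. b g)"
      using b by (intro finsum_image) blast
    finally have "x = (\<Sum>g\<in>carrier G. b g)"
      using h_inj x b by (simp add: inj_on_eq_iff subspace_sum[OF W])
    moreover have "\<forall>g\<in>carrier G. b g \<in> {x \<in> W. h x \<in> R g}"
      using b c(1) by (metis (no_types, lifting) PiE_mem mem_Collect_eq)
    ultimately show "\<exists>c. (\<forall>g\<in>carrier G. c g \<in> {x \<in> W. h x \<in> R g}) \<and> x = (\<Sum>g\<in>carrier G. c g)"
      by blast
  next
    fix c g assume c: "\<forall>g\<in>carrier G. c g \<in> {x \<in> W. h x \<in> R g}" and zero: "(\<Sum>g\<in>carrier G. c g) = 0"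
      and g: "g \<in> carrier G"
    \<comment> \<open>Both families decompose zero; the uniqueness clause of \<open>grading\<close>
      at zero identifies them, which is independence.\<close>
    let ?c = "\<lambda>g\<in>carrier G. h (c g)" and ?z = "\<lambda>g\<in>carrier G. \<zero>\<^bsub>M\<^esub>"
    have "(\<Oplus>\<^bsub>M\<^esub>g\<in>carrier G. ?c g) = (\<Oplus>\<^bsub>M\<^esub>g\<in>carrier G. h (c g))"
      using c closed by (intro M.finsum_cong') auto
    also have "\<dots> = h 0"
      using c finsum_image[of "carrier G" c] zero by simp
    finally have "?c \<in> (\<Pi>\<^sub>E g\<in>carrier G. R g) \<and> \<zero>\<^bsub>M\<^esub> = (\<Oplus>\<^bsub>M\<^esub>g\<in>carrier G. ?c g)"
      using c h_zero by auto
    moreover have "(\<Oplus>\<^bsub>M\<^esub>g\<in>carrier G. ?z g) = (\<Oplus>\<^bsub>M\<^esub>g\<in>carrier G. \<zero>\<^bsub>M\<^esub>)"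
      by (intro M.finsum_cong') auto
    then have "?z \<in> (\<Pi>\<^sub>E g\<in>carrier G. R g) \<and> \<zero>\<^bsub>M\<^esub> = (\<Oplus>\<^bsub>M\<^esub>g\<in>carrier G. ?z g)"
      using submodule.zero_closed[OF sub] by (auto simp: M.finsum_zero)
    ultimately have "?c = ?z"
      using ex1[OF M.zero_closed] by blast
    then have "h (c g) = h 0"
      using g h_zero by (metis restrict_apply')
    then show "c g = 0"
      using h_inj c g subspace_0[OF W] by (simp add: inj_on_eq_iff)
  qed
qed

end

lemma entry_Fin: "entry ` Fin = {X. finite {(i, j). X i j \<noteq> 0}}"
proof (intro equalityI subsetI)
  fix X :: "nat \<Rightarrow> nat \<Rightarrow> 'a" assume "X \<in> {X. finite {(i, j). X i j \<noteq> 0}}"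
  then have fin: "finite {(i, j). X i j \<noteq> 0}"
    by simp
  have "finite {j. X i j \<noteq> 0}" for i
  proof (rule finite_subset)
    show "{j. X i j \<noteq> 0} \<subseteq> snd ` {(i, j). X i j \<noteq> 0}"
      by force
  qed (use fin in simp)
  then have "entry (Rmat X) = X"
    by (simp add: Rmat_inverse)
  then show "X \<in> entry ` Fin"
    using fin by (intro image_eqI[of _ _ "Rmat X"]) (simp_all add: Fin_def)
qed (auto simp: Fin_def)

interpretation finitary: rmat_iso Fin "finitary_mat TYPE('f::field)" entry
proof
  show "entry ` Fin = carrier (finitary_mat TYPE('f))"
    by (simp add: entry_Fin finitary_mat_def)
  show "inj_on entry Fin"
    by (simp add: inj_on_def entry_inject)
qed (auto simp: subspace_Fin finitary_mat_def plus_rmat.rep_eq smul.rep_eq zero_rmat.rep_eq times_rmat.rep_eq)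

section \<open>Elementary gradings by support conditions\<close>

definition elementary_component ::
  "('g, 'm) monoid_scheme \<Rightarrow> (nat \<Rightarrow> 'g) \<Rightarrow> 'g \<Rightarrow> 'f::field rmat set" where
  "elementary_component G s g =
    {x \<in> Fin. \<forall>i j. entry x i j \<noteq> 0 \<longrightarrow> inv\<^bsub>G\<^esub> (s i) \<otimes>\<^bsub>G\<^esub> s j = g}"

lemma elementary_component_span:
  fixes G :: "('g, 'm) monoid_scheme" and s :: "nat \<Rightarrow> 'g" and g :: 'g
  defines "C \<equiv> elementary_component G s g :: 'f::field rmat set"
  shows "C = rmat.span {E i j | i j. inv\<^bsub>G\<^esub> (s i) \<otimes>\<^bsub>G\<^esub> s j = g}"
proof
  show "C \<subseteq> rmat.span {E i j | i j. inv\<^bsub>G\<^esub> (s i) \<otimes>\<^bsub>G\<^esub> s j = g}"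
  proof
    fix x :: "'f rmat" assume x: "x \<in> C"
    then obtain N where N: "x \<in> corner N"
      by (auto simp: C_def elementary_component_def elim: FinE)
    have "smul (entry x i j) (E i j) \<in> rmat.span {E i j | i j. inv\<^bsub>G\<^esub> (s i) \<otimes>\<^bsub>G\<^esub> s j = g}" for i j
    proof (cases "entry x i j = 0")
      case False
      then have "inv\<^bsub>G\<^esub> (s i) \<otimes>\<^bsub>G\<^esub> s j = g"
        using x by (simp add: C_def elementary_component_def)
      then show ?thesis
        by (intro rmat.span_scale rmat.span_base) blast
    qed (simp add: rmat.span_zero)
    then have "(\<Sum>i<N. \<Sum>j<N. smul (entry x i j) (E i j)) \<in> rmat.span {E i j | i j. inv\<^bsub>G\<^esub> (s i) \<otimes>\<^bsub>G\<^esub> s j = g}"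
      by (intro rmat.span_sum)
    then show "x \<in> rmat.span {E i j | i j. inv\<^bsub>G\<^esub> (s i) \<otimes>\<^bsub>G\<^esub> s j = g}"
      by (simp flip: corner_expand[OF N])
  qed
  have "rmat.subspace C"
  proof (rule rmat.subspaceI)
    fix x y :: "'f rmat" assume "x \<in> C" "y \<in> C"
    moreover have "entry x i j \<noteq> 0 \<or> entry y i j \<noteq> 0" if "entry (x + y) i j \<noteq> 0" for i j
      using that by (auto simp: plus_rmat.rep_eq)
    ultimately show "x + y \<in> C"
      unfolding C_def elementary_component_def by blast
  qed (auto simp: C_def elementary_component_def entry_simps)
  then show "rmat.span {E i j | i j. inv\<^bsub>G\<^esub> (s i) \<otimes>\<^bsub>G\<^esub> s j = g} \<subseteq> C"
    by (rule rmat.span_minimal[rotated]) (auto simp: C_def elementary_component_def entry_E split: if_splits)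
qed

text \<open>Each position \<open>(i, j)\<close> carries the single degree \<open>s_i^-1 s_j\<close>,
  so decomposing a matrix means sorting its entries; along a product the degrees telescope.\<close>

lemma internal_grading_elementary:
  fixes G :: "('g, 'm) monoid_scheme" (structure)
  assumes "group G" "finite (carrier G)" and s: "\<And>i. s i \<in> carrier G"
  shows "internal_grading G (Fin :: 'f::field rmat set) (elementary_component G s)"
  unfolding internal_grading_def
proof (intro conjI ballI allI impI)
  interpret group G by fact
  let ?C = "elementary_component G s :: 'g \<Rightarrow> 'f rmat set"
  show "rmat.subspace (?C g)" for g
    by (subst elementary_component_span) (rule rmat.subspace_span)
  show "?C g \<subseteq> Fin" for g
    by (auto simp: elementary_component_def)
  show "x * y \<in> ?C (g \<otimes> h)"
    if gh: "g \<in> carrier G" "h \<in> carrier G" and x: "x \<in> ?C g" and y: "y \<in> ?C h" for g h x y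
  proof -
    have "inv (s i) \<otimes> s k = g \<otimes> h" if ne: "entry (x * y) i k \<noteq> 0" for i k
    proof -
      obtain j where "entry x i j \<noteq> 0" "entry y j k \<noteq> 0"
        using ne unfolding times_rmat.rep_eq
        by (elim sum.not_neutral_contains_not_neutral) auto
      then have "inv (s i) \<otimes> s j = g" "inv (s j) \<otimes> s k = h"
        using x y by (auto simp: elementary_component_def)
      moreover have "s j \<otimes> (inv (s j) \<otimes> s k) = s k"
        using s by (simp flip: m_assoc)
      ultimately show ?thesis
        using s by (auto simp: m_assoc)
    qed
    then show ?thesis
      using x y by (simp add: elementary_component_def)
  qed
  show "\<exists>c. (\<forall>g\<in>carrier G. c g \<in> ?C g) \<and> x = (\<Sum>g\<in>carrier G. c g)" if x: "x \<in> Fin" for x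
  proof -
    define c where "c g = Rmat (\<lambda>i j. if inv (s i) \<otimes> s j = g then entry x i j else 0)" for g
    have c: "entry (c g) i j = (if inv (s i) \<otimes> s j = g then entry x i j else 0)" for g i j
    proof -
      have "finite {j. (if inv (s i) \<otimes> s j = g then entry x i j else 0) \<noteq> 0}" for i
        by (rule finite_subset[OF _ finite_row[of x i]]) (auto split: if_splits)
      then show ?thesis
        unfolding c_def by (subst Rmat_inverse) auto
    qed
    have "c g \<in> ?C g" for g
    proof -
      have "{(i, j). entry (c g) i j \<noteq> 0} \<subseteq> {(i, j). entry x i j \<noteq> 0}"
        by (auto simp: c split: if_splits)
      then have "c g \<in> Fin"
        using x unfolding Fin_def by (auto intro: finite_subset)
      then show ?thesis
        by (simp add: elementary_component_def c)
    qed
    moreover have "x = (\<Sum>g\<in>carrier G. c g)"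
      by (rule rmat_eqI) (simp add: entry_sum c s assms(2))
    ultimately show ?thesis
      by blast
  qed
  show "c g = 0"
    if c: "\<forall>g\<in>carrier G. c g \<in> ?C g" and zero: "(\<Sum>g\<in>carrier G. c g) = 0" and g: "g \<in> carrier G" for c g
  proof (rule rmat_eqI)
    fix i j
    have "entry (c h) i j = 0" if "h \<in> carrier G" "h \<noteq> g" "inv (s i) \<otimes> s j = g" for h
      using c that by (auto simp: elementary_component_def)
    moreover have "(\<Sum>h\<in>carrier G. entry (c h) i j) = 0"
      using zero by (metis entry_sum zero_rmat.rep_eq)
    ultimately have "entry (c g) i j = 0" if "inv (s i) \<otimes> s j = g"
      using that g sum.remove[OF assms(2) g, of "\<lambda>h. entry (c h) i j"] by simp
    moreover have "entry (c g) i j = 0" if "inv (s i) \<otimes> s j \<noteq> g"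
      using c g that by (auto simp: elementary_component_def)
    ultimately show "entry (c g) i j = entry 0 i j"
      by (auto simp: zero_rmat.rep_eq)
  qed
qed

lemma elementary_grading_entry:
  fixes G :: "('g, 'm) monoid_scheme"
  assumes "group G" "finite (carrier G)" "\<And>i. s i \<in> carrier G"
  shows "elementary_grading G (\<lambda>g. entry ` (elementary_component G s g :: 'f::field rmat set))"
  unfolding elementary_grading_def
proof (intro conjI exI[of _ s] allI ballI)
  show "grading G (finitary_mat TYPE('f)) (\<lambda>g. entry ` elementary_component G s g)"
    by (intro finitary.grading_image internal_grading_elementary assms)
  fix g
  have "entry ` {E i j | i j. inv\<^bsub>G\<^esub> (s i) \<otimes>\<^bsub>G\<^esub> s j = g} =
      {mat_unit i j :: nat \<Rightarrow> nat \<Rightarrow> 'f | i j. inv\<^bsub>G\<^esub> (s i) \<otimes>\<^bsub>G\<^esub> s j = g}"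
    unfolding E.rep_eq[symmetric] by blast
  moreover have "{E i j :: 'f rmat | i j. inv\<^bsub>G\<^esub> (s i) \<otimes>\<^bsub>G\<^esub> s j = g} \<subseteq> Fin"
    by auto
  ultimately show "entry ` elementary_component G s g =
      lin_span (finitary_mat TYPE('f)) {mat_unit i j | i j. inv\<^bsub>G\<^esub> (s i) \<otimes>\<^bsub>G\<^esub> s j = g}"
    using finitary.lin_span_image[of "{E i j :: 'f rmat | i j. inv\<^bsub>G\<^esub> (s i) \<otimes>\<^bsub>G\<^esub> s j = g}"]
    by (simp add: elementary_component_span)
qed (rule assms)

lemma supp_elementary:
  fixes G :: "('g, 'm) monoid_scheme"
  assumes "g \<in> supp G (finitary_mat TYPE('f)) (\<lambda>g. entry ` (elementary_component G s g :: 'f::field rmat set))"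
  obtains i j where "inv\<^bsub>G\<^esub> (s i) \<otimes>\<^bsub>G\<^esub> s j = g"
proof -
  have ne: "entry ` (elementary_component G s g :: 'f rmat set) \<noteq> {\<zero>\<^bsub>finitary_mat TYPE('f)\<^esub>}"
    using assms by (simp add: supp_def)
  have "(0 :: 'f rmat) \<in> elementary_component G s g"
    unfolding elementary_component_span by (rule rmat.span_zero)
  then have "elementary_component G s g \<noteq> {0 :: 'f rmat}" "elementary_component G s g \<noteq> ({} :: 'f rmat set)"
    using ne finitary.h_zero[where 'f = 'f] by auto
  then obtain x :: "'f rmat" where "x \<in> elementary_component G s g" "x \<noteq> 0"
    by blast
  moreover from this(2) obtain i j where "entry x i j \<noteq> 0"
    by (rule rmat_neq_0E)
  ultimately show thesis
    using that by (auto simp: elementary_component_def)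
qed

section \<open>Tensor products\<close>

abbreviation pscale :: "'f::field \<Rightarrow> ('k \<Rightarrow>\<^sub>0 'f) \<Rightarrow> ('k \<Rightarrow>\<^sub>0 'f)" where
  "pscale c \<equiv> Poly_Mapping.map ((*) c)"

lemma lookup_pscale [simp]: "Poly_Mapping.lookup (pscale c w) k = c * Poly_Mapping.lookup w k"
  by (simp add: Poly_Mapping.map.rep_eq when_def)

global_interpretation pm: vector_space "pscale :: 'f::field \<Rightarrow> ('k \<Rightarrow>\<^sub>0 'f) \<Rightarrow> ('k \<Rightarrow>\<^sub>0 'f)"
  by unfold_locales (rule poly_mapping_eqI; simp add: lookup_add algebra_simps)+

definition supported_on :: "'k set \<Rightarrow> ('k \<Rightarrow>\<^sub>0 'f::field) set" where
  "supported_on X = {w. Poly_Mapping.keys w \<subseteq> X}"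

lemma supported_on_iff: "w \<in> supported_on X \<longleftrightarrow> (\<forall>k. Poly_Mapping.lookup w k \<noteq> 0 \<longrightarrow> k \<in> X)"
  by (auto simp: supported_on_def in_keys_iff)

lemma subspace_supported_on: "pm.subspace (supported_on X)"
proof (rule pm.subspaceI)
  fix x y :: "'b \<Rightarrow>\<^sub>0 'a" assume *: "x \<in> supported_on X" "y \<in> supported_on X"
  show "x + y \<in> supported_on X"
    using keys_add[of x y] * by (auto simp: supported_on_def)
qed (auto simp: supported_on_iff)

lemma single_expand:
  "w = (\<Sum>p\<in>Poly_Mapping.keys w. pscale (Poly_Mapping.lookup w p) (Poly_Mapping.single p 1))"
proof (rule poly_mapping_eqI)
  fix k
  have "(\<Sum>p\<in>Poly_Mapping.keys w. Poly_Mapping.lookup w p * (1 when p = k)) =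
      (\<Sum>p\<in>Poly_Mapping.keys w. if p = k then Poly_Mapping.lookup w k else 0)"
    by (intro sum.cong) (auto simp: when_def)
  also have "\<dots> = Poly_Mapping.lookup w k"
    by (simp add: in_keys_iff)
  finally show "Poly_Mapping.lookup w k = Poly_Mapping.lookup (\<Sum>p\<in>Poly_Mapping.keys w.
      pscale (Poly_Mapping.lookup w p) (Poly_Mapping.single p 1)) k"
    by (simp add: lookup_sum lookup_single del: map_single)
qed

definition lin_ext :: "('k \<Rightarrow> 'f rmat) \<Rightarrow> ('k \<Rightarrow>\<^sub>0 'f::field) \<Rightarrow> 'f rmat" where
  "lin_ext t w = (\<Sum>p\<in>Poly_Mapping.keys w. smul (Poly_Mapping.lookup w p) (t p))"

lemma lin_ext_superset:
  "finite P \<Longrightarrow> Poly_Mapping.keys w \<subseteq> P \<Longrightarrow> lin_ext t w = (\<Sum>p\<in>P. smul (Poly_Mapping.lookup w p) (t p))"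
  unfolding lin_ext_def by (rule sum.mono_neutral_left) (auto simp: in_keys_iff)

lemma lin_ext_add: "lin_ext t (x + y) = lin_ext t x + lin_ext t y"
proof -
  let ?P = "Poly_Mapping.keys x \<union> Poly_Mapping.keys y"
  have "lin_ext t (x + y) = (\<Sum>p\<in>?P. smul (Poly_Mapping.lookup (x + y) p) (t p))"
    by (rule lin_ext_superset) (auto simp: keys_add)
  moreover have "lin_ext t x = (\<Sum>p\<in>?P. smul (Poly_Mapping.lookup x p) (t p))"
    "lin_ext t y = (\<Sum>p\<in>?P. smul (Poly_Mapping.lookup y p) (t p))"
    by (auto intro: lin_ext_superset)
  ultimately show ?thesis
    by (simp add: lookup_add rmat.scale_left_distrib sum.distrib)
qed

lemma lin_ext_0 [simp]: "lin_ext t 0 = 0"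
  by (simp add: lin_ext_def)

lemma lin_ext_pscale: "lin_ext t (pscale c x) = smul c (lin_ext t x)"
proof -
  have "lin_ext t (pscale c x) = (\<Sum>p\<in>Poly_Mapping.keys x. smul (Poly_Mapping.lookup (pscale c x) p) (t p))"
    by (rule lin_ext_superset) (auto simp: in_keys_iff)
  then show ?thesis
    by (simp add: lin_ext_def rmat.scale_sum_right)
qed

lemma lin_ext_diff: "lin_ext t (x - y) = lin_ext t x - lin_ext t y"
  by (metis add_diff_cancel_right' diff_add_cancel lin_ext_add)

lemma lin_ext_single [simp]: "lin_ext t (Poly_Mapping.single p c) = smul c (t p)"
  by (simp add: lin_ext_def)

lemma lin_ext_sum: "lin_ext t (sum f X) = (\<Sum>x\<in>X. lin_ext t (f x))"
  by (induction X rule: infinite_finite_induct) (simp_all add: lin_ext_add)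

lemma lin_ext_closed: "(\<And>p. p \<in> X \<Longrightarrow> t p \<in> Fin) \<Longrightarrow> w \<in> supported_on X \<Longrightarrow> lin_ext t w \<in> Fin"
  unfolding lin_ext_def supported_on_def by (intro Fin_sum Fin_smul) auto

section \<open>The homomorphism that a multiplicative bilinear map induces on a tensor
  product\<close>

locale tensor_factors =
  fixes A :: "('f::field, 'a) module" and B :: "('f, 'b) module" and t :: "'a \<Rightarrow> 'b \<Rightarrow> 'f rmat"
  assumes module_A: "Module.module class_ring A" and module_B: "Module.module class_ring B"
    and A_mult: "x \<in> carrier A \<Longrightarrow> x' \<in> carrier A \<Longrightarrow> x \<otimes>\<^bsub>A\<^esub> x' \<in> carrier A"
    and B_mult: "y \<in> carrier B \<Longrightarrow> y' \<in> carrier B \<Longrightarrow> y \<otimes>\<^bsub>B\<^esub> y' \<in> carrier B"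
    and t_Fin: "x \<in> carrier A \<Longrightarrow> y \<in> carrier B \<Longrightarrow> t x y \<in> Fin"
    and t_add_left: "x \<in> carrier A \<Longrightarrow> x' \<in> carrier A \<Longrightarrow> y \<in> carrier B \<Longrightarrow>
      t (x \<oplus>\<^bsub>A\<^esub> x') y = t x y + t x' y"
    and t_add_right: "x \<in> carrier A \<Longrightarrow> y \<in> carrier B \<Longrightarrow> y' \<in> carrier B \<Longrightarrow>
      t x (y \<oplus>\<^bsub>B\<^esub> y') = t x y + t x y'"
    and t_smult_left: "x \<in> carrier A \<Longrightarrow> y \<in> carrier B \<Longrightarrow> t (c \<odot>\<^bsub>A\<^esub> x) y = smul c (t x y)"
    and t_smult_right: "x \<in> carrier A \<Longrightarrow> y \<in> carrier B \<Longrightarrow> t x (c \<odot>\<^bsub>B\<^esub> y) = smul c (t x y)"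
    and t_mult: "x \<in> carrier A \<Longrightarrow> x' \<in> carrier A \<Longrightarrow> y \<in> carrier B \<Longrightarrow> y' \<in> carrier B \<Longrightarrow>
      t (x \<otimes>\<^bsub>A\<^esub> x') (y \<otimes>\<^bsub>B\<^esub> y') = t x y * t x' y'"
begin

definition K where
  "K = (supported_on (carrier A \<times> carrier B) :: (('a \<times> 'b) \<Rightarrow>\<^sub>0 'f) set)"

definition eval_t :: "(('a \<times> 'b) \<Rightarrow>\<^sub>0 'f) \<Rightarrow> 'f rmat" where
  "eval_t = lin_ext (\<lambda>(x, y). t x y)"

definition N where
  "N = bilinear_ideal A B"

abbreviation pure where
  "pure x y \<equiv> Poly_Mapping.single (x, y) (1 :: 'f)"

sublocale free: linear_onto pscale K "free_alg A B" id
proof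
  show "pm.subspace K"
    unfolding K_def by (rule subspace_supported_on)
qed (auto simp: free_alg_def K_def supported_on_def)

lemma pure_K: "x \<in> carrier A \<Longrightarrow> y \<in> carrier B \<Longrightarrow> pure x y \<in> K"
  by (simp add: K_def supported_on_def)

lemma eval_pure: "eval_t (pure x y) = t x y"
  by (simp add: eval_t_def)

lemma smult_A: "x \<in> carrier A \<Longrightarrow> c \<odot>\<^bsub>A\<^esub> x \<in> carrier A"
  using module.smult_closed[OF module_A] by (simp add: class_ring_simps)

lemma smult_B: "x \<in> carrier B \<Longrightarrow> c \<odot>\<^bsub>B\<^esub> x \<in> carrier B"
  using module.smult_closed[OF module_B] by (simp add: class_ring_simps)

lemma add_A: "x \<in> carrier A \<Longrightarrow> x' \<in> carrier A \<Longrightarrow> x \<oplus>\<^bsub>A\<^esub> x' \<in> carrier A"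
  using abelian_monoid.a_closed[OF abelian_group.axioms(1)[OF module.axioms(2)[OF module_A]]] .

lemma add_B: "x \<in> carrier B \<Longrightarrow> x' \<in> carrier B \<Longrightarrow> x \<oplus>\<^bsub>B\<^esub> x' \<in> carrier B"
  using abelian_monoid.a_closed[OF abelian_group.axioms(1)[OF module.axioms(2)[OF module_B]]] .

lemma relations_K: "bilinear_relations A B \<subseteq> K"
  unfolding bilinear_relations_def Let_def
  by (auto simp del: map_single intro!: free.W_closed(4) free.W_closed(2) pure_K add_A add_B smult_A smult_B)

lemma N_span: "N = pm.span (bilinear_relations A B)"
  using free.lin_span_image[OF relations_K] by (simp add: N_def bilinear_ideal_def)

lemma N_subspace: "pm.subspace N"
  unfolding N_span by (rule pm.subspace_span)

lemma N_K: "N \<subseteq> K"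
  unfolding N_span by (rule pm.span_minimal[OF relations_K free.W])

lemma eval_diff: "eval_t (x - y) = eval_t x - eval_t y"
  by (simp add: eval_t_def lin_ext_diff)

lemma eval_add: "eval_t (x + y) = eval_t x + eval_t y"
  by (simp add: eval_t_def lin_ext_add)

lemma eval_pscale: "eval_t (pscale c x) = smul c (eval_t x)"
  by (simp add: eval_t_def lin_ext_pscale)

lemma eval_sum: "eval_t (sum f X) = (\<Sum>x\<in>X. eval_t (f x))"
  by (simp add: eval_t_def lin_ext_sum)

lemma eval_0: "eval_t 0 = 0"
  by (simp add: eval_t_def)

lemma eval_Fin: "w \<in> K \<Longrightarrow> eval_t w \<in> Fin"
  unfolding eval_t_def K_def by (rule lin_ext_closed[rotated]) (auto simp: t_Fin)

lemma eval_N: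
  assumes "w \<in> N"
  shows "eval_t w = 0"
proof -
  have "bilinear_relations A B \<subseteq> {w. eval_t w = 0}"
    unfolding bilinear_relations_def Let_def
    by (auto simp: eval_diff eval_pscale eval_pure t_add_left t_add_right t_smult_left t_smult_right
        simp del: map_single)
  moreover have "pm.subspace {w. eval_t w = 0}"
    by (rule pm.subspaceI) (simp_all add: eval_0 eval_add eval_pscale)
  ultimately have "N \<subseteq> {w. eval_t w = 0}"
    unfolding N_span by (rule pm.span_minimal)
  then show ?thesis
    using assms by blast
qed

definition cong (infix "\<approx>" 50) where
  "x \<approx> y \<longleftrightarrow> x - y \<in> N"

lemma cong_refl [simp]: "x \<approx> x"
  by (simp add: cong_def pm.subspace_0[OF N_subspace])

lemma cong_sym: "x \<approx> y \<Longrightarrow> y \<approx> x"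
  unfolding cong_def using pm.subspace_neg[OF N_subspace, of "x - y"] by simp

lemma cong_trans [trans]: "x \<approx> y \<Longrightarrow> y \<approx> z \<Longrightarrow> x \<approx> z"
  unfolding cong_def using pm.subspace_add[OF N_subspace, of "x - y" "y - z"] by simp

lemma cong_add: "x \<approx> y \<Longrightarrow> x' \<approx> y' \<Longrightarrow> x + x' \<approx> y + y'"
  unfolding cong_def using pm.subspace_add[OF N_subspace, of "x - y" "x' - y'"]
  by (simp add: add_diff_add)

lemma cong_pscale: "x \<approx> y \<Longrightarrow> pscale c x \<approx> pscale c y"
  unfolding cong_def using pm.subspace_scale[OF N_subspace, of "x - y" c]
  by (simp add: pm.scale_right_diff_distrib)

lemma cong_sum: "(\<And>i. i \<in> I \<Longrightarrow> f i \<approx> g i) \<Longrightarrow> sum f I \<approx> sum g I"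
  by (induction I rule: infinite_finite_induct) (simp_all add: cong_add)

lemma relation_N: "w \<in> bilinear_relations A B \<Longrightarrow> w \<in> N"
  unfolding N_span by (rule pm.span_base)

lemma pure_add_left:
  "x \<in> carrier A \<Longrightarrow> x' \<in> carrier A \<Longrightarrow> y \<in> carrier B \<Longrightarrow> pure (x \<oplus>\<^bsub>A\<^esub> x') y \<approx> pure x y + pure x' y"
  unfolding cong_def diff_diff_add[symmetric]
  by (intro relation_N, unfold bilinear_relations_def Let_def) blast

lemma pure_add_right:
  "x \<in> carrier A \<Longrightarrow> y \<in> carrier B \<Longrightarrow> y' \<in> carrier B \<Longrightarrow> pure x (y \<oplus>\<^bsub>B\<^esub> y') \<approx> pure x y + pure x y'"
  unfolding cong_def diff_diff_add[symmetric]
  by (intro relation_N, unfold bilinear_relations_def Let_def) blast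

lemma pure_smult_left:
  "x \<in> carrier A \<Longrightarrow> y \<in> carrier B \<Longrightarrow> pure (c \<odot>\<^bsub>A\<^esub> x) y \<approx> pscale c (pure x y)"
  unfolding cong_def by (intro relation_N, unfold bilinear_relations_def Let_def) blast

lemma pure_smult_right:
  "x \<in> carrier A \<Longrightarrow> y \<in> carrier B \<Longrightarrow> pure x (c \<odot>\<^bsub>B\<^esub> y) \<approx> pscale c (pure x y)"
  unfolding cong_def by (intro relation_N, unfold bilinear_relations_def Let_def) blast

lemma mult_free:
  "u \<otimes>\<^bsub>free_alg A B\<^esub> w = (\<Sum>p\<in>Poly_Mapping.keys u. \<Sum>q\<in>Poly_Mapping.keys w.
    Poly_Mapping.single (fst p \<otimes>\<^bsub>A\<^esub> fst q, snd p \<otimes>\<^bsub>B\<^esub> snd q)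
      (Poly_Mapping.lookup u p * Poly_Mapping.lookup w q))"
  by (simp add: free_alg_def case_prod_unfold)

lemma mult_free_K: "u \<in> K \<Longrightarrow> w \<in> K \<Longrightarrow> u \<otimes>\<^bsub>free_alg A B\<^esub> w \<in> K"
  unfolding mult_free
proof (intro pm.subspace_sum[OF free.W])
  fix p q assume *: "u \<in> K" "w \<in> K" "p \<in> Poly_Mapping.keys u" "q \<in> Poly_Mapping.keys w"
  then have "p \<in> carrier A \<times> carrier B" "q \<in> carrier A \<times> carrier B"
    by (auto simp: K_def supported_on_def)
  then show "Poly_Mapping.single (fst p \<otimes>\<^bsub>A\<^esub> fst q, snd p \<otimes>\<^bsub>B\<^esub> snd q)
      (Poly_Mapping.lookup u p * Poly_Mapping.lookup w q) \<in> K"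
    by (auto simp: K_def supported_on_def A_mult B_mult)
qed

lemma eval_mult: 
  assumes "u \<in> K" "w \<in> K"
  shows "eval_t (u \<otimes>\<^bsub>free_alg A B\<^esub> w) = eval_t u * eval_t w"
proof -
  have mem: "p \<in> carrier A \<times> carrier B" if "p \<in> Poly_Mapping.keys u \<or> p \<in> Poly_Mapping.keys w" for p
    using assms that by (auto simp: K_def supported_on_def)
  have "eval_t (u \<otimes>\<^bsub>free_alg A B\<^esub> w) = (\<Sum>p\<in>Poly_Mapping.keys u. \<Sum>q\<in>Poly_Mapping.keys w.
      smul (Poly_Mapping.lookup u p * Poly_Mapping.lookup w q) (t (fst p \<otimes>\<^bsub>A\<^esub> fst q) (snd p \<otimes>\<^bsub>B\<^esub> snd q)))"
    unfolding mult_free eval_sum by (simp add: eval_t_def)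
  also have "\<dots> = (\<Sum>p\<in>Poly_Mapping.keys u. \<Sum>q\<in>Poly_Mapping.keys w.
      smul (Poly_Mapping.lookup u p) (t (fst p) (snd p)) * smul (Poly_Mapping.lookup w q) (t (fst q) (snd q)))"
  proof (intro sum.cong refl)
    fix p q assume "p \<in> Poly_Mapping.keys u" "q \<in> Poly_Mapping.keys w"
    then have "p \<in> carrier A \<times> carrier B" "q \<in> carrier A \<times> carrier B"
      using mem by blast+
    then have "t (fst p \<otimes>\<^bsub>A\<^esub> fst q) (snd p \<otimes>\<^bsub>B\<^esub> snd q) = t (fst p) (snd p) * t (fst q) (snd q)"
      by (intro t_mult) auto
    then show "smul (Poly_Mapping.lookup u p * Poly_Mapping.lookup w q) (t (fst p \<otimes>\<^bsub>A\<^esub> fst q) (snd p \<otimes>\<^bsub>B\<^esub> snd q)) =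
        smul (Poly_Mapping.lookup u p) (t (fst p) (snd p)) * smul (Poly_Mapping.lookup w q) (t (fst q) (snd q))"
      by simp
  qed
  also have "\<dots> = eval_t u * eval_t w"
    by (simp only: eval_t_def lin_ext_def case_prod_unfold sum_product)
  finally show ?thesis .
qed

text \<open>The fibre of the evaluation map over \<open>z\<close>. Once the kernel is known to be
  \<open>N\<close>, the fibres over \<open>Fin\<close> are the cosets that form the tensor product,
  and \<open>coset_of\<close> inverts the induced homomorphism.\<close>

definition coset_of :: "'f rmat \<Rightarrow> (('a \<times> 'b) \<Rightarrow>\<^sub>0 'f) set" where
  "coset_of z = {w \<in> K. eval_t w = z}"

end

locale tensor_decomposition = tensor_factors +
  assumes surjective: "z \<in> Fin \<Longrightarrow> \<exists>w\<in>K. eval_t w = z"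
    and kernel: "w \<in> K \<Longrightarrow> eval_t w = 0 \<Longrightarrow> w \<in> N"
begin

lemma coset_of_eval:
  assumes "w \<in> K"
  shows "N +>\<^bsub>free_alg A B\<^esub> w = coset_of (eval_t w)"
proof -
  have "N +>\<^bsub>free_alg A B\<^esub> w = {n + w | n. n \<in> N}"
    by (auto simp: a_r_coset_def' free_alg_def)
  also have "\<dots> = coset_of (eval_t w)"
  proof (intro equalityI subsetI)
    fix x assume "x \<in> {n + w | n. n \<in> N}"
    then show "x \<in> coset_of (eval_t w)"
      using assms N_K free.W_closed(1) eval_N by (auto simp: coset_of_def eval_add)
  next
    fix x assume x: "x \<in> coset_of (eval_t w)"
    then have "x - w \<in> N"
      using assms free.W_closed(4) by (intro kernel) (auto simp: coset_of_def eval_diff)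
    then have "x = (x - w) + w \<and> x - w \<in> N"
      by simp
    then show "x \<in> {n + w | n. n \<in> N}"
      by blast
  qed
  finally show ?thesis .
qed

lemma tensor_elem_coset:
  "x \<in> carrier A \<Longrightarrow> y \<in> carrier B \<Longrightarrow> tensor_elem A B x y = coset_of (t x y)"
  using coset_of_eval[OF pure_K] by (simp add: tensor_elem_def N_def eval_pure)

sublocale tensor: rmat_iso Fin "tensor_alg A B" coset_of
proof
  show "rmat.subspace Fin"
    by (rule subspace_Fin)
  show "coset_of ` Fin = carrier (tensor_alg A B)"
  proof -
    have "carrier (tensor_alg A B) = (\<lambda>w. N +>\<^bsub>free_alg A B\<^esub> w) ` K"
      by (auto simp: tensor_alg_def Let_def A_RCOSETS_def' N_def free_alg_def K_def supported_on_def)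
    also have "\<dots> = coset_of ` eval_t ` K"
      using coset_of_eval by (simp add: image_image)
    also have "eval_t ` K = Fin"
      using surjective eval_Fin by blast
    finally show ?thesis ..
  qed
  show "coset_of (x + y) = coset_of x \<oplus>\<^bsub>tensor_alg A B\<^esub> coset_of y" if xy: "x \<in> Fin" "y \<in> Fin" for x y
  proof -
    obtain w where w: "w \<in> K" "eval_t w = x"
      using surjective[OF xy(1)] by blast
    have "coset_of x \<oplus>\<^bsub>tensor_alg A B\<^esub> coset_of y = {a + b | a b. a \<in> coset_of x \<and> b \<in> coset_of y}"
      by (auto simp: tensor_alg_def Let_def set_add_def' free_alg_def)
    also have "\<dots> = coset_of (x + y)"
    proof (intro equalityI subsetI)
      fix c assume "c \<in> {a + b | a b. a \<in> coset_of x \<and> b \<in> coset_of y}"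
      then show "c \<in> coset_of (x + y)"
        using free.W_closed(1) by (auto simp: coset_of_def eval_add)
    next
      fix c assume c: "c \<in> coset_of (x + y)"
      then have "c = w + (c - w) \<and> w \<in> coset_of x \<and> c - w \<in> coset_of y"
        using w free.W_closed(4) by (auto simp: coset_of_def eval_diff)
      then show "c \<in> {a + b | a b. a \<in> coset_of x \<and> b \<in> coset_of y}"
        by blast
    qed
    finally show ?thesis ..
  qed
  show "coset_of (smul c x) = c \<odot>\<^bsub>tensor_alg A B\<^esub> coset_of x" if x: "x \<in> Fin" for c x
  proof -
    obtain w where w: "w \<in> K" "eval_t w = x"
      using surjective[OF x] by blast
    have "c \<odot>\<^bsub>tensor_alg A B\<^esub> coset_of x = (\<Union>u\<in>coset_of x. N +>\<^bsub>free_alg A B\<^esub> pscale c u)"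
      by (simp add: tensor_alg_def Let_def N_def free_alg_def)
    \<comment> \<open>Scalar multiplication in the quotient is a union over all representatives.
      They all give the same coset, and surjectivity of the evaluation makes the union
      nonempty.\<close>
    also have "\<dots> = (\<Union>u\<in>coset_of x. coset_of (smul c x))"
      by (intro SUP_cong refl) (auto simp: coset_of_def[of x] coset_of_eval eval_pscale free.W_closed(2))
    also have "\<dots> = coset_of (smul c x)"
      using w by (auto simp: coset_of_def[of x])
    finally show ?thesis ..
  qed
  show "coset_of (x * y) = coset_of x \<otimes>\<^bsub>tensor_alg A B\<^esub> coset_of y" if xy: "x \<in> Fin" "y \<in> Fin" for x y
  proof -
    obtain w w' where w: "w \<in> K" "eval_t w = x" "w' \<in> K" "eval_t w' = y"
      using surjective xy by meson
    have "coset_of x \<otimes>\<^bsub>tensor_alg A B\<^esub> coset_of y =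
        (\<Union>a\<in>coset_of x. \<Union>b\<in>coset_of y. N +>\<^bsub>free_alg A B\<^esub> (a \<otimes>\<^bsub>free_alg A B\<^esub> b))"
      by (simp add: tensor_alg_def Let_def N_def rcoset_mult_def)
    also have "\<dots> = (\<Union>a\<in>coset_of x. \<Union>b\<in>coset_of y. coset_of (x * y))"
      by (intro SUP_cong refl) (auto simp: coset_of_def[of x] coset_of_def[of y] coset_of_eval mult_free_K eval_mult)
    also have "\<dots> = coset_of (x * y)"
      using w by (auto simp: coset_of_def[of x] coset_of_def[of y])
    finally show ?thesis ..
  qed
  show "coset_of 0 = \<zero>\<^bsub>tensor_alg A B\<^esub>"
  proof -
    have "coset_of 0 = N"
      using kernel N_K eval_N by (auto simp: coset_of_def)
    then show ?thesis
      by (simp add: tensor_alg_def Let_def N_def)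
  qed
  show "inj_on coset_of Fin"
  proof (rule inj_onI)
    fix x y assume "x \<in> Fin" "y \<in> Fin" "coset_of x = coset_of y"
    then obtain w where "w \<in> K" "eval_t w = x" "w \<in> coset_of y"
      using surjective[of x] by (auto simp: coset_of_def)
    then show "x = y"
      by (simp add: coset_of_def)
  qed
qed auto

end

section \<open>The corner as a full matrix algebra\<close>

locale corner_units =
  fixes e :: "'f::field rmat" and n :: nat and a b :: "nat \<Rightarrow> 'f rmat"
  assumes e_sum: "e = (\<Sum>k<n. b k * a k)"
    and a_row: "E 0 0 * a k = a k" and b_column: "b k * E 0 0 = b k"
    and a_Fin: "a k \<in> Fin" and b_Fin: "b k \<in> Fin"
    and ab: "k < n \<Longrightarrow> l < n \<Longrightarrow> a k * b l = (if k = l then E 0 0 else 0)"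
begin

definition Cor where
  "Cor = {x \<in> Fin. e * x = x \<and> x * e = x}"

text \<open>As \<open>a k * x * b l\<close> is a multiple of \<open>E 0 0\<close>, its entry at
  \<open>(0, 0)\<close> determines it; this is the matrix coefficient of \<open>x\<close> with
  respect to the factorization of \<open>e\<close>.\<close>

definition to_mat where
  "to_mat x = mat n n (\<lambda>(k, l). entry (a k * x * b l) 0 0)"

definition of_mat where
  "of_mat m = (\<Sum>k<n. \<Sum>l<n. smul (m $$ (k, l)) (b k * a l))"

lemma ae: "k < n \<Longrightarrow> a k * e = a k"
proof -
  assume k: "k < n"
  have "a k * e = (\<Sum>l<n. a k * b l * a l)"
    by (simp add: e_sum sum_distrib_left mult.assoc)
  also have "\<dots> = (\<Sum>l<n. if l = k then a k else 0)"
    by (intro sum.cong) (auto simp: ab k a_row)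
  finally show ?thesis
    using k by simp
qed

lemma eb: "k < n \<Longrightarrow> e * b k = b k"
proof -
  assume k: "k < n"
  have "e * b k = (\<Sum>l<n. b l * (a l * b k))"
    by (simp add: e_sum sum_distrib_right mult.assoc)
  also have "\<dots> = (\<Sum>l<n. if l = k then b k else 0)"
    by (intro sum.cong) (auto simp: ab k b_column)
  finally show ?thesis
    using k by simp
qed

lemma scalar_entry: "a k * x * b l = smul (entry (a k * x * b l) 0 0) (E 0 0)"
proof -
  have "a k * x * b l = E 0 0 * (a k * x * b l) * E 0 0"
    using a_row[of k] b_column[of l] by (metis mult.assoc)
  then show ?thesis
    by (metis E_sandwich)
qed

lemma of_mat_Cor: "of_mat m \<in> Cor"
proof -
  have "of_mat m \<in> Fin"
    unfolding of_mat_def by (intro Fin_sum Fin_smul Fin_mult a_Fin b_Fin)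
  moreover have "e * of_mat m = of_mat m"
    unfolding of_mat_def sum_distrib_left
    by (intro sum.cong refl) (simp add: eb flip: mult.assoc)
  moreover have "of_mat m * e = of_mat m"
    unfolding of_mat_def sum_distrib_right
    by (intro sum.cong refl) (simp add: ae mult.assoc)
  ultimately show ?thesis
    by (simp add: Cor_def)
qed

lemma to_mat_carrier [simp]: "to_mat x \<in> carrier_mat n n"
  by (simp add: to_mat_def)

lemma of_mat_to_mat: "x \<in> Cor \<Longrightarrow> of_mat (to_mat x) = x"
proof -
  assume x: "x \<in> Cor"
  have "of_mat (to_mat x) = (\<Sum>k<n. \<Sum>l<n. b k * (a k * x * b l) * a l)"
    unfolding of_mat_def
  proof (intro sum.cong refl)
    fix k l assume "k \<in> {..<n}" "l \<in> {..<n}"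
    then have "smul (to_mat x $$ (k, l)) (b k * a l) = smul (entry (a k * x * b l) 0 0) (b k * E 0 0 * a l)"
      by (simp add: to_mat_def b_column)
    also have "\<dots> = b k * smul (entry (a k * x * b l) 0 0) (E 0 0) * a l"
      by simp
    finally show "smul (to_mat x $$ (k, l)) (b k * a l) = b k * (a k * x * b l) * a l"
      using scalar_entry[of k x l] by simp
  qed
  also have "\<dots> = e * x * e"
    by (simp add: e_sum sum_distrib_left sum_distrib_right mult.assoc) (rule sum.swap)
  finally show ?thesis
    using x by (simp add: Cor_def)
qed

lemma to_mat_of_mat: "m \<in> carrier_mat n n \<Longrightarrow> to_mat (of_mat m) = m"
proof (rule eq_matI)
  fix k l assume m: "m \<in> carrier_mat n n" and "k < dim_row m" "l < dim_col m"
  then have kl: "k < n" "l < n"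
    by auto
  have "a k * of_mat m * b l = (\<Sum>i<n. \<Sum>j<n. smul (m $$ (i, j)) ((a k * b i) * (a j * b l)))"
    by (simp add: of_mat_def sum_distrib_left sum_distrib_right mult.assoc)
  also have "\<dots> = (\<Sum>i<n. \<Sum>j<n. if i = k then if j = l then smul (m $$ (k, l)) (E 0 0) else 0 else 0)"
    by (intro sum.cong refl) (auto simp: ab kl E_mult_E)
  also have "\<dots> = (\<Sum>i<n. if i = k then smul (m $$ (k, l)) (E 0 0) else 0)"
    using kl by (intro sum.cong refl) auto
  also have "\<dots> = smul (m $$ (k, l)) (E 0 0)"
    using kl by simp
  finally show "to_mat (of_mat m) $$ (k, l) = m $$ (k, l)"
    using kl by (simp add: to_mat_def entry_simps entry_E)
qed (auto simp: to_mat_def)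

lemma to_mat_add: "to_mat (x + y) = to_mat x + to_mat y"
  by (rule eq_matI) (auto simp: to_mat_def distrib_left distrib_right entry_simps)

lemma to_mat_smul: "to_mat (smul c x) = c \<cdot>\<^sub>m to_mat x"
  by (rule eq_matI) (auto simp: to_mat_def entry_simps)

lemma to_mat_0: "to_mat 0 = 0\<^sub>m n n"
  by (rule eq_matI) (auto simp: to_mat_def entry_simps)

text \<open>Inserting \<open>e = (\<Sum>i<n. b i * a i)\<close> between \<open>x\<close> and
  \<open>y\<close> produces the sum of the matrix product.\<close>

lemma to_mat_mult:
  assumes "x \<in> Cor"
  shows "to_mat (x * y) = to_mat x * to_mat y"
proof (rule eq_matI)
  fix k l assume "k < dim_row (to_mat x * to_mat y)" "l < dim_col (to_mat x * to_mat y)"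
  then have kl: "k < n" "l < n"
    by (auto simp: to_mat_def)
  have "a k * (x * y) * b l = a k * (x * e) * y * b l"
    using assms by (simp add: Cor_def mult.assoc)
  also have "\<dots> = (\<Sum>i<n. (a k * x * b i) * (a i * y * b l))"
    by (simp add: e_sum sum_distrib_left sum_distrib_right mult.assoc)
  also have "\<dots> = (\<Sum>i<n. smul (entry (a k * x * b i) 0 0 * entry (a i * y * b l) 0 0) (E 0 0))"
  proof (intro sum.cong refl)
    fix i
    have "(a k * x * b i) * (a i * y * b l) =
        smul (entry (a k * x * b i) 0 0) (E 0 0) * smul (entry (a i * y * b l) 0 0) (E 0 0)"
      using scalar_entry by metis
    then show "(a k * x * b i) * (a i * y * b l) =
        smul (entry (a k * x * b i) 0 0 * entry (a i * y * b l) 0 0) (E 0 0)"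
      by (simp add: E_mult_E mult.commute)
  qed
  finally have "entry (a k * (x * y) * b l) 0 0 =
      (\<Sum>i<n. entry (a k * x * b i) 0 0 * entry (a i * y * b l) 0 0)"
    by (simp add: entry_simps entry_E)
  then show "to_mat (x * y) $$ (k, l) = (to_mat x * to_mat y) $$ (k, l)"
    using kl by (simp add: to_mat_def scalar_prod_def atLeast0LessThan)
qed (auto simp: to_mat_def)

lemma subspace_Cor: "rmat.subspace Cor"
  by (rule rmat.subspaceI) (auto simp: Cor_def distrib_left distrib_right)

lemma Cor_mult: "x \<in> Cor \<Longrightarrow> y \<in> Cor \<Longrightarrow> x * y \<in> Cor"
  unfolding Cor_def mem_Collect_eq by (metis Fin_mult mult.assoc)

sublocale corner: rmat_iso Cor "full_mat TYPE('f) n" to_mat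
proof
  show "to_mat ` Cor = carrier (full_mat TYPE('f) n)"
  proof (intro equalityI subsetI)
    fix m assume "m \<in> carrier (full_mat TYPE('f) n)"
    then have "m = to_mat (of_mat m)"
      by (simp add: module_mat_simps to_mat_of_mat)
    then show "m \<in> to_mat ` Cor"
      using of_mat_Cor by blast
  qed (auto simp: module_mat_simps)
  show "inj_on to_mat Cor"
    by (metis inj_onI of_mat_to_mat)
qed (simp_all add: subspace_Cor Cor_mult to_mat_mult module_mat_def to_mat_add to_mat_smul to_mat_0)

lemma of_mat_mult:
  assumes "m \<in> carrier_mat n n" "m' \<in> carrier_mat n n"
  shows "of_mat (m * m') = of_mat m * of_mat m'"
  by (metis Cor_mult of_mat_Cor of_mat_to_mat to_mat_mult to_mat_of_mat assms)

lemma of_mat_add: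
  assumes "m \<in> carrier_mat n n" "m' \<in> carrier_mat n n"
  shows "of_mat (m + m') = of_mat m + of_mat m'"
proof -
  have "of_mat m + of_mat m' \<in> Cor"
    by (intro rmat.subspace_add[OF subspace_Cor] of_mat_Cor)
  then have "of_mat m + of_mat m' = of_mat (to_mat (of_mat m + of_mat m'))"
    by (rule of_mat_to_mat[symmetric])
  then show ?thesis
    by (simp only: to_mat_add to_mat_of_mat assms)
qed

lemma of_mat_smult:
  assumes "m \<in> carrier_mat n n"
  shows "of_mat (c \<cdot>\<^sub>m m) = smul c (of_mat m)"
proof -
  have "smul c (of_mat m) \<in> Cor"
    by (intro rmat.subspace_scale[OF subspace_Cor] of_mat_Cor)
  then have "smul c (of_mat m) = of_mat (to_mat (smul c (of_mat m)))"
    by (rule of_mat_to_mat[symmetric])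
  then show ?thesis
    by (simp only: to_mat_smul to_mat_of_mat assms)
qed

end

section \<open>The decomposition\<close>

locale framed = corner_units e n a b
  for e :: "'f::field rmat" and n a b +
  fixes u v :: "nat \<Rightarrow> 'f rmat"
  assumes u_Fin: "u i \<in> Fin" and v_Fin: "v i \<in> Fin"
    and eu: "e * u i = u i" and ve: "v i * e = v i"
    and uv: "u i * v j = (if i = j then e else 0)"
    and exhaust: "x \<in> Fin \<Longrightarrow> \<exists>N. \<forall>k\<ge>N. (\<Sum>i<k. v i * u i) * x = x \<and> x * (\<Sum>i<k. v i * u i) = x"
begin

definition theta where
  "theta x m = (\<Sum>(i, j)\<in>{(i, j). entry x i j \<noteq> 0}. smul (entry x i j) (v i * of_mat m * u j))"

lemma theta_corner:
  "x \<in> corner N \<Longrightarrow> theta x m = (\<Sum>i<N. \<Sum>j<N. smul (entry x i j) (v i * of_mat m * u j))"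
  unfolding theta_def sum.cartesian_product
  by (rule sum.mono_neutral_left) (auto simp: corner_def)

lemma theta_Fin: "x \<in> Fin \<Longrightarrow> theta x m \<in> Fin"
  unfolding theta_def using of_mat_Cor u_Fin v_Fin by (intro Fin_sum) (auto simp: Cor_def)

lemma theta_E: "theta (E i j) m = v i * of_mat m * u j"
proof -
  have "{(k, l). entry (E i j :: 'f rmat) k l \<noteq> 0} = {(i, j)}"
    by (auto simp: entry_E split: if_splits)
  then show ?thesis
    by (simp add: theta_def entry_E)
qed

lemma theta_add_left:
  assumes "x \<in> Fin" "y \<in> Fin"
  shows "theta (x + y) m = theta x m + theta y m"
proof -
  obtain N where N: "x \<in> corner N" "y \<in> corner N"
    using FinE2[OF assms] .
  then have "x + y \<in> corner N"
    by (rule rmat.subspace_add[OF subspace_corner])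
  then show ?thesis
    using N by (simp add: theta_corner plus_rmat.rep_eq rmat.scale_left_distrib sum.distrib)
qed

lemma theta_smul_left:
  assumes "x \<in> Fin"
  shows "theta (smul c x) m = smul c (theta x m)"
proof -
  obtain N where N: "x \<in> corner N"
    using FinE[OF assms] .
  then have "smul c x \<in> corner N"
    by (rule rmat.subspace_scale[OF subspace_corner])
  then show ?thesis
    using N by (simp add: theta_corner smul.rep_eq rmat.scale_sum_right)
qed

lemma theta_add_right:
  assumes "m \<in> carrier_mat n n" "m' \<in> carrier_mat n n"
  shows "theta x (m + m') = theta x m + theta x m'"
  unfolding theta_def sum.distrib[symmetric]
  by (intro sum.cong refl)
    (simp add: of_mat_add assms distrib_left distrib_right rmat.scale_right_distrib case_prod_unfold)

lemma theta_smult_right: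
  assumes "m \<in> carrier_mat n n"
  shows "theta x (c \<cdot>\<^sub>m m) = smul c (theta x m)"
  unfolding theta_def rmat.scale_sum_right
  by (intro sum.cong refl) (simp add: of_mat_smult assms case_prod_unfold mult.commute)

text \<open>Duality of \<open>u\<close> and \<open>v\<close> kills every term except the one at
  \<open>(i, j)\<close>. The elements \<open>u i * z * v j\<close> thus serve as coordinates of
  \<open>z\<close> with values in \<open>e R e\<close>.\<close>

lemma theta_coordinate:
  assumes "x \<in> Fin"
  shows "u i * theta x m * v j = smul (entry x i j) (of_mat m)"
proof -
  obtain N0 where N0: "x \<in> corner N0"
    using FinE[OF assms] .
  \<comment> \<open>The bound must exceed \<open>i\<close> and \<open>j\<close> as well, so that the
    term at \<open>(i, j)\<close> occurs in the sum even when its entry is zero.\<close>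
  define N where "N = max N0 (Suc (max i j))"
  have N: "x \<in> corner N" "i < N" "j < N"
    using corner_mono[of N0 N] N0 by (auto simp: N_def)
  have "u i * theta x m * v j =
      (\<Sum>k<N. \<Sum>l<N. smul (entry x k l) ((u i * v k) * of_mat m * (u l * v j)))"
    by (simp add: theta_corner[OF N(1)] sum_distrib_left sum_distrib_right mult.assoc)
  also have "\<dots> = (\<Sum>k<N. \<Sum>l<N. if k = i then if l = j then smul (entry x i j) (of_mat m) else 0 else 0)"
    using of_mat_Cor[of m] by (intro sum.cong refl) (auto simp: uv Cor_def)
  also have "\<dots> = (\<Sum>k<N. if k = i then smul (entry x i j) (of_mat m) else 0)"
    using N(3) by (intro sum.cong refl) auto
  also have "\<dots> = smul (entry x i j) (of_mat m)"
    using N(2) by simp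
  finally show ?thesis .
qed

lemma coordinate_expansion:
  assumes "z \<in> Fin"
  obtains N where "z = (\<Sum>i<N. \<Sum>j<N. v i * (u i * z * v j) * u j)"
proof -
  obtain N where N: "\<forall>k\<ge>N. (\<Sum>i<k. v i * u i) * z = z \<and> z * (\<Sum>i<k. v i * u i) = z"
    using exhaust[OF assms] ..
  then have "z = (\<Sum>i<N. v i * u i) * (z * (\<Sum>j<N. v j * u j))"
    by simp
  also have "\<dots> = (\<Sum>i<N. \<Sum>j<N. v i * (u i * z * v j) * u j)"
    by (simp only: sum_distrib_left sum_distrib_right mult.assoc) (rule sum.swap)
  finally show thesis
    by (rule that)
qed

lemma coordinate_Cor: "z \<in> Fin \<Longrightarrow> u i * z * v j \<in> Cor"
  using u_Fin v_Fin eu ve by (auto simp: Cor_def mult.assoc) (simp flip: mult.assoc)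

lemma coordinate_eqI:
  assumes "z \<in> Fin" "z' \<in> Fin" "\<And>i j. u i * z * v j = u i * z' * v j"
  shows "z = z'"
proof -
  have "z - z' \<in> Fin"
    using assms by auto
  then obtain N where "z - z' = (\<Sum>i<N. \<Sum>j<N. v i * (u i * (z - z') * v j) * u j)"
    by (rule coordinate_expansion)
  also have "\<dots> = 0"
    using assms(3) by (simp add: right_diff_distrib left_diff_distrib)
  finally show ?thesis
    by simp
qed

lemma theta_mult:
  assumes x: "x \<in> Fin" and y: "y \<in> Fin" and m: "m \<in> carrier_mat n n" "m' \<in> carrier_mat n n"
  shows "theta (x * y) (m * m') = theta x m * theta y m'"
proof (rule coordinate_eqI)
  show "theta (x * y) (m * m') \<in> Fin" "theta x m * theta y m' \<in> Fin"
    using x y by (auto intro: theta_Fin)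
  fix i j
  obtain N1 where N1: "x \<in> corner N1"
    using FinE[OF x] .
  obtain N2 where N2: "\<forall>k\<ge>N2. (\<Sum>i<k. v i * u i) * theta y m' = theta y m' \<and>
      theta y m' * (\<Sum>i<k. v i * u i) = theta y m'"
    using exhaust[OF theta_Fin[OF y]] ..
  \<comment> \<open>\<open>N1\<close> bounds the summation in \<open>x * y\<close>; from
    \<open>N2\<close> on the local unit may be inserted before \<open>theta y m'\<close>, which
    splits a coordinate of the product into products of coordinates.\<close>
  define N where "N = max N1 N2"
  have N: "x \<in> corner N" "(\<Sum>i<N. v i * u i) * theta y m' = theta y m'"
    using N1 N2 corner_mono[of N1 N] by (auto simp: N_def)
  have "u i * (theta x m * theta y m') * v j = u i * theta x m * ((\<Sum>k<N. v k * u k) * theta y m') * v j"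
    unfolding N(2) by (simp only: mult.assoc)
  also have "\<dots> = (\<Sum>k<N. (u i * theta x m * v k) * (u k * theta y m' * v j))"
    by (simp only: sum_distrib_left sum_distrib_right mult.assoc)
  also have "\<dots> = (\<Sum>k<N. smul (entry x i k * entry y k j) (of_mat m * of_mat m'))"
    unfolding theta_coordinate[OF x] theta_coordinate[OF y] by (simp add: mult.commute)
  also have "\<dots> = smul (entry (x * y) i j) (of_mat m * of_mat m')"
    by (simp add: entry_mult_corner[OF N(1)] rmat.scale_sum_left)
  also have "\<dots> = u i * theta (x * y) (m * m') * v j"
    by (simp add: theta_coordinate x y of_mat_mult[OF m])
  finally show "u i * theta (x * y) (m * m') * v j = u i * (theta x m * theta y m') * v j" ..
qed

section \<open>Surjectivity and kernel of the evaluation map\<close>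

definition tensor_map where
  "tensor_map X m = theta (Rmat X) m"

lemma tensor_map_entry: "tensor_map (entry x) m = theta x m"
  by (simp add: tensor_map_def entry_inverse)

lemma finitary_carrierE:
  fixes X :: "nat \<Rightarrow> nat \<Rightarrow> 'f"
  assumes "X \<in> carrier (finitary_mat TYPE('f))"
  obtains x where "x \<in> Fin" "X = entry x"
  using finitary.carrierE[OF assms] .

lemma full_carrier: "m \<in> carrier (full_mat TYPE('f) n) \<longleftrightarrow> m \<in> carrier_mat n n"
  by (simp add: module_mat_simps)

sublocale tensor_factors "finitary_mat TYPE('f)" "full_mat TYPE('f) n" tensor_map
proof (rule tensor_factors.intro, unfold full_carrier)
  show "Module.module class_ring (finitary_mat TYPE('f))"
    by (rule finitary.module)
  show "Module.module class_ring (full_mat TYPE('f) n)"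
    by (rule corner.module)
qed (auto elim!: finitary_carrierE simp: tensor_map_entry module_mat_def theta_Fin theta_add_left
    theta_add_right theta_smul_left theta_smult_right theta_mult finitary.closed
    simp flip: finitary.h_add finitary.h_scale finitary.h_mult)

notation cong (infix "\<approx>" 50)

text \<open>\<open>psi L\<close> is the inverse of the evaluation map modulo \<open>N\<close>, for elements with coordinates below \<open>L\<close>.\<close>

definition psi where
  "psi L z = (\<Sum>i<L. \<Sum>j<L. pure (entry (E i j)) (to_mat (u i * z * v j)))"

lemma pure_E_K: "pure (entry (E i j)) (to_mat x) \<in> K"
  by (intro pure_K finitary.closed) (simp_all add: full_carrier)

lemma psi_K: "psi L z \<in> K"
  unfolding psi_def by (intro pm.subspace_sum[OF free.W] pure_E_K)

lemma eval_psi: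
  assumes "z \<in> Fin"
  obtains L where "eval_t (psi L z) = z"
proof -
  obtain L where "z = (\<Sum>i<L. \<Sum>j<L. v i * (u i * z * v j) * u j)"
    using coordinate_expansion[OF assms] .
  moreover have "eval_t (psi L z) = (\<Sum>i<L. \<Sum>j<L. v i * (u i * z * v j) * u j)"
    by (simp add: psi_def eval_sum eval_pure tensor_map_entry theta_E of_mat_to_mat coordinate_Cor assms)
  ultimately show thesis
    using that by metis
qed

lemma psi_add: "psi L (y + z) \<approx> psi L y + psi L z"
  unfolding psi_def sum.distrib[symmetric] distrib_left distrib_right to_mat_add
  using pure_add_right[of _ "to_mat _" "to_mat _"]
  by (intro cong_sum) (simp add: full_carrier module_mat_def finitary.closed)

lemma psi_smul: "psi L (smul c z) \<approx> pscale c (psi L z)"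
  unfolding psi_def pm.scale_sum_right mult_smul smul_mult to_mat_smul
  using pure_smult_right[of _ "to_mat _" c]
  by (intro cong_sum) (simp add: full_carrier module_mat_def finitary.closed del: map_single)

lemma pure_0_left:
  assumes "m \<in> carrier_mat n n"
  shows "pure (entry 0) m \<approx> 0"
  using pure_smult_left[of "entry 0" m 0] assms
  by (simp add: full_carrier finitary.closed flip: finitary.h_scale)

lemma pure_0_right:
  assumes "x \<in> Fin"
  shows "pure (entry x) (0\<^sub>m n n) \<approx> 0"
proof -
  have "0 \<cdot>\<^sub>m 0\<^sub>m n n = (0\<^sub>m n n :: 'f mat)"
    by auto
  then show ?thesis
    using pure_smult_right[of "entry x" "0\<^sub>m n n" 0] assms
    by (simp add: full_carrier finitary.closed module_mat_def)
qed

lemma pure_sum_left: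
  assumes "\<And>i. i \<in> I \<Longrightarrow> f i \<in> Fin" and m: "m \<in> carrier_mat n n"
  shows "pure (entry (sum f I)) m \<approx> (\<Sum>i\<in>I. pure (entry (f i)) m)"
  using assms(1)
proof (induction I rule: infinite_finite_induct)
  case (insert i I)
  then have "pure (entry (f i + sum f I)) m \<approx> pure (entry (f i)) m + pure (entry (sum f I)) m"
    using pure_add_left[of "entry (f i)" "entry (sum f I)" m] m
    by (simp add: full_carrier finitary.closed Fin_sum finitary.h_add)
  also have "\<dots> \<approx> pure (entry (f i)) m + (\<Sum>i\<in>I. pure (entry (f i)) m)"
    using insert by (intro cong_add cong_refl) auto
  finally show ?case
    using insert by simp
qed (simp_all add: pure_0_left m)

text \<open>Normal form of a pure tensor: the left factor is expanded in matrix units and its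
  coefficients move to the right factor, where they appear as the coordinates of
  \<open>theta x m\<close>.\<close>

lemma pure_psi:
  assumes x: "x \<in> corner L" and m: "m \<in> carrier_mat n n"
  shows "pure (entry x) m \<approx> psi L (theta x m)"
proof -
  have "pure (entry (\<Sum>i<L. \<Sum>j<L. smul (entry x i j) (E i j))) m \<approx>
      (\<Sum>i<L. pure (entry (\<Sum>j<L. smul (entry x i j) (E i j))) m)"
    by (intro pure_sum_left Fin_sum m) simp
  also have "\<dots> \<approx> (\<Sum>i<L. \<Sum>j<L. pure (entry (smul (entry x i j) (E i j))) m)"
    by (intro cong_sum pure_sum_left m) simp
  also have "\<dots> \<approx> (\<Sum>i<L. \<Sum>j<L. pscale (entry x i j) (pure (entry (E i j)) m))"
    using pure_smult_left[of "entry (E i j)" m c for i j c] m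
    by (intro cong_sum) (simp add: full_carrier finitary.closed finitary.h_scale del: map_single)
  also have "\<dots> \<approx> (\<Sum>i<L. \<Sum>j<L. pure (entry (E i j)) (entry x i j \<cdot>\<^sub>m m))"
    using pure_smult_right[THEN cong_sym, of "entry (E i j)" m c for i j c] m
    by (intro cong_sum) (simp add: full_carrier finitary.closed module_mat_def del: map_single)
  also have "\<dots> = psi L (theta x m)"
    unfolding psi_def theta_coordinate[OF corner_Fin[OF x]] to_mat_smul to_mat_of_mat[OF m] ..
  finally show ?thesis
    by (simp flip: corner_expand[OF x])
qed

sublocale tensor_decomposition "finitary_mat TYPE('f)" "full_mat TYPE('f) n" tensor_map
proof
  show "\<exists>w\<in>K. eval_t w = z" if "z \<in> Fin" for z
    using eval_psi[OF that] psi_K by metis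
  show "w \<in> N" if w: "w \<in> K" "eval_t w = 0" for w
  proof -
    have keys: "p \<in> carrier (finitary_mat TYPE('f)) \<times> carrier_mat n n" if "p \<in> Poly_Mapping.keys w" for p
      using w(1) that by (auto simp: K_def supported_on_def full_carrier)
    have "\<exists>M. \<forall>p\<in>Poly_Mapping.keys w. Rmat (fst p) \<in> corner M"
    proof -
      have "\<forall>p\<in>Poly_Mapping.keys w. \<exists>M. Rmat (fst p) \<in> corner M"
      proof
        fix p assume "p \<in> Poly_Mapping.keys w"
        then have "fst p \<in> carrier (finitary_mat TYPE('f))"
          using keys by (metis mem_Times_iff)
        then obtain x where "x \<in> Fin" "fst p = entry x"
          by (rule finitary_carrierE)
        then show "\<exists>M. Rmat (fst p) \<in> corner M"
          by (metis FinE entry_inverse)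
      qed
      then obtain M where M: "\<And>p. p \<in> Poly_Mapping.keys w \<Longrightarrow> Rmat (fst p) \<in> corner (M p)"
        by metis
      have "Rmat (fst p) \<in> corner (Max (M ` Poly_Mapping.keys w))" if "p \<in> Poly_Mapping.keys w" for p
        using corner_mono[of "M p"] M[OF that] that by (metis Max_ge finite_imageI finite_keys imageI subsetD)
      then show ?thesis
        by blast
    qed
    then obtain M where M: "\<And>p. p \<in> Poly_Mapping.keys w \<Longrightarrow> Rmat (fst p) \<in> corner M"
      by blast
    \<comment> \<open>For one fixed \<open>M\<close>, the map \<open>psi M\<close> is linear modulo
      \<open>N\<close>, so \<open>?Q\<close> is a subspace. As \<open>M\<close> bounds the left
      factors of all pure tensors in \<open>w\<close>, these lie in \<open>?Q\<close>, hence so does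
      \<open>w\<close>, and \<open>eval_t w = 0\<close> makes it congruent to zero.\<close>
    let ?Q = "{w. w \<approx> psi M (eval_t w)}"
    have psi_0: "psi M 0 \<approx> 0"
    proof -
      have "psi M 0 \<approx> (\<Sum>i<M. \<Sum>j<M. 0)"
        unfolding psi_def by (intro cong_sum) (simp add: to_mat_0 pure_0_right)
      then show ?thesis
        by simp
    qed
    have "pm.subspace ?Q"
    proof (rule pm.subspaceI)
      show "0 \<in> ?Q"
        using cong_sym[OF psi_0] by (simp add: eval_0)
      fix x y assume "x \<in> ?Q" "y \<in> ?Q"
      then have "x + y \<approx> psi M (eval_t x) + psi M (eval_t y)"
        by (simp add: cong_add)
      then show "x + y \<in> ?Q"
        using cong_trans[OF _ cong_sym[OF psi_add]] by (simp add: eval_add)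
    next
      fix c x assume "x \<in> ?Q"
      then have "pscale c x \<approx> pscale c (psi M (eval_t x))"
        by (simp add: cong_pscale)
      then show "pscale c x \<in> ?Q"
        using cong_trans[OF _ cong_sym[OF psi_smul]] by (simp add: eval_pscale)
    qed
    note Q = this
    have "Poly_Mapping.single p 1 \<in> ?Q" if p: "p \<in> Poly_Mapping.keys w" for p
    proof -
      obtain X m where pXm: "p = (X, m)"
        by fastforce
      then have m: "m \<in> carrier_mat n n" and "X \<in> carrier (finitary_mat TYPE('f))"
        using keys[OF p] by auto
      then obtain x where x: "X = entry x"
        by (metis finitary_carrierE)
      have "x \<in> corner M"
        using M[OF p] by (simp add: pXm x entry_inverse)
      then show ?thesis
        using pure_psi[OF _ m] by (simp add: pXm x eval_pure tensor_map_entry)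
    qed
    then have "(\<Sum>p\<in>Poly_Mapping.keys w. pscale (Poly_Mapping.lookup w p) (Poly_Mapping.single p 1)) \<in> ?Q"
      by (intro pm.subspace_sum[OF Q] pm.subspace_scale[OF Q])
    then have "w \<in> ?Q"
      unfolding single_expand[symmetric] .
    then have "w \<approx> psi M (eval_t w)"
      by simp
    then have "w \<approx> 0"
      using psi_0[folded w(2)] by (rule cong_trans)
    then show ?thesis
      by (simp add: cong_def)
  qed
qed

end

context framed
begin

lemma coset_of_Rmat_alg_iso:
  "(\<lambda>X. coset_of (Rmat X)) \<in> alg_iso (finitary_mat TYPE('f))
    (tensor_alg (finitary_mat TYPE('f)) (full_mat TYPE('f) n))"
  unfolding alg_iso_def LinearCombinations.module_hom_def
proof (intro CollectI conjI ballI allI impI funcsetI)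
  let ?A = "finitary_mat TYPE('f)" and ?T = "tensor_alg (finitary_mat TYPE('f)) (full_mat TYPE('f) n)"
  show "coset_of (Rmat X) \<in> carrier ?T" if "X \<in> carrier ?A" for X
    using that tensor.closed by (auto elim!: finitary_carrierE simp: entry_inverse)
  show "coset_of (Rmat (X \<oplus>\<^bsub>?A\<^esub> Y)) = coset_of (Rmat X) \<oplus>\<^bsub>?T\<^esub> coset_of (Rmat Y)"
    if "X \<in> carrier ?A \<and> Y \<in> carrier ?A" for X Y
    using that by (auto elim!: finitary_carrierE simp: entry_inverse tensor.h_add simp flip: finitary.h_add)
  show "coset_of (Rmat (c \<odot>\<^bsub>?A\<^esub> X)) = c \<odot>\<^bsub>?T\<^esub> coset_of (Rmat X)"
    if "c \<in> carrier class_ring \<and> X \<in> carrier ?A" for c X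
    using that by (auto elim!: finitary_carrierE simp: entry_inverse tensor.h_scale simp flip: finitary.h_scale)
  show "coset_of (Rmat (X \<otimes>\<^bsub>?A\<^esub> Y)) = coset_of (Rmat X) \<otimes>\<^bsub>?T\<^esub> coset_of (Rmat Y)"
    if "X \<in> carrier ?A" "Y \<in> carrier ?A" for X Y
    using that by (auto elim!: finitary_carrierE simp: entry_inverse tensor.h_mult simp flip: finitary.h_mult)
  show "bij_betw (\<lambda>X. coset_of (Rmat X)) (carrier ?A) (carrier ?T)"
  proof (rule bij_betw_imageI)
    show "inj_on (\<lambda>X. coset_of (Rmat X)) (carrier ?A)"
    proof (rule inj_onI)
      fix X Y assume *: "X \<in> carrier ?A" "Y \<in> carrier ?A" "coset_of (Rmat X) = coset_of (Rmat Y)"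
      then obtain x y where xy: "x \<in> Fin" "X = entry x" "y \<in> Fin" "Y = entry y"
        by (metis finitary_carrierE)
      then have "x = y"
        using * tensor.h_inj by (simp add: entry_inverse inj_on_eq_iff)
      then show "X = Y"
        using xy by simp
    qed
    show "(\<lambda>X. coset_of (Rmat X)) ` carrier ?A = carrier ?T"
      unfolding finitary.image[symmetric] tensor.image[symmetric] image_image entry_inverse ..
  qed
qed

end

section \<open>Compatibility of the isomorphism with the gradings\<close>

locale graded_framed = graded_fin_idempotent G S e + framed e n a b u v
  for G :: "('g, 'm) monoid_scheme" (structure) and S :: "'g \<Rightarrow> 'f::alg_closed_field rmat set"
  and e n a b u v +
  fixes s :: "nat \<Rightarrow> 'g"
  assumes s_carrier: "s i \<in> carrier G" and u_S: "u i \<in> S (s i)" and v_S: "v i \<in> S (inv (s i))"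
    and s_coset: "inv (s i) \<otimes> s j \<in> H \<Longrightarrow> s i = s j"
begin

lemma D_Cor: "g \<in> carrier G \<Longrightarrow> D g \<subseteq> Cor"
  by (auto simp: D_def Cor_def S_Fin)

lemma internal_grading_D: "internal_grading G Cor D"
  unfolding internal_grading_def
proof (intro conjI ballI allI impI)
  show "\<exists>c. (\<forall>g\<in>carrier G. c g \<in> D g) \<and> x = (\<Sum>g\<in>carrier G. c g)" if x: "x \<in> Cor" for x
  proof -
    have x': "x \<in> Fin" "e * x = x" "x * e = x"
      using x by (auto simp: Cor_def)
    obtain c where c: "\<And>g. g \<in> carrier G \<Longrightarrow> c g \<in> S g" "x = (\<Sum>g\<in>carrier G. c g)"
      using S_decompose[OF x'(1)] by blast
    \<comment> \<open>Cutting with \<open>e\<close> on both sides keeps \<open>x\<close> and moves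
      its components into the spaces \<open>D g\<close>.\<close>
    have "x = e * x * e"
      using x' by simp
    also have "\<dots> = (\<Sum>g\<in>carrier G. e * c g * e)"
      unfolding c(2) sum_distrib_left sum_distrib_right ..
    finally show ?thesis
      using c(1) e_sandwich_D by (intro exI[of _ "\<lambda>g. e * c g * e"]) blast
  qed
  show "c g = 0" if "\<forall>g\<in>carrier G. c g \<in> D g" "(\<Sum>g\<in>carrier G. c g) = 0" "g \<in> carrier G" for c g
    using S_sum_eq_0[of c g] that by (auto simp: D_def)
qed (use D_subspace D_Cor D_mult in auto)

lemma to_mat_D_eq_0_iff: "g \<in> carrier G \<Longrightarrow> to_mat ` D g = {\<zero>\<^bsub>full_mat TYPE('f) n\<^esub>} \<longleftrightarrow> D g = {0}"
proof
  assume g: "g \<in> carrier G" and "to_mat ` D g = {\<zero>\<^bsub>full_mat TYPE('f) n\<^esub>}"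
  then have "to_mat ` D g = to_mat ` {0}"
    by (simp add: corner.h_zero)
  then show "D g = {0}"
    using inj_on_image_eq_iff[OF corner.h_inj D_Cor[OF g], of "{0}"] rmat.subspace_0[OF subspace_Cor] by simp
qed (simp add: corner.h_zero)

lemma supp_to_mat_D: "supp G (full_mat TYPE('f) n) (\<lambda>g. to_mat ` D g) = H"
  unfolding supp_def H_def using to_mat_D_eq_0_iff by blast

lemma fine_grading_to_mat_D: "fine_grading G n (\<lambda>g. to_mat ` D g)"
  unfolding fine_grading_def supp_to_mat_D
proof (intro conjI ballI)
  show "grading G (full_mat TYPE('f) n) (\<lambda>g. to_mat ` D g)"
    by (rule corner.grading_image[OF internal_grading_D])
  fix g assume "g \<in> H"
  then obtain x where x: "x \<in> D g" "x \<noteq> 0" "g \<in> carrier G"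
    by (rule H_E)
  interpret line: linear_onto smul "D g" "full_mat TYPE('f) n\<lparr>carrier := to_mat ` D g\<rparr>" to_mat
  proof
    show "rmat.subspace (D g)"
      by (rule D_subspace[OF x(3)])
  qed (simp_all add: corner.h_add corner.h_scale corner.h_zero subsetD[OF D_Cor[OF x(3)]])
  show "vectorspace.dim class_ring (full_mat TYPE('f) n\<lparr>carrier := to_mat ` D g\<rparr>) = 1"
  proof (rule line.dim_eq_1[OF _ x(1)])
    show "D g \<subseteq> range (\<lambda>c. smul c x)"
    proof
      fix y assume "y \<in> D g"
      then obtain c where "y = smul c x"
        using D_one_dimensional x by metis
      then show "y \<in> range (\<lambda>c. smul c x)"
        by blast
    qed
    have "to_mat x \<noteq> to_mat 0"
      using corner.h_inj D_Cor[OF x(3)] x rmat.subspace_0[OF subspace_Cor]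
      by (metis inj_onD subsetD)
    then show "to_mat x \<noteq> \<zero>\<^bsub>full_mat TYPE('f) n\<lparr>carrier := to_mat ` D g\<rparr>\<^esub>"
      by (simp add: corner.h_zero)
  qed
qed

abbreviation homogeneous where
  "homogeneous k \<equiv> {theta x (to_mat d) | x d g h. g \<in> carrier G \<and> h \<in> carrier G \<and>
    x \<in> elementary_component G s g \<and> d \<in> D h \<and> g \<otimes> h = k}"

text \<open>A term \<open>v i * d * u j\<close> has degree
  \<open>inv (s i) \<otimes> h \<otimes> s j\<close>, and commutativity turns this into
  \<open>g \<otimes> h\<close>.\<close>

lemma theta_homogeneous:
  assumes x: "x \<in> elementary_component G s g" and d: "d \<in> D h" and gh: "g \<in> carrier G" "h \<in> carrier G"
  shows "theta x (to_mat d) \<in> S (g \<otimes> h)"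
  unfolding theta_def
proof (rule rmat.subspace_sum[OF S_subspace])
  fix p assume "p \<in> {(i, j). entry x i j \<noteq> 0}"
  then obtain i j where p: "p = (i, j)" "entry x i j \<noteq> 0"
    by auto
  then have "inv (s i) \<otimes> s j = g"
    using x by (simp add: elementary_component_def)
  then have "inv (s i) \<otimes> h \<otimes> s j = g \<otimes> h"
    using s_carrier gh by (metis inv_closed m_assoc m_comm)
  moreover have "d \<in> S h" "of_mat (to_mat d) = d"
    using d D_Cor[OF gh(2)] of_mat_to_mat by (auto simp: D_def)
  ultimately have "v i * of_mat (to_mat d) * u j \<in> S (g \<otimes> h)"
    using S_mult[OF S_mult[OF v_S] u_S] s_carrier gh by (metis inv_closed m_closed)
  then show "(case p of (i, j) \<Rightarrow> smul (entry x i j) (v i * of_mat (to_mat d) * u j)) \<in> S (g \<otimes> h)"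
    using gh by (simp add: p S_smul)
qed (use gh in simp)

text \<open>For \<open>z\<close> of degree \<open>k\<close> the coordinate
  \<open>u i * z * v j\<close> is homogeneous of degree
  \<open>s i \<otimes> k \<otimes> inv (s j)\<close>, which together with the degree of
  \<open>E i j\<close> multiplies to \<open>k\<close>. The coordinate expansion therefore writes
  \<open>z\<close> as a sum of generators.\<close>

lemma S_eq_span_homogeneous:
  assumes k: "k \<in> carrier G"
  shows "S k = rmat.span (homogeneous k)"
proof
  show "rmat.span (homogeneous k) \<subseteq> S k"
    by (rule rmat.span_minimal[OF _ S_subspace[OF k]]) (auto intro: theta_homogeneous)
  show "S k \<subseteq> rmat.span (homogeneous k)"
  proof
    fix z assume z: "z \<in> S k"
    then have zF: "z \<in> Fin"
      using S_Fin k by blast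
    then obtain L where L: "z = (\<Sum>i<L. \<Sum>j<L. v i * (u i * z * v j) * u j)"
      by (rule coordinate_expansion)
    have "v i * (u i * z * v j) * u j \<in> homogeneous k" for i j
    proof -
      let ?d = "u i * z * v j"
      have d: "?d \<in> Cor"
        by (rule coordinate_Cor[OF zF])
      have "?d \<in> S (s i \<otimes> k \<otimes> inv (s j))"
        using S_mult[OF S_mult[OF u_S z] v_S] s_carrier k by simp
      then have "?d \<in> D (s i \<otimes> k \<otimes> inv (s j))"
        using d by (simp add: D_def Cor_def)
      moreover have "E i j \<in> elementary_component G s (inv (s i) \<otimes> s j)"
        by (auto simp: elementary_component_def entry_E split: if_splits)
      moreover have "inv (s i) \<otimes> s j \<otimes> (s i \<otimes> k \<otimes> inv (s j)) = k"
      proof -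
        let ?x = "s i" and ?y = "s j"
        have "inv ?x \<otimes> ?y \<otimes> (?x \<otimes> k \<otimes> inv ?y) = ?x \<otimes> k \<otimes> (inv ?y \<otimes> (inv ?x \<otimes> ?y))"
          using m_comm[of "inv ?x \<otimes> ?y" "?x \<otimes> k \<otimes> inv ?y"]
            m_assoc[of "?x \<otimes> k" "inv ?y" "inv ?x \<otimes> ?y"] s_carrier k by simp
        also have "inv ?y \<otimes> (inv ?x \<otimes> ?y) = inv ?x"
          using m_lcomm[of "inv ?y" "inv ?x" ?y] s_carrier by simp
        also have "?x \<otimes> k \<otimes> inv ?x = k"
          using m_comm[of ?x k] m_assoc[of k ?x "inv ?x"] s_carrier k by simp
        finally show ?thesis .
      qed
      moreover have "v i * ?d * u j = theta (E i j) (to_mat ?d)"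
        by (simp add: theta_E of_mat_to_mat d)
      moreover have "inv (s i) \<otimes> s j \<in> carrier G" "s i \<otimes> k \<otimes> inv (s j) \<in> carrier G"
        using s_carrier k by simp_all
      ultimately show ?thesis
        by (intro CollectI exI[of _ "E i j"] exI[of _ ?d] exI[of _ "inv (s i) \<otimes> s j"]
            exI[of _ "s i \<otimes> k \<otimes> inv (s j)"] conjI)
    qed
    then have "(\<Sum>i<L. \<Sum>j<L. v i * (u i * z * v j) * u j) \<in> rmat.span (homogeneous k)"
      by (intro rmat.span_sum rmat.span_base)
    then show "z \<in> rmat.span (homogeneous k)"
      unfolding L[symmetric] .
  qed
qed

lemma tensor_grading_image:
  assumes k: "k \<in> carrier G"
  shows "tensor_grading G (finitary_mat TYPE('f)) (\<lambda>g. entry ` elementary_component G s g)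
      (full_mat TYPE('f) n) (\<lambda>g. to_mat ` D g) k = coset_of ` S k"
proof -
  have Fin: "homogeneous k \<subseteq> Fin"
    by (auto simp: elementary_component_def intro: theta_Fin)
  have elem: "tensor_elem (finitary_mat TYPE('f)) (full_mat TYPE('f) n) (entry x) (to_mat d) =
      coset_of (theta x (to_mat d))" if "x \<in> elementary_component G s g" for x d g
    using that tensor_elem_coset[of "entry x" "to_mat d"]
    by (simp add: elementary_component_def finitary.closed full_carrier tensor_map_entry)
  have "{tensor_elem (finitary_mat TYPE('f)) (full_mat TYPE('f) n) c d | c d g h.
      g \<in> carrier G \<and> h \<in> carrier G \<and> c \<in> entry ` elementary_component G s g \<and> d \<in> to_mat ` D h \<and>
      g \<otimes> h = k} = coset_of ` homogeneous k" (is "?L = ?R")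
  proof
    show "?L \<subseteq> ?R"
    proof
      fix y assume "y \<in> ?L"
      then obtain x d g h where "g \<in> carrier G" "h \<in> carrier G" "x \<in> elementary_component G s g" "d \<in> D h"
        "g \<otimes> h = k" "y = tensor_elem (finitary_mat TYPE('f)) (full_mat TYPE('f) n) (entry x) (to_mat d)"
        by blast
      moreover from this have "y = coset_of (theta x (to_mat d))"
        using elem by blast
      ultimately show "y \<in> ?R"
        by blast
    qed
    show "?R \<subseteq> ?L"
    proof
      fix y assume "y \<in> ?R"
      then obtain x d g h where xd: "g \<in> carrier G" "h \<in> carrier G" "x \<in> elementary_component G s g" "d \<in> D h"
        "g \<otimes> h = k" "y = coset_of (theta x (to_mat d))"
        by blast
      moreover from xd have "y = tensor_elem (finitary_mat TYPE('f)) (full_mat TYPE('f) n) (entry x) (to_mat d)"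
        using elem by metis
      ultimately show "y \<in> ?L"
        by blast
    qed
  qed
  then show ?thesis
    unfolding tensor_grading_def using tensor.lin_span_image[OF Fin] S_eq_span_homogeneous[OF k] by simp
qed

text \<open>A common degree is a quotient \<open>inv (s i) \<otimes> s j\<close> lying in
  \<open>H\<close>; the transversal condition forces \<open>s i = s j\<close>, so the quotient is
  \<open>\<one>\<close>.\<close>

lemma supp_intersection:
  assumes "n \<ge> 1"
  shows "supp G (finitary_mat TYPE('f)) (\<lambda>g. entry ` (elementary_component G s g :: 'f rmat set)) \<inter>
    supp G (full_mat TYPE('f) n) (\<lambda>g. to_mat ` D g) = {\<one>}"
proof
  let ?C = "\<lambda>g. entry ` (elementary_component G s g :: 'f rmat set)"
  show "supp G (finitary_mat TYPE('f)) ?C \<inter> supp G (full_mat TYPE('f) n) (\<lambda>g. to_mat ` D g) \<subseteq> {\<one>}"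
  proof
    fix g assume "g \<in> supp G (finitary_mat TYPE('f)) ?C \<inter> supp G (full_mat TYPE('f) n) (\<lambda>g. to_mat ` D g)"
    then have "g \<in> supp G (finitary_mat TYPE('f)) ?C" "g \<in> H"
      unfolding supp_to_mat_D by auto
    moreover from this(1) obtain i j where "inv (s i) \<otimes> s j = g"
      by (rule supp_elementary)
    ultimately show "g \<in> {\<one>}"
      using s_coset[of i j] s_carrier[of j] by auto
  qed
  have "E 0 0 \<in> elementary_component G s \<one>"
    using s_carrier by (auto simp: elementary_component_def entry_E split: if_splits)
  then have "entry (E 0 0) \<in> ?C \<one>"
    by blast
  moreover have "entry (E 0 0) \<noteq> entry (0 :: 'f rmat)"
    by (simp add: entry_inject)
  ultimately have "?C \<one> \<noteq> {\<zero>\<^bsub>finitary_mat TYPE('f)\<^esub>}"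
    unfolding finitary.h_zero[symmetric] by blast
  moreover have "\<one> \<in> H"
    by (rule subgroup.one_closed[OF H_subgroup])
  ultimately show "{\<one>} \<subseteq> supp G (finitary_mat TYPE('f)) ?C \<inter> supp G (full_mat TYPE('f) n) (\<lambda>g. to_mat ` D g)"
    unfolding supp_to_mat_D by (simp add: supp_def)
qed

end

theorem theorem5:
  fixes G :: "('g, 'm) monoid_scheme"
    and R :: "'g \<Rightarrow> (nat \<Rightarrow> nat \<Rightarrow> 'f::{alg_closed_field, field_char_0}) set"
  assumes "comm_group G" and "finite (carrier G)"
    and "grading G (finitary_mat TYPE('f)) R"
  shows "\<exists>(C :: 'g \<Rightarrow> (nat \<Rightarrow> nat \<Rightarrow> 'f) set) (n :: nat) (D :: 'g \<Rightarrow> 'f mat set).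
    elementary_grading G C \<and> n \<ge> 1 \<and> fine_grading G n D \<and>
    graded_isomorphic G (finitary_mat TYPE('f)) R
      (tensor_alg (finitary_mat TYPE('f)) (full_mat TYPE('f) n))
      (tensor_grading G (finitary_mat TYPE('f)) C (full_mat TYPE('f) n) D) \<and>
    supp G (finitary_mat TYPE('f)) C \<inter> supp G (full_mat TYPE('f) n) D = {\<one>\<^bsub>G\<^esub>}"
proof -
  define S where "S g = {x \<in> Fin. entry x \<in> R g}" for g
  interpret graded_fin G S
  proof (intro graded_fin.intro graded_fin_axioms.intro assms(1,2))
    show "internal_grading G Fin S"
      unfolding S_def by (rule finitary.grading_vimage[OF assms(3)])
  qed
  obtain e where e: "e \<in> S \<one>\<^bsub>G\<^esub>" "e * e = e" "e \<noteq> 0"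
    "\<forall>f\<in>S \<one>\<^bsub>G\<^esub>. f * f = f \<longrightarrow> e * f = f \<longrightarrow> f * e = f \<longrightarrow> f \<noteq> 0 \<longrightarrow> f = e"
    using ex_minimal_idempotent by blast
  interpret graded_fin_idempotent G S e
    by unfold_locales (use e in auto)
  obtain s :: "nat \<Rightarrow> 'g" and u v :: "nat \<Rightarrow> 'f rmat" where
    suv: "\<And>n. s n \<in> carrier G" "\<And>n. u n \<in> S (s n)" "\<And>n. v n \<in> S (inv\<^bsub>G\<^esub> (s n))"
    "\<And>n. e * u n = u n" "\<And>n. v n * e = v n" "\<And>m n. u m * v n = (if m = n then e else 0)"
    "\<And>x. x \<in> Fin \<Longrightarrow> \<exists>N. \<forall>n\<ge>N. (\<Sum>i<n. v i * u i) * x = x \<and> x * (\<Sum>i<n. v i * u i) = x"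
    "\<And>m n. inv\<^bsub>G\<^esub> (s m) \<otimes>\<^bsub>G\<^esub> s n \<in> H \<Longrightarrow> s m = s n"
    by (rule ex_normalized_dual_bases) (rule that)
  obtain n :: nat and a b where nab: "e = (\<Sum>k<n. b k * a k)"
    "\<forall>k. E 0 0 * a k = a k \<and> b k * E 0 0 = b k \<and> a k \<in> Fin \<and> b k \<in> Fin"
    "\<forall>k<n. \<forall>l<n. a k * b l = (if k = l then E 0 0 else 0)"
    using idempotent_matrix_units[OF e_Fin e_idem] by blast
  interpret graded_framed G S e n a b u v s
  proof (intro graded_framed.intro graded_framed_axioms.intro framed.intro framed_axioms.intro
      corner_units.intro graded_fin_idempotent_axioms)
  qed (use suv nab in \<open>auto intro: S_Fin\<close>)
  \<comment> \<open>For \<open>n = 0\<close> the nonzero idempotent \<open>e\<close> would be an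
    empty sum.\<close>
  have "n \<ge> 1"
    using e_sum e_nonzero by (cases n) auto
  let ?C = "\<lambda>g. entry ` (elementary_component G s g :: 'f rmat set)"
  let ?D = "\<lambda>g. to_mat ` D g"
  have "graded_isomorphic G (finitary_mat TYPE('f)) R
      (tensor_alg (finitary_mat TYPE('f)) (full_mat TYPE('f) n))
      (tensor_grading G (finitary_mat TYPE('f)) ?C (full_mat TYPE('f) n) ?D)"
    unfolding graded_isomorphic_def
  proof (intro bexI[OF _ coset_of_Rmat_alg_iso] ballI)
    fix g assume g: "g \<in> carrier G"
    then have "VectorSpace.subspace class_ring (R g) (finitary_mat TYPE('f))"
      using assms(3) by (simp add: grading_def)
    then have "R g \<subseteq> carrier (finitary_mat TYPE('f))"
      by (simp add: VectorSpace.subspace_def submodule_def)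
    then have "R g = entry ` S g"
      unfolding S_def finitary.image[symmetric] by blast
    then have "(\<lambda>X. coset_of (Rmat X)) ` R g = coset_of ` S g"
      by (simp add: image_image entry_inverse)
    then show "(\<lambda>X. coset_of (Rmat X)) ` R g =
        tensor_grading G (finitary_mat TYPE('f)) ?C (full_mat TYPE('f) n) ?D g"
      by (simp add: tensor_grading_image[OF g])
  qed
  moreover have "elementary_grading G ?C"
    by (rule elementary_grading_entry[OF group_axioms assms(2) suv(1)])
  ultimately show ?thesis
    using \<open>n \<ge> 1\<close> fine_grading_to_mat_D supp_intersection by blast
qed

end
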